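(* Every automorphism of the compact quantum group $SO_{-1}(3)$ is given by $A\mapsto\rho(x)^{\top}A\rho(x)$ for some $x\in S_4$, where $A=(a_{i,j})_{1\le i,j\le3}$ is the fundamental corepresentation of $C(SO_{-1}(3))$ (that is, every automorphism $\theta$ satisfies $(\theta(a_{i,j}))_{i,j}=\rho(x)^{\top}A\rho(x)$ for some $x\in S_4$). In other words, $\mathrm{Aut}(SO_{-1}(3))\cong S_4$.
   Context: $C(SO_{-1}(3))$ is the universal $C^*$-algebra generated by self-adjoint elements $a_{i,j}$, $1\le i,j\le3$, subject to: (1) $A=(a_{i,j})$ is orthogonal, $AA^\top=A^\top A=\mathbf 1$; (2) $a_{i,j}a_{i,k}=-a_{i,k}a_{i,j}$ for $k\ne j$; (3) $a_{i,j}a_{k,j}=-a_{k,j}a_{i,j}$ for $k\neq i$; (4) $a_{i,j}a_{k,l}=a_{k,l}a_{i,j}$ for $i\ne k$, $j\ne l$; (5) $\sum_{\sigma\in S_3}a_{1,\sigma(1)}a_{2,\sigma(2)}a_{3,\sigma(3)}=\mathbf 1$. The coproduct is $\Delta(a_{i,j})=\sum_k a_{i,k}\otimes a_{k,j}$. An automorphism of a compact quantum group $\mathbb{G}$ is a ${}^*$-automorphism $\theta$ of $C^u(\mathbb{G})$ (equivalently of the Hopf ${}^*$-algebra $\mathcal{O}(\mathbb{G})$) intertwining the coproduct, $(\theta\otimes\theta)\circ\Delta=\Delta\circ\theta$; $\mathrm{Aut}(\mathbb{G})$ is the group of these. $SO_{-1}(3)$ is coamenable, so $C^u(SO_{-1}(3))=C(SO_{-1}(3))$.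 $\rho\colon S_4\to O(3)$ is the homomorphism obtained by restricting the permutation representation of $S_4$ on $\mathbb{R}^4$ to the subspace $(1,1,1,1)^\perp$, written as matrices in the orthonormal basis $\tfrac12(1,1,-1,-1)$, $\tfrac12(1,-1,1,-1)$, $\tfrac12(1,-1,-1,1)$; in this basis $\rho$ maps $\{\mathrm{id},(12)(34),(13)(24),(14)(23)\}$ onto the group of diagonal matrices with entries $\pm1$ and determinant $1$. *)

theory Defs
  imports "HOL-Analysis.Analysis" "HOL-Algebra.Sym_Groups" "HOL-Library.Poly_Mapping"
begin

section \<open>Complex star-algebras and C*-algebras\<close>

class complex_star_algebra = ring_1 +
  fixes scaleC :: "complex \<Rightarrow> 'a \<Rightarrow> 'a" (infixr "*\<^sub>C" 75)
    and adj :: "'a \<Rightarrow> 'a"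
  assumes scaleC_add_right: "c *\<^sub>C (x + y) = c *\<^sub>C x + c *\<^sub>C y"
    and scaleC_add_left: "(c + d) *\<^sub>C x = c *\<^sub>C x + d *\<^sub>C x"
    and scaleC_scaleC: "c *\<^sub>C (d *\<^sub>C x) = (c * d) *\<^sub>C x"
    and scaleC_one: "1 *\<^sub>C x = x"
    and mult_scaleC_left: "(c *\<^sub>C x) * y = c *\<^sub>C (x * y)"
    and mult_scaleC_right: "x * (c *\<^sub>C y) = c *\<^sub>C (x * y)"
    and adj_adj: "adj (adj x) = x"
    and adj_add: "adj (x + y) = adj x + adj y"
    and adj_scaleC: "adj (c *\<^sub>C x) = cnj c *\<^sub>C adj x"
    and adj_mult: "adj (x * y) = adj y * adj x"

text \<open>Unital, with \<open>1 \<noteq> 0\<close>; complete because of \<open>banach\<close>.\<close>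

class cstar_algebra = complex_star_algebra + real_normed_algebra_1 + banach +
  assumes scaleR_scaleC: "scaleR r x = complex_of_real r *\<^sub>C x"
    and norm_scaleC: "norm (c *\<^sub>C x) = cmod c * norm x"
    and cstar_identity: "norm (adj x * x) = (norm x)\<^sup>2"

definition clinear_map :: "('a::complex_star_algebra \<Rightarrow> 'b::complex_star_algebra) \<Rightarrow> bool" where
  "clinear_map f \<longleftrightarrow> (\<forall>x y. f (x + y) = f x + f y) \<and> (\<forall>c x. f (c *\<^sub>C x) = c *\<^sub>C f x)"

definition star_hom :: "('a::complex_star_algebra \<Rightarrow> 'b::complex_star_algebra) \<Rightarrow> bool" where
  "star_hom f \<longleftrightarrow> clinear_map f \<and> f 1 = 1 \<and>
     (\<forall>x y. f (x * y) = f x * f y) \<and> (\<forall>x. f (adj x) = adj (f x))"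

instantiation complex :: complex_star_algebra
begin

definition scaleC_complex :: "complex \<Rightarrow> complex \<Rightarrow> complex" where
  "scaleC_complex c x = c * x"

definition adj_complex :: "complex \<Rightarrow> complex" where
  "adj_complex = cnj"

instance
  by standard (simp_all add: scaleC_complex_def adj_complex_def algebra_simps)

end

section \<open>The free star-algebra on self-adjoint generators\<close>

text \<open>
  The free unital complex star-algebra on self-adjoint generators indexed by \<open>'g\<close> is the monoid
  algebra \<open>'g word \<Rightarrow>\<^sub>0 complex\<close> of the free monoid on \<open>'g\<close>. The monoid is
  written additively because \<open>Poly_Mapping\<close> convolves along \<open>+\<close>; the involution reverses words
  and conjugates coefficients.
\<close>

datatype 'g word = Word (letters: "'g list")

class involutive_monoid = monoid_add +
  fixes flip :: "'a \<Rightarrow> 'a"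
  assumes flip_flip: "flip (flip x) = x"
    and flip_add: "flip (x + y) = flip y + flip x"

lemma flip_eq_iff: "flip x = flip y \<longleftrightarrow> x = (y :: 'a::involutive_monoid)"
  by (metis flip_flip)

lemma flip_zero: "flip 0 = (0 :: 'a::involutive_monoid)"
  by (metis add_0_left add_0_right flip_add flip_flip)

instantiation word :: (type) involutive_monoid
begin

definition zero_word :: "'a word" where "zero_word = Word []"

definition plus_word :: "'a word \<Rightarrow> 'a word \<Rightarrow> 'a word" where
  "plus_word u v = Word (letters u @ letters v)"

definition flip_word :: "'a word \<Rightarrow> 'a word" where
  "flip_word u = Word (rev (letters u))"

instance
  by standard (simp_all add: zero_word_def plus_word_def flip_word_def)

end

lemma scaleC_zero_right: "c *\<^sub>C 0 = (0 :: 'a::complex_star_algebra)"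
  by (metis add_cancel_right_right scaleC_add_right)

lemma adj_zero: "adj 0 = (0 :: 'a::complex_star_algebra)"
  by (metis add_cancel_right_right adj_add)

lemma single_sum_induct:
  fixes p :: "'a \<Rightarrow>\<^sub>0 'b::comm_monoid_add"
  assumes "\<And>w c. P (Poly_Mapping.single w c)" "\<And>p q. P p \<Longrightarrow> P q \<Longrightarrow> P (p + q)"
  shows "P p"
proof (induction p rule: update_induct)
  case const
  show ?case using assms(1)[of undefined 0] by simp
next
  case (update f a b)
  have "Poly_Mapping.update a b f = Poly_Mapping.single a b + f"
    using update(1)
    by (intro poly_mapping_eqI)
      (auto simp: lookup_update lookup_add lookup_single when_def in_keys_iff)
  then show ?case using assms update by simp
qed

instantiation poly_mapping :: (involutive_monoid, complex_star_algebra) complex_star_algebra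
begin

lift_definition scaleC_poly_mapping :: "complex \<Rightarrow> ('a \<Rightarrow>\<^sub>0 'b) \<Rightarrow> ('a \<Rightarrow>\<^sub>0 'b)"
  is "\<lambda>c p w. c *\<^sub>C p w"
  by (metis (mono_tags, lifting) Collect_mono finite_subset scaleC_zero_right)

lift_definition adj_poly_mapping :: "('a \<Rightarrow>\<^sub>0 'b) \<Rightarrow> ('a \<Rightarrow>\<^sub>0 'b)"
  is "\<lambda>p w. adj (p (flip w))"
proof -
  fix p :: "'a \<Rightarrow> 'b" assume *: "finite {w. p w \<noteq> 0}"
  have "{w. adj (p (flip w)) \<noteq> 0} \<subseteq> flip ` {w. p w \<noteq> 0}"
    by (auto simp: image_iff) (metis adj_zero flip_flip)
  then show "finite {w. adj (p (flip w)) \<noteq> 0}"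
    using * finite_surj by blast
qed

instance
proof
  fix c d :: complex and x y :: "'a \<Rightarrow>\<^sub>0 'b"
  have scale_single: "c *\<^sub>C Poly_Mapping.single w b = Poly_Mapping.single w (c *\<^sub>C b)"
    for c and w :: 'a and b :: 'b
    by (intro poly_mapping_eqI)
      (simp add: scaleC_poly_mapping.rep_eq lookup_single when_def scaleC_zero_right)
  have adj_single: "adj (Poly_Mapping.single w b) = Poly_Mapping.single (flip w) (adj b)"
    for w :: 'a and b :: 'b
    by (intro poly_mapping_eqI)
      (auto simp: adj_poly_mapping.rep_eq lookup_single when_def adj_zero flip_flip)
  show sr: "c *\<^sub>C (x + y) = c *\<^sub>C x + c *\<^sub>C y" for x y :: "'a \<Rightarrow>\<^sub>0 'b"
    by transfer (simp add: scaleC_add_right)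
  show "(c + d) *\<^sub>C x = c *\<^sub>C x + d *\<^sub>C x"
    by transfer (simp add: scaleC_add_left)
  show "c *\<^sub>C (d *\<^sub>C x) = (c * d) *\<^sub>C x"
    by transfer (simp add: scaleC_scaleC)
  show "1 *\<^sub>C x = x"
    by transfer (simp add: scaleC_one)
  show "adj (adj x) = x"
    by transfer (simp add: adj_adj flip_flip)
  show aa: "adj (x + y) = adj x + adj y" for x y :: "'a \<Rightarrow>\<^sub>0 'b"
    by transfer (simp add: adj_add)
  show "adj (c *\<^sub>C x) = cnj c *\<^sub>C adj x"
    by transfer (simp add: adj_scaleC)
  show "(c *\<^sub>C x) * y = c *\<^sub>C (x * y)"
  proof (induction x rule: single_sum_induct)
    case (1 w a)
    show ?case
      by (induction y rule: single_sum_induct)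
        (simp_all add: scale_single mult_single mult_scaleC_left distrib_left sr)
  qed (simp add: sr distrib_right)
  show "x * (c *\<^sub>C y) = c *\<^sub>C (x * y)"
  proof (induction x rule: single_sum_induct)
    case (1 w a)
    show ?case
      by (induction y rule: single_sum_induct)
        (simp_all add: scale_single mult_single mult_scaleC_right distrib_left sr)
  qed (simp add: sr distrib_right)
  show "adj (x * y) = adj y * adj x"
  proof (induction x rule: single_sum_induct)
    case (1 w a)
    show ?case
      by (induction y rule: single_sum_induct)
        (simp_all add: adj_single mult_single adj_mult flip_add distrib_left distrib_right aa)
  qed (simp add: aa distrib_left distrib_right)
qed

end

section \<open>The C*-algebra \<open>C(SO\<^sub>-\<^sub>1(3))\<close>\<close>

text \<open>
  The defining relations, each written as an element that is required to vanish. In the numeral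
  type \<open>3\<close> the three indices are \<open>1, 2, 3\<close> (where \<open>3 = 0\<close>).
\<close>

definition so_relators :: "'a::complex_star_algebra^3^3 \<Rightarrow> 'a set" where
  "so_relators A =
     {adj (A$i$j) - A$i$j | i j. True} \<union>
     {(A ** transpose A - mat 1)$i$j | i j. True} \<union>
     {(transpose A ** A - mat 1)$i$j | i j. True} \<union>
     {A$i$j * A$i$k + A$i$k * A$i$j | i j k. k \<noteq> j} \<union>
     {A$i$j * A$k$j + A$k$j * A$i$j | i j k. k \<noteq> i} \<union>
     {A$i$j * A$k$l - A$k$l * A$i$j | i j k l. i \<noteq> k \<and> j \<noteq> l} \<union>
     {(\<Sum>\<sigma> | \<sigma> permutes (UNIV :: 3 set). A$1$(\<sigma> 1) * A$2$(\<sigma> 2) * A$3$(\<sigma> 3)) - 1}"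

type_synonym free_so = "(3 \<times> 3) word \<Rightarrow>\<^sub>0 complex"

definition free_gen :: "free_so^3^3" where
  "free_gen = (\<chi> i j. Poly_Mapping.single (Word [(i, j)]) 1)"

definition eval_free :: "'a::complex_star_algebra^3^3 \<Rightarrow> free_so \<Rightarrow> 'a" where
  "eval_free A p =
     (\<Sum>w\<in>Poly_Mapping.keys p.
        Poly_Mapping.lookup p w *\<^sub>C prod_list (map (\<lambda>(i, j). A$i$j) (letters w)))"

definition cstar_seminorm :: "('a::complex_star_algebra \<Rightarrow> real) \<Rightarrow> bool" where
  "cstar_seminorm s \<longleftrightarrow>
     (\<forall>x y. s (x + y) \<le> s x + s y) \<and> (\<forall>c x. s (c *\<^sub>C x) = cmod c * s x) \<and>
     (\<forall>x y. s (x * y) \<le> s x * s y) \<and> (\<forall>x. s (adj x * x) = (s x)\<^sup>2)"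

text \<open>
  \<open>is_C_SO A\<close>: the ambient C*-algebra is the universal C*-algebra of the relations, with \<open>A\<close> as
  its matrix of generators, i.e. it is the Hausdorff completion of the free star-algebra in the
  largest C*-seminorm that kills the relators. HOL cannot quantify over all target C*-algebras
  \<open>B\<close> inside a formula; such seminorms \<open>s\<close> are exactly the functions \<open>\<lambda>p. norm (\<pi> p)\<close>
  for representations \<open>\<pi>\<close> of the relations in C*-algebras, and the last clause says that every such
  \<open>\<pi>\<close> factors through \<open>'a\<close>.
\<close>

definition is_C_SO :: "'a::cstar_algebra^3^3 \<Rightarrow> bool" where
  "is_C_SO A \<longleftrightarrow>
     so_relators A \<subseteq> {0} \<and>
     closure (range (eval_free A)) = UNIV \<and>
     (\<forall>s. cstar_seminorm s \<and> (\<forall>r\<in>so_relators free_gen. s r = 0) \<longrightarrow>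
        (\<forall>p. s p \<le> norm (eval_free A p)))"

section \<open>The minimal (spatial) tensor product\<close>

definition state :: "('a::cstar_algebra \<Rightarrow> complex) \<Rightarrow> bool" where
  "state \<phi> \<longleftrightarrow> clinear_map \<phi> \<and> \<phi> 1 = 1 \<and> (\<forall>x. \<phi> (adj x * x) \<in> \<real>\<^sub>\<ge>\<^sub>0)"

text \<open>
  A list \<open>[(x\<^sub>1, y\<^sub>1), \<dots>]\<close> stands for the element \<open>\<Sum> x\<^sub>k \<otimes> y\<^sub>k\<close> of the algebraic
  tensor product.
\<close>

definition tprod :: "('a::complex_star_algebra \<times> 'c::complex_star_algebra) list \<Rightarrow>
    ('a \<times> 'c) list \<Rightarrow> ('a \<times> 'c) list" where
  "tprod ts us = [(x * u, y * v). (x, y) \<leftarrow> ts, (u, v) \<leftarrow> us]"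

definition tadj :: "('a::complex_star_algebra \<times> 'c::complex_star_algebra) list \<Rightarrow>
    ('a \<times> 'c) list" where
  "tadj ts = [(adj x, adj y). (x, y) \<leftarrow> ts]"

definition tfun :: "('a \<Rightarrow> complex) \<Rightarrow> ('c \<Rightarrow> complex) \<Rightarrow> ('a \<times> 'c) list \<Rightarrow> complex" where
  "tfun \<phi> \<psi> ts = (\<Sum>(x, y)\<leftarrow>ts. \<phi> x * \<psi> y)"

text \<open>
  With the GNS representations \<open>\<pi>\<^sub>\<phi>\<close>, \<open>\<pi>\<^sub>\<psi>\<close>, the algebraic tensors \<open>z\<close> give the dense
  subspace of vectors \<open>\<Lambda> z\<close> of \<open>H\<^sub>\<phi> \<otimes> H\<^sub>\<psi>\<close>, with \<open>norm (\<Lambda> z)\<^sup>2 = (\<phi> \<otimes> \<psi>)(z\<^sup>* z)\<close> and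
  \<open>norm ((\<pi>\<^sub>\<phi> \<otimes> \<pi>\<^sub>\<psi>)(t) (\<Lambda> z))\<^sup>2 = (\<phi> \<otimes> \<psi>)(z\<^sup>* t\<^sup>* t z)\<close>. Hence \<open>spatial_bound t C\<close> says that
  \<open>C\<close> bounds the operator norms of \<open>(\<pi>\<^sub>\<phi> \<otimes> \<pi>\<^sub>\<psi>)(t)\<close> for all states \<open>\<phi>\<close>, \<open>\<psi>\<close>, and the
  spatial norm of \<open>t\<close> is the least such \<open>C\<close>.
\<close>

definition spatial_bound ::
  "('a::cstar_algebra \<times> 'c::cstar_algebra) list \<Rightarrow> real \<Rightarrow> bool" where
  "spatial_bound ts C \<longleftrightarrow> 0 \<le> C \<and>
     (\<forall>\<phi> \<psi> zs. state \<phi> \<and> state \<psi> \<longrightarrow>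
        Re (tfun \<phi> \<psi> (tprod (tadj (tprod ts zs)) (tprod ts zs)))
          \<le> C\<^sup>2 * Re (tfun \<phi> \<psi> (tprod (tadj zs) zs)))"

definition tsum :: "('a \<Rightarrow> 'c \<Rightarrow> 'b::comm_monoid_add) \<Rightarrow> ('a \<times> 'c) list \<Rightarrow> 'b" where
  "tsum tens ts = (\<Sum>(x, y)\<leftarrow>ts. tens x y)"

text \<open>\<open>'b\<close>, with \<open>tens x y\<close> as the elementary tensors, is the spatial tensor product of \<open>'a\<close>
  and \<open>'c\<close>.\<close>

definition is_min_tensor ::
  "('a::cstar_algebra \<Rightarrow> 'c::cstar_algebra \<Rightarrow> 'b::cstar_algebra) \<Rightarrow> bool" where
  "is_min_tensor tens \<longleftrightarrow>
     (\<forall>y. clinear_map (\<lambda>x. tens x y)) \<and> (\<forall>x. clinear_map (tens x)) \<and>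
     tens 1 1 = 1 \<and>
     (\<forall>x y u v. tens x y * tens u v = tens (x * u) (y * v)) \<and>
     (\<forall>x y. adj (tens x y) = tens (adj x) (adj y)) \<and>
     closure (range (tsum tens)) = UNIV \<and>
     (\<forall>ts. spatial_bound ts (norm (tsum tens ts)) \<and>
        (\<forall>C. spatial_bound ts C \<longrightarrow> norm (tsum tens ts) \<le> C))"

section \<open>Quantum group automorphisms\<close>

definition is_coproduct ::
  "('a::cstar_algebra \<Rightarrow> 'a \<Rightarrow> 'b::cstar_algebra) \<Rightarrow> 'a^3^3 \<Rightarrow> ('a \<Rightarrow> 'b) \<Rightarrow> bool" where
  "is_coproduct tens A \<Delta> \<longleftrightarrow>
     star_hom \<Delta> \<and> (\<forall>i j. \<Delta> (A$i$j) = (\<Sum>k\<in>UNIV. tens (A$i$k) (A$k$j)))"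

text \<open>\<open>T\<close> is \<open>\<theta> \<otimes> \<theta>\<close>: star-homomorphisms of C*-algebras are continuous, so it is determined by
  its values on elementary tensors.\<close>

definition qg_automorphism ::
  "('a::cstar_algebra \<Rightarrow> 'a \<Rightarrow> 'b::cstar_algebra) \<Rightarrow> ('a \<Rightarrow> 'b) \<Rightarrow> ('a \<Rightarrow> 'a) \<Rightarrow> bool" where
  "qg_automorphism tens \<Delta> \<theta> \<longleftrightarrow>
     star_hom \<theta> \<and> bij \<theta> \<and>
     (\<exists>T. star_hom T \<and> (\<forall>x y. T (tens x y) = tens (\<theta> x) (\<theta> y)) \<and> T \<circ> \<Delta> = \<Delta> \<circ> \<theta>)"

definition qg_Aut ::
  "('a::cstar_algebra \<Rightarrow> 'a \<Rightarrow> 'b::cstar_algebra) \<Rightarrow> ('a \<Rightarrow> 'b) \<Rightarrow> ('a \<Rightarrow> 'a) monoid" where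
  "qg_Aut tens \<Delta> = \<lparr>carrier = {\<theta>. qg_automorphism tens \<Delta> \<theta>}, mult = (\<circ>), one = id\<rparr>"

section \<open>The representation \<open>\<rho>\<close> of \<open>S\<^sub>4\<close>\<close>

text \<open>Coordinates of \<open>\<real>\<^sup>4\<close> are numbered \<open>1, \<dots>, 4\<close>, the points permuted by \<open>sym_group 4\<close>.\<close>

definition rho_basis :: "3 \<Rightarrow> nat \<Rightarrow> real" where
  "rho_basis i k =
     (if i = 1 then [1, 1, -1, -1] else if i = 2 then [1, -1, 1, -1] else [1, -1, -1, 1]) ! (k - 1) / 2"

text \<open>The permutation representation maps the \<open>k\<close>-th unit vector to the \<open>x k\<close>-th one, so it sends
  \<open>v\<close> to \<open>v \<circ> inv x\<close>; the entries are the inner products of \<open>b\<^sub>i\<close> with the image of \<open>b\<^sub>j\<close>.\<close>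

definition rho :: "(nat \<Rightarrow> nat) \<Rightarrow> real^3^3" where
  "rho x = (\<chi> i j. \<Sum>k=1..4. rho_basis i k * rho_basis j (Hilbert_Choice.inv x k))"

definition scalar_matrix :: "real^3^3 \<Rightarrow> 'a::real_algebra_1^3^3" where
  "scalar_matrix R = (\<chi> i j. of_real (R$i$j))"

end

theory Submission
  imports Defs "HOL-Real_Asymp.Real_Asymp"
begin

text \<open>
  For a rotation \<open>g\<close>, the operators \<open>v \<mapsto> g\<^sub>i\<^sub>j e\<^sub>i v e\<^sub>j\<^sup>*\<close> on the complexified quaternions satisfy the relations
  of \<open>C(SO\<^sub>-\<^sub>1(3))\<close>, and these representations determine the norm: with Chebyshev-type interpolation a
  polynomial in the generators is bounded, up to a factor polynomial in its degree, by its values under the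
  same representations with \<open>g\<close> replaced by arbitrary matrices of a box; high powers remove the factor, and
  multiplying by powers of \<open>1 - r / c\<close>, where \<open>r\<close> is the sum of squares of the relators, concentrates
  the estimate on rotations.

  A suitable linear functional turns these representations into functionals \<open>\<phi>\<^sub>g\<close> with
  \<open>\<phi>\<^sub>g(a\<^sub>i\<^sub>j) = g\<^sub>i\<^sub>j\<close> and \<open>(\<phi>\<^sub>g \<otimes> \<phi>\<^sub>h) \<circ> \<Delta> = \<phi>\<^sub>g\<^sub>h\<close> that separate the points of the algebra; this reflects that
  \<open>SO\<^sub>-\<^sub>1(3)\<close> is a cocycle twist of \<open>SO(3)\<close>. An automorphism \<open>\<theta>\<close> therefore yields a bounded representation
  \<open>g \<mapsto> (\<phi>\<^sub>g(\<theta>(a\<^sub>i\<^sub>j)))\<close> of \<open>SO(3)\<close>. On the rotations of the tetrahedron \<open>\<phi>\<^sub>g\<close> is a character, which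
  makes this representation conjugate there to the standard one by an element of \<open>\<rho>(S\<^sub>4)\<close>, and a bounded
  representation that is standard on the rotations of the tetrahedron is standard everywhere.
\<close>

section \<open>Elementary facts on C*-algebras\<close>

text \<open>An automorphism is only known to respect the C*-structure and the coproduct, so nothing
  places the images of the generators in their linear span, or even among the polynomials in them.
  Evaluation by the functionals moves the question to SO(3), and separation of points brings the
  answer back. Only boundedness of the resulting representation enters the rigidity argument, no
  continuity. The signs come from the quaternions: left multiplications by distinct imaginary units
  anticommute, so do right multiplications, and left commutes with right. Hence two of the operators
  anticommute exactly when they share one index and differ in the other. On a word in the generators
  the sign splits into a factor from the row indices and one from the column indices; the two legs
  of a coproduct term share their middle indices, whose sign is squared away. Characters correspond
  to signed permutation matrices of permanent 1. Odd permutations are allowed and give determinant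
  -1, which is why all of S_4 appears although the rotations among these matrices form only a copy
  of A_4.\<close>

lemma scaleC_zero_left [simp]: "0 *\<^sub>C x = (0::'a::complex_star_algebra)"
  by (metis add_cancel_right_right scaleC_add_left)

declare scaleC_zero_right [simp] adj_zero [simp]

lemma scaleC_minus_left: "(- c) *\<^sub>C x = - (c *\<^sub>C x)"
  by (metis add_eq_0_iff add.right_inverse scaleC_add_left scaleC_zero_left)

lemma scaleC_minus_right: "c *\<^sub>C (- x) = - (c *\<^sub>C x)"
  by (metis add.right_inverse add_eq_0_iff scaleC_add_right scaleC_zero_right)

lemma scaleC_diff_right: "c *\<^sub>C (x - y) = c *\<^sub>C x - c *\<^sub>C y"
  by (metis diff_conv_add_uminus scaleC_add_right scaleC_minus_right)

lemma scaleC_sum_right: "c *\<^sub>C (\<Sum>i\<in>I. f i) = (\<Sum>i\<in>I. c *\<^sub>C f i)"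
  by (induction I rule: infinite_finite_induct) (simp_all add: scaleC_add_right)

lemma scaleC_sum_left: "(\<Sum>i\<in>I. c i) *\<^sub>C x = (\<Sum>i\<in>I. c i *\<^sub>C x)"
  by (induction I rule: infinite_finite_induct) (simp_all add: scaleC_add_left)

lemma adj_one [simp]: "adj 1 = (1::'a::complex_star_algebra)"
proof -
  have "adj 1 = adj 1 * adj (adj (1::'a))" by (simp add: adj_adj)
  also have "\<dots> = adj (adj 1 * 1)" by (simp only: adj_mult)
  finally show ?thesis by (simp add: adj_adj)
qed

lemma adj_minus: "adj (- x) = - adj x"
  by (metis add.right_inverse add_eq_0_iff adj_add adj_zero)

lemma adj_diff: "adj (x - y) = adj x - adj y"
  by (metis diff_conv_add_uminus adj_add adj_minus)

lemma adj_power: "adj (x ^ n) = adj x ^ n"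
  by (induction n) (simp_all add: adj_mult power_commutes)

lemma scaleC_power:
  fixes x :: "'a::complex_star_algebra"
  shows "(c *\<^sub>C x) ^ n = c ^ n *\<^sub>C x ^ n"
  by (induction n) (simp_all add: scaleC_one mult_scaleC_left mult_scaleC_right scaleC_scaleC mult_ac)

lemma star_homD:
  assumes "star_hom f"
  shows "f (x + y) = f x + f y" "f (c *\<^sub>C x) = c *\<^sub>C f x" "f 1 = 1"
    "f (x * y) = f x * f y" "f (adj x) = adj (f x)"
  using assms unfolding star_hom_def clinear_map_def by blast+

lemma clinear_map_zero: "clinear_map f \<Longrightarrow> f 0 = 0"
  unfolding clinear_map_def by (metis scaleC_zero_left)

lemma clinear_map_minus: "clinear_map f \<Longrightarrow> f (- x) = - f x"
  unfolding clinear_map_def by (metis scaleC_minus_left scaleC_one)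

lemma clinear_map_diff: "clinear_map f \<Longrightarrow> f (x - y) = f x - f y"
  using clinear_map_minus[of f y] unfolding clinear_map_def by (metis diff_conv_add_uminus)

lemma clinear_map_sum: "clinear_map f \<Longrightarrow> f (\<Sum>i\<in>I. g i) = (\<Sum>i\<in>I. f (g i))"
  by (induction I rule: infinite_finite_induct)
    (simp_all add: clinear_map_zero, simp add: clinear_map_def)

lemma star_hom_clinear: "star_hom f \<Longrightarrow> clinear_map f"
  by (simp add: star_hom_def)

lemma star_hom_power: "star_hom f \<Longrightarrow> f (x ^ n) = f x ^ n"
  by (induction n) (simp_all add: star_homD)

lemma star_hom_comp: "star_hom f \<Longrightarrow> star_hom g \<Longrightarrow> star_hom (f \<circ> g)"
  unfolding star_hom_def clinear_map_def by simp

lemma star_hom_id: "star_hom id"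
  unfolding star_hom_def clinear_map_def by simp

lemma norm_adj [simp]: "norm (adj x) = norm (x :: 'a::cstar_algebra)"
proof -
  have le: "norm x \<le> norm (adj x)" for x :: 'a
  proof (cases "x = 0")
    case False
    have "norm x * norm x \<le> norm (adj x) * norm x"
      using norm_mult_ineq[of "adj x" x] by (simp add: cstar_identity power2_eq_square)
    then show ?thesis using False by simp
  qed simp
  show ?thesis using le[of x] le[of "adj x"] by (simp add: adj_adj)
qed

lemma bounded_linear_adj: "bounded_linear (adj :: 'a::cstar_algebra \<Rightarrow> 'a)"
  by (rule bounded_linear_intro[where K = 1])
    (simp_all add: adj_add scaleR_scaleC adj_scaleC)

lemma bounded_linear_scaleC: "bounded_linear (\<lambda>x :: 'a::cstar_algebra. c *\<^sub>C x)"
  by (rule bounded_linear_intro[where K = "cmod c"])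
    (simp_all add: scaleC_add_right scaleR_scaleC scaleC_scaleC norm_scaleC mult.commute)

lemmas continuous_adj = bounded_linear.continuous_on[OF bounded_linear_adj]
lemmas tendsto_adj = bounded_linear.tendsto[OF bounded_linear_adj]
lemmas tendsto_scaleC = bounded_linear.tendsto[OF bounded_linear_scaleC]

section \<open>Norms of powers, unitaries, and contractivity of star-homomorphisms\<close>

lemma norm_selfadjoint_power:
  fixes x :: "'a::cstar_algebra"
  assumes "adj x = x"
  shows "norm (x ^ (2 ^ k)) = norm x ^ (2 ^ k)"
proof (induction k)
  case (Suc k)
  have "adj (x ^ 2 ^ k) = x ^ 2 ^ k" by (simp add: adj_power assms)
  then have "norm (x ^ 2 ^ k * x ^ 2 ^ k) = (norm (x ^ 2 ^ k))\<^sup>2"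
    using cstar_identity[of "x ^ 2 ^ k"] by simp
  then show ?case by (simp add: Suc mult_2 power_add power2_eq_square)
qed simp

lemma norm_unitary_le:
  fixes u :: "'a::cstar_algebra"
  assumes "adj u * u = 1"
  shows "norm u = 1"
  using cstar_identity[of u] by (simp add: assms power2_eq_1_iff) (smt (verit) norm_ge_zero)

text \<open>With \<open>s = 1 - e\<close> the equation for \<open>s\<close> becomes
  \<open>2 e = h * h + e * e\<close>. Banach's fixed point theorem solves it among the self-adjoint
  elements of norm at most 1/2 that commute with \<open>h\<close>: the bound on \<open>h\<close>
  keeps this set invariant, and the bound on \<open>e\<close> gives the contraction constant
  1/2.\<close>

lemma square_root_one_minus_square:
  fixes h :: "'a::cstar_algebra"
  assumes h: "adj h = h" "norm h \<le> 1 / 2"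
  obtains s where "adj s = s" "s * h = h * s" "s * s = 1 - h * h"
proof -
  define S where "S = {e :: 'a. norm e \<le> 1 / 2 \<and> adj e = e \<and> e * h = h * e}"
  define f where "f = (\<lambda>e. (1/2 :: real) *\<^sub>R (h * h + e * e))"
  have "closed S"
    unfolding S_def
    by (intro closed_Collect_conj closed_Collect_le closed_Collect_eq continuous_intros continuous_adj)
  then have "complete S" by (simp add: complete_eq_closed)
  moreover have "0 \<in> S" by (simp add: S_def)
  moreover have "f ` S \<subseteq> S"
  proof (rule image_subsetI)
    fix e assume "e \<in> S"
    then have e: "norm e \<le> 1 / 2" "adj e = e" "e * h = h * e" by (auto simp: S_def)
    have "norm (h * h + e * e) \<le> norm h * norm h + norm e * norm e"
      by (meson add_mono norm_mult_ineq norm_triangle_ineq order_trans)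
    also have "\<dots> \<le> 1/2 * (1/2) + 1/2 * (1/2)"
      using h e by (intro add_mono mult_mono) auto
    finally have "norm (h * h + e * e) \<le> 1" by simp
    moreover have "adj ((1/2 :: real) *\<^sub>R (h * h + e * e)) = (1/2 :: real) *\<^sub>R (h * h + e * e)"
      by (simp add: scaleR_scaleC adj_scaleC adj_add adj_mult h e)
    moreover have "e * e * h = h * (e * e)" using e(3) by (metis mult.assoc)
    ultimately show "f e \<in> S"
      unfolding S_def f_def mem_Collect_eq by (simp add: distrib_left distrib_right mult.assoc)
  qed
  moreover have "dist (f x) (f y) \<le> 1/2 * dist x y" if "x \<in> S" "y \<in> S" for x y
  proof -
    have "f x - f y = (1/2 :: real) *\<^sub>R (x * (x - y) + (x - y) * y)"
      by (simp add: f_def algebra_simps)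
    also have "norm \<dots> \<le> 1/2 * (norm x * norm (x - y) + norm (x - y) * norm y)"
      by simp (meson add_mono norm_mult_ineq norm_triangle_ineq order_trans)
    also have "\<dots> \<le> 1/2 * (1/2 * norm (x - y) + norm (x - y) * (1/2))"
      using that by (intro mult_left_mono add_mono mult_right_mono mult_left_mono) (auto simp: S_def)
    finally show ?thesis by (simp add: dist_norm)
  qed
  ultimately obtain e where e: "e \<in> S" "f e = e"
    using Banach_fix[of S "1/2" f] by auto
  have "2 *\<^sub>R f e = 2 *\<^sub>R e" using e by simp
  then have *: "h * h + e * e = e + e" by (simp add: f_def scaleR_2)
  show thesis
  proof (rule that[of "1 - e"])
    show "adj (1 - e) = 1 - e" using e by (simp add: adj_diff S_def)
    show "(1 - e) * h = h * (1 - e)" using e by (simp add: algebra_simps S_def)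
    show "(1 - e) * (1 - e) = 1 - h * h" using * by (simp add: algebra_simps)
  qed
qed

text \<open>The unitary is \<open>u = h + \<i> s\<close>, where \<open>s\<close> is the square root
  of \<open>1 - h * h\<close>; as \<open>s\<close> commutes with \<open>h\<close>, both products of
  \<open>u\<close> with its adjoint are \<open>h * h + s * s\<close>.\<close>

lemma selfadjoint_unitary_decomposition:
  fixes h :: "'a::cstar_algebra"
  assumes "adj h = h" "norm h \<le> 1 / 2"
  obtains u where "adj u * u = 1" "u * adj u = 1" "2 *\<^sub>C h = u + adj u"
proof -
  obtain s where s: "adj s = s" "s * h = h * s" "s * s = 1 - h * h"
    using square_root_one_minus_square[OF assms] .
  define u where "u = h + \<i> *\<^sub>C s"
  have a: "adj u = h - \<i> *\<^sub>C s"
    by (simp add: u_def adj_add adj_scaleC assms s scaleC_minus_left)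
  show thesis
  proof (rule that[of u])
    show "adj u * u = 1" "u * adj u = 1" unfolding a unfolding u_def
      by (simp_all add: algebra_simps mult_scaleC_left mult_scaleC_right scaleC_scaleC s
          scaleC_minus_left scaleC_one scaleC_diff_right scaleC_add_right)
    show "2 *\<^sub>C h = u + adj u" unfolding a unfolding u_def
      by simp (metis one_add_one scaleC_add_left scaleC_one)
  qed
qed

text \<open>Purely algebraic: \<open>f\<close> maps the unitary \<open>u\<close> with \<open>2 h = u + u\<^sup>*\<close> to a unitary.\<close>

lemma star_hom_norm_le:
  fixes f :: "'a::cstar_algebra \<Rightarrow> 'b::cstar_algebra"
  assumes f: "star_hom f"
  shows "norm (f x) \<le> norm x"
proof -
  have 1: "norm (f h) \<le> 1" if h: "adj h = h" "norm h \<le> 1/2" for h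
  proof -
    obtain u where u: "adj u * u = 1" "u * adj u = 1" "2 *\<^sub>C h = u + adj u"
      using selfadjoint_unitary_decomposition[OF h] .
    have "adj (f u) * f u = 1" using u(1) f by (metis star_homD(3-5))
    then have n: "norm (f u) = 1" by (rule norm_unitary_le)
    have "2 *\<^sub>C f h = f u + adj (f u)" using u(3) f by (metis star_homD(1,2,5))
    then have "norm (2 *\<^sub>C f h) \<le> 2"
      using norm_triangle_ineq[of "f u" "adj (f u)"] n by simp
    then show ?thesis by (simp add: norm_scaleC)
  qed
  have 2: "norm (f h) \<le> 2 * norm h" if "adj h = h" for h
  proof (cases "h = 0")
    case True then show ?thesis using f by (simp add: clinear_map_zero star_hom_clinear)
  next
    case False
    define c where "c = complex_of_real (1 / (2 * norm h))"
    have "norm (f (c *\<^sub>C h)) \<le> 1"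
      by (rule 1) (use False in \<open>simp_all add: c_def adj_scaleC that norm_scaleC norm_divide norm_mult\<close>)
    then show ?thesis using False
      by (simp add: star_homD[OF f] norm_scaleC c_def norm_divide norm_mult field_simps)
  qed
  text \<open>The factor \<open>2\<close> disappears on taking high powers.\<close>
  have 3: "norm (f h) \<le> norm h" if h: "adj h = h" for h
  proof (rule ccontr)
    assume "\<not> norm (f h) \<le> norm h"
    then have lt: "norm h < norm (f h)" by simp
    have *: "norm (f h) ^ (2 ^ k) \<le> 2 * norm h ^ (2 ^ k)" for k
    proof -
      have "adj (f h) = f h" using h f by (metis star_homD(5))
      then have "norm (f h) ^ (2 ^ k) = norm (f (h ^ 2 ^ k))"
        using norm_selfadjoint_power[of "f h"] f by (simp add: star_hom_power)
      also have "\<dots> \<le> 2 * norm (h ^ 2 ^ k)" by (rule 2) (simp add: adj_power h)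
      finally show ?thesis using norm_selfadjoint_power[of h] h by simp
    qed
    show False
    proof (cases "h = 0")
      case True then show ?thesis using lt f by (simp add: clinear_map_zero star_hom_clinear)
    next
      case False
      define r where "r = norm (f h) / norm h"
      have r: "r > 1" using lt False by (simp add: r_def)
      obtain m where m: "2 < r ^ m" using real_arch_pow[OF r] by blast
      have "r ^ m \<le> r ^ (2 ^ m)" using r by (intro power_increasing) auto
      moreover have "r ^ (2 ^ m) \<le> 2"
        using *[of m] False by (simp add: r_def power_divide divide_le_eq)
      ultimately show False using m by simp
    qed
  qed
  have "(norm (f x))\<^sup>2 = norm (f (adj x * x))" using f by (simp add: star_homD cstar_identity)
  also have "\<dots> \<le> norm (adj x * x)" by (rule 3) (simp add: adj_mult adj_adj)
  also have "\<dots> = (norm x)\<^sup>2" by (simp add: cstar_identity)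
  finally show ?thesis by (simp add: power2_le_iff_abs_le)
qed

lemma star_hom_bounded_linear:
  fixes f :: "'a::cstar_algebra \<Rightarrow> 'b::cstar_algebra"
  assumes "star_hom f"
  shows "bounded_linear f"
  by (rule bounded_linear_intro[where K = 1])
    (simp_all add: star_homD[OF assms] scaleR_scaleC star_hom_norm_le[OF assms])

section \<open>Interpolation of powers of a self-adjoint element\<close>

lemma sum_roots_of_unity:
  fixes m m' N :: nat
  assumes "m < N" "m' < N"
  shows "(\<Sum>j<N. cis (2 * pi * j / N) ^ m * cnj (cis (2 * pi * j / N)) ^ m') =
    (if m = m' then of_nat N else 0)"
proof -
  define z where "z = cis (2 * pi * (real m - real m') / N)"
  have eq: "cis (2 * pi * j / N) ^ m * cnj (cis (2 * pi * j / N)) ^ m' = z ^ j" for j :: nat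
    unfolding z_def Complex.DeMoivre cis_cnj cis_mult
    by (rule arg_cong[where f = cis]) (simp add: algebra_simps diff_divide_distrib)
  have zN: "z ^ N = 1"
  proof -
    have "z ^ N = cis (2 * pi * of_int (int m - int m'))"
      unfolding z_def Complex.DeMoivre using assms by (intro arg_cong[where f = cis]) simp
    then show ?thesis by (simp add: cis_multiple_2pi)
  qed
  have "z \<noteq> 1" if "m \<noteq> m'"
  proof
    assume "z = 1"
    then have "cos (2 * pi * (real m - real m') / N) = 1"
      by (metis Re_complex_of_real cis.sel(1) of_real_1 z_def)
    then obtain i :: int where "2 * pi * (real m - real m') / N = of_int i * 2 * pi"
      by (auto simp: cos_one_2pi_int)
    then have "2 * pi * (real m - real m') = 2 * pi * (real_of_int i * real N)"
      using assms by (simp add: field_simps)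
    then have "real m - real m' = real_of_int i * real N"
      by (subst (asm) mult_cancel_left) simp
    then have "real_of_int (int m - int m') = real_of_int (i * int N)"
      by simp
    then have *: "int m - int m' = i * int N" by (simp only: of_int_eq_iff)
    have "\<bar>i\<bar> * int N = \<bar>int m - int m'\<bar>" by (simp add: * abs_mult)
    also have "\<dots> < 1 * int N" using assms by simp
    finally have "i = 0" using assms by (simp add: mult_less_cancel_right)
    then show False using * that by simp
  qed
  then show ?thesis
    using zN unfolding eq by (auto simp: sum_gp_strict) (simp add: z_def)
qed

text \<open>The \<open>L j\<close> are, up to a factor, the values at a unitary \<open>u\<close> with \<open>2 h = u + u\<^sup>*\<close> of the Dirichlet
  kernels centred at the roots of unity; \<open>V m\<close> below stands for the power \<open>u\<^sup>m\<^sup>-\<^sup>n\<close>.\<close>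

lemma trigonometric_interpolation:
  fixes h :: "'a::cstar_algebra" and n :: nat
  assumes h: "adj h = h" "norm h \<le> 1 / 2"
  obtains t :: "nat \<Rightarrow> real" and L where
    "\<And>j. \<bar>t j\<bar> \<le> 1" "\<And>j. norm (L j) \<le> 1"
    "\<And>k. k \<le> n \<Longrightarrow> h ^ k = (\<Sum>j<2 * n + 1. of_real (t j) ^ k *\<^sub>C L j)"
proof -
  obtain u where u: "adj u * u = 1" "u * adj u = 1" "2 *\<^sub>C h = u + adj u"
    using selfadjoint_unitary_decomposition[OF h] .
  \<comment> \<open>The powers of \<open>u\<close> with exponents from \<open>-n\<close> to
    \<open>n\<close> occur, \<open>2 * n + 1\<close> in number, and as many roots of unity tell them
    apart.\<close>
  define N where "N = 2 * n + 1"
  define w where "w = (\<lambda>j. cis (2 * pi * real j / real N))"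
  define V where "V = (\<lambda>m. u ^ m * adj u ^ n)"
  define K where "K = (\<lambda>j. (1 / of_nat N) *\<^sub>C (\<Sum>m<N. cnj (w j) ^ m *\<^sub>C V m))"
  have hh: "h = (1/2) *\<^sub>C (u + adj u)"
    unfolding u(3)[symmetric] by (simp add: scaleC_scaleC scaleC_one)
  have nu: "norm u = 1" using norm_unitary_le u(1) by blast
  have nV: "norm (V m) \<le> 1" for m
  proof -
    have "norm (V m) \<le> norm u ^ m * norm (adj u) ^ n"
      unfolding V_def by (meson mult_mono norm_ge_zero norm_mult_ineq norm_power_ineq order_trans zero_le_power)
    then show ?thesis by (simp add: nu)
  qed
  have hV: "h * V m = (1/2) *\<^sub>C (V (m + 1) + V (m - 1))" if "m \<ge> 1" for m
  proof -
    obtain m' where m: "m = Suc m'" using \<open>m \<ge> 1\<close> by (cases m) auto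
    have "adj u * (u * x) = x" for x by (simp add: u flip: mult.assoc)
    then show ?thesis unfolding hh V_def m
      by (simp add: mult_scaleC_left distrib_right mult.assoc)
  qed
  have cosw: "complex_of_real (cos (2 * pi * j / N)) = (w j + cnj (w j)) / 2" for j :: nat
    by (simp add: w_def complex_eq_iff)
  have ww: "w j * cnj (w j) = 1" "w j ^ Suc i * cnj (w j) = w j ^ i" for j i
  proof -
    show "w j * cnj (w j) = 1" by (simp add: w_def cis_cnj cis_mult)
    then show "w j ^ Suc i * cnj (w j) = w j ^ i" by (simp add: mult_ac)
  qed
  \<comment> \<open>Discrete Fourier inversion: orthogonality of the roots of unity recovers
    \<open>V m\<close> from the \<open>K j\<close>.\<close>
  have V0: "V m = (\<Sum>j<N. w j ^ m *\<^sub>C K j)" if "m < N" for m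
  proof -
    have "(\<Sum>j<N. w j ^ m *\<^sub>C K j) =
        (1 / of_nat N) *\<^sub>C (\<Sum>j<N. \<Sum>m'<N. (w j ^ m * cnj (w j) ^ m') *\<^sub>C V m')"
      by (simp add: K_def scaleC_sum_right scaleC_scaleC mult_ac)
    also have "(\<Sum>j<N. \<Sum>m'<N. (w j ^ m * cnj (w j) ^ m') *\<^sub>C V m') =
        (\<Sum>m'<N. (\<Sum>j<N. w j ^ m * cnj (w j) ^ m') *\<^sub>C V m')"
      by (subst sum.swap) (simp add: scaleC_sum_left)
    also have "\<dots> = (\<Sum>m'<N. (if m = m' then of_nat N else 0) *\<^sub>C V m')"
      unfolding w_def using that by (intro sum.cong refl, subst sum_roots_of_unity) auto
    also have "\<dots> = (\<Sum>m'<N. if m' = m then of_nat N *\<^sub>C V m' else 0)"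
      by (intro sum.cong) auto
    also have "\<dots> = of_nat N *\<^sub>C V m" using that by simp
    finally show ?thesis using that by (simp add: scaleC_scaleC scaleC_one)
  qed
  \<comment> \<open>A factor \<open>h\<close> shifts the index of \<open>V\<close> by one in both
    directions, so the two side conditions keep every index in the range of \<open>V0\<close>. In
    the coefficients the same shift amounts to multiplication by the cosine, the mean of
    \<open>w j\<close> and its conjugate.\<close>
  have key: "h ^ k * V m = (\<Sum>j<N. (of_real (cos (2 * pi * j / N)) ^ k * w j ^ m) *\<^sub>C K j)"
    if "k \<le> m" "m + k \<le> 2 * n" for k m
    using that
  proof (induction k arbitrary: m)
    case 0 then show ?case using V0[of m] by (simp add: N_def)
  next
    case (Suc k)
    obtain m' where m: "m = Suc m'" using Suc.prems by (cases m) auto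
    have "h ^ Suc k * V m = h ^ k * (h * V m)" by (metis mult.assoc power_Suc2)
    also have "\<dots> = (1/2) *\<^sub>C (h ^ k * V (m + 1) + h ^ k * V m')"
      using hV[of m] m by (simp add: mult_scaleC_right distrib_left)
    also have "\<dots> = (1/2) *\<^sub>C ((\<Sum>j<N. (of_real (cos (2 * pi * j / N)) ^ k * w j ^ (m + 1)) *\<^sub>C K j) +
        (\<Sum>j<N. (of_real (cos (2 * pi * j / N)) ^ k * w j ^ m') *\<^sub>C K j))"
      using Suc.IH[of "m + 1"] Suc.IH[of m'] Suc.prems m by simp
    also have "\<dots> = (\<Sum>j<N. (1/2 * (of_real (cos (2 * pi * j / N)) ^ k * w j ^ (m + 1)) +
        1/2 * (of_real (cos (2 * pi * j / N)) ^ k * w j ^ m')) *\<^sub>C K j)"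
      by (simp only: scaleC_sum_right scaleC_scaleC scaleC_add_right scaleC_add_left sum.distrib)
    also have "\<dots> = (\<Sum>j<N. (of_real (cos (2 * pi * j / N)) ^ Suc k * w j ^ m) *\<^sub>C K j)"
    proof (intro sum.cong refl arg_cong2[where f = scaleC])
      fix j
      have "w j ^ m' = cnj (w j) * w j ^ m" using ww(2)[of j m'] m by (simp add: mult_ac)
      then show "1/2 * (complex_of_real (cos (2 * pi * j / N)) ^ k * w j ^ (m + 1)) +
        1/2 * (of_real (cos (2 * pi * j / N)) ^ k * w j ^ m') =
        of_real (cos (2 * pi * j / N)) ^ Suc k * w j ^ m"
        unfolding cosw power_Suc by (simp add: field_simps)
    qed
    finally show ?case .
  qed
  have Vn: "V n = 1"
  proof -
    have "u ^ i * adj u ^ i = 1" for i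
    proof (induction i)
      case (Suc i)
      have "u ^ Suc i * adj u ^ Suc i = u * (u ^ i * adj u ^ i) * adj u"
        by (metis mult.assoc power_Suc power_Suc2)
      then show ?case using Suc u by simp
    qed simp
    then show ?thesis by (simp add: V_def)
  qed
  show thesis
  \<comment> \<open>The index \<open>m = n\<close> is used because \<open>V n = 1\<close>, and it
    admits every exponent \<open>k \<le> n\<close>.\<close>
  proof (rule that[of "\<lambda>j. cos (2 * pi * j / N)" "\<lambda>j. w j ^ n *\<^sub>C K j"])
    fix j
    have w1: "cmod (w j) = 1" by (simp add: w_def)
    have "norm (\<Sum>m<N. cnj (w j) ^ m *\<^sub>C V m) \<le> (\<Sum>m<N. 1)"
      by (rule sum_norm_le) (simp add: norm_scaleC norm_power w1 nV)
    moreover have "0 < N" by (simp add: N_def)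
    ultimately show "norm (w j ^ n *\<^sub>C K j) \<le> 1"
      by (simp add: norm_scaleC norm_power w1 K_def norm_divide divide_le_eq)
  next
    fix k assume "k \<le> n"
    then show "h ^ k = (\<Sum>j<2*n+1. of_real (cos (2 * pi * j / N)) ^ k *\<^sub>C w j ^ n *\<^sub>C K j)"
      using key[of k n] by (simp add: Vn scaleC_scaleC N_def)
  qed simp
qed

text \<open>The generators are removed one at a time from the left. The powers of the leading one
  become combinations of the same \<open>2 * n + 1\<close> contractions with scalar powers as
  coefficients, so each generator costs a factor \<open>2 * n + 1\<close>. Interpolation is applied
  to \<open>b g / c\<close>, of norm at most 1/2, while its nodes fill [-1, 1]; this is why norms up
  to \<open>c / 2\<close> require scalars up to \<open>c\<close>.\<close>

lemma ordered_monomials_bound: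
  fixes b :: "'g \<Rightarrow> 'a::cstar_algebra" and k :: "'w \<Rightarrow> 'g \<Rightarrow> nat"
  assumes "finite W" "distinct gs" "c > 0"
    and "\<And>g. g \<in> set gs \<Longrightarrow> adj (b g) = b g" "\<And>g. g \<in> set gs \<Longrightarrow> norm (b g) \<le> c / 2"
    and "\<And>w g. w \<in> W \<Longrightarrow> g \<in> set gs \<Longrightarrow> k w g \<le> n"
    and "\<And>y. (\<And>g. \<bar>y g\<bar> \<le> c) \<Longrightarrow>
      cmod (\<Sum>w\<in>W. C w * prod_list (map (\<lambda>g. complex_of_real (y g) ^ k w g) gs)) \<le> S"
  shows "norm (\<Sum>w\<in>W. C w *\<^sub>C prod_list (map (\<lambda>g. b g ^ k w g) gs)) \<le> (2 * real n + 1) ^ length gs * S"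
  using assms
proof (induction gs arbitrary: C)
  case Nil
  from Nil(7)[of "\<lambda>_. 0"] Nil(3) have "cmod (\<Sum>w\<in>W. C w) \<le> S" by simp
  moreover have "(\<Sum>w\<in>W. C w *\<^sub>C (1::'a)) = (\<Sum>w\<in>W. C w) *\<^sub>C 1" by (simp add: scaleC_sum_left)
  ultimately show ?case by (simp add: norm_scaleC)
next
  case (Cons g gs)
  define h where "h = complex_of_real (1 / c) *\<^sub>C b g"
  have "adj h = h" using Cons.prems(4)[of g] by (simp add: h_def adj_scaleC)
  moreover have "norm h \<le> 1/2" using Cons.prems(3) Cons.prems(5)[of g]
    by (simp add: h_def norm_scaleC norm_divide norm_mult field_simps)
  ultimately obtain t L where t: "\<And>j. \<bar>t j\<bar> \<le> 1" "\<And>j. norm (L j) \<le> 1"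
    "\<And>i. i \<le> n \<Longrightarrow> h ^ i = (\<Sum>j<2 * n + 1. of_real (t j) ^ i *\<^sub>C L j)"
    using trigonometric_interpolation[of h n] by metis
  have bg: "b g = complex_of_real c *\<^sub>C h"
    using Cons.prems(3) by (simp add: h_def scaleC_scaleC scaleC_one)
  have pow: "b g ^ k w g = (\<Sum>j<2 * n + 1. of_real (c * t j) ^ k w g *\<^sub>C L j)" if "w \<in> W" for w
    using t(3)[of "k w g"] Cons.prems(6)[of w g] that
    by (simp add: bg scaleC_power scaleC_sum_right scaleC_scaleC power_mult_distrib
        del: sum.lessThan_Suc)
  let ?P = "\<lambda>w. prod_list (map (\<lambda>g. b g ^ k w g) gs)"
  have "(\<Sum>w\<in>W. C w *\<^sub>C prod_list (map (\<lambda>g. b g ^ k w g) (g # gs))) =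
      (\<Sum>w\<in>W. \<Sum>j<2*n+1. L j * ((C w * of_real (c * t j) ^ k w g) *\<^sub>C ?P w))"
    by (intro sum.cong refl)
      (simp add: pow scaleC_sum_right sum_distrib_right mult_scaleC_left mult_scaleC_right scaleC_scaleC
        del: sum.lessThan_Suc)
  also have "\<dots> = (\<Sum>j<2*n+1. L j * (\<Sum>w\<in>W. (C w * of_real (c * t j) ^ k w g) *\<^sub>C ?P w))"
    by (subst sum.swap) (simp add: sum_distrib_left del: sum.lessThan_Suc)
  also have "norm \<dots> \<le> (\<Sum>j<2*n+1. (2 * real n + 1) ^ length gs * S)"
  proof (rule sum_norm_le)
    fix j assume "j \<in> {..<2*n+1}"
    have IH: "norm (\<Sum>w\<in>W. (C w * of_real (c * t j) ^ k w g) *\<^sub>C ?P w) \<le> (2 * real n + 1) ^ length gs * S"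
    proof (rule Cons.IH)
      fix y :: "'g \<Rightarrow> real" assume y: "\<And>g. \<bar>y g\<bar> \<le> c"
      define z where "z = y(g := c * t j)"
      have zg: "z g = c * t j" by (simp add: z_def)
      have zgs: "map (\<lambda>g'. complex_of_real (z g') ^ k w g') gs =
          map (\<lambda>g'. complex_of_real (y g') ^ k w g') gs" for w
        using Cons.prems(2) by (auto simp: z_def)
      have "\<bar>z g'\<bar> \<le> c" for g'
        using y t(1)[of j] Cons.prems(3) by (simp add: z_def abs_mult mult_left_le)
      from Cons.prems(7)[of z, OF this] show "cmod (\<Sum>w\<in>W. C w * of_real (c * t j) ^ k w g *
          prod_list (map (\<lambda>g. complex_of_real (y g) ^ k w g) gs)) \<le> S"
        by (simp add: zg zgs mult.assoc)
    qed (use Cons.prems in auto)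
    have "norm (L j * (\<Sum>w\<in>W. (C w * of_real (c * t j) ^ k w g) *\<^sub>C ?P w)) \<le>
        1 * norm (\<Sum>w\<in>W. (C w * of_real (c * t j) ^ k w g) *\<^sub>C ?P w)"
      using t(2)[of j] by (meson mult_right_mono norm_ge_zero norm_mult_ineq order_trans)
    then show "norm (L j * (\<Sum>w\<in>W. (C w * of_real (c * t j) ^ k w g) *\<^sub>C ?P w)) \<le>
        (2 * real n + 1) ^ length gs * S" using IH by simp
  qed
  also have "\<dots> = (2 * real n + 1) ^ length (g # gs) * S" by (simp add: algebra_simps)
  finally show ?case .
qed

text \<open>The scalar produced by insertion sort: the tail is sorted first, and then the letter
  \<open>g\<close> passes all occurrences in it of the letters that come before \<open>g\<close> in
  \<open>gs\<close>.\<close>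

fun reordering_sign :: "('g \<Rightarrow> 'g \<Rightarrow> complex) \<Rightarrow> 'g list \<Rightarrow> 'g list \<Rightarrow> complex" where
  "reordering_sign \<epsilon> gs [] = 1"
| "reordering_sign \<epsilon> gs (g # w) =
     reordering_sign \<epsilon> gs w * prod_list (map (\<lambda>h. \<epsilon> g h ^ count_list w h) (takeWhile (\<lambda>h. h \<noteq> g) gs))"

lemma prod_list_reordering:
  fixes b :: "'g \<Rightarrow> 'a::complex_star_algebra"
  assumes comm: "\<And>g h. b g * b h = \<epsilon> g h *\<^sub>C (b h * b g)"
    and "distinct gs" "set w \<subseteq> set gs"
  shows "prod_list (map b w) =
    reordering_sign \<epsilon> gs w *\<^sub>C prod_list (map (\<lambda>g. b g ^ count_list w g) gs)"
  using assms(3)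
proof (induction w)
  case Nil
  have "prod_list (map (\<lambda>g. 1::'a) gs) = 1" by (induction gs) auto
  then show ?case by (simp add: scaleC_one)
next
  case (Cons g w)
  have pow: "b g * b h ^ n = \<epsilon> g h ^ n *\<^sub>C (b h ^ n * b g)" for h n
  proof (induction n)
    case (Suc n)
    have "b g * b h ^ Suc n = (b g * b h) * b h ^ n" by (simp add: mult.assoc)
    also have "\<dots> = \<epsilon> g h *\<^sub>C (b h * (b g * b h ^ n))" by (simp add: comm[of g h] mult_scaleC_left mult.assoc)
    finally show ?case by (simp add: Suc mult_scaleC_right scaleC_scaleC mult.assoc)
  qed (simp add: scaleC_one)
  have insert: "b g * prod_list (map (\<lambda>h. b h ^ count_list w h) hs) =
      prod_list (map (\<lambda>h. \<epsilon> g h ^ count_list w h) (takeWhile (\<lambda>h. h \<noteq> g) hs)) *\<^sub>C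
      prod_list (map (\<lambda>h. b h ^ count_list (g # w) h) hs)"
    if "distinct hs" "g \<in> set hs" for hs
    using that
  proof (induction hs)
    case (Cons h hs)
    show ?case
    proof (cases "h = g")
      case True
      have "prod_list (map (\<lambda>h. b h ^ count_list (g # w) h) hs) =
          prod_list (map (\<lambda>h. b h ^ count_list w h) hs)"
        using Cons.prems True by (intro arg_cong[where f = prod_list] map_cong) auto
      then show ?thesis unfolding list.map prod_list.Cons using True
        by (simp add: scaleC_one mult.assoc)
    next
      case False
      have "b g * prod_list (map (\<lambda>h. b h ^ count_list w h) (h # hs)) =
          (b g * b h ^ count_list w h) * prod_list (map (\<lambda>h. b h ^ count_list w h) hs)"
        by (simp add: mult.assoc)
      also have "\<dots> = \<epsilon> g h ^ count_list w h *\<^sub>C (b h ^ count_list w h *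
          (b g * prod_list (map (\<lambda>h. b h ^ count_list w h) hs)))"
        by (simp add: pow mult_scaleC_left mult.assoc)
      finally show ?thesis using Cons False
        by (simp add: mult_scaleC_right scaleC_scaleC)
    qed
  qed simp
  show ?case using Cons insert[of gs] assms(2)
    by (simp add: mult_scaleC_right scaleC_scaleC)
qed

text \<open>Flipping the sign of a coordinate \<open>y g\<close> separates the even from the odd powers of \<open>\<tau> g\<close>.\<close>

lemma involution_twist_bound:
  fixes \<tau> :: "'g \<Rightarrow> 'a::cstar_algebra" and k :: "'w \<Rightarrow> 'g \<Rightarrow> nat"
  assumes "finite W" "distinct gs" "\<And>g. \<tau> g * \<tau> g = 1" "\<And>g. norm (\<tau> g) \<le> 1"
    and "\<And>y. (\<And>g. \<bar>y g\<bar> \<le> c) \<Longrightarrow>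
      norm (\<Sum>w\<in>W. C w * prod_list (map (\<lambda>g. (complex_of_real (y g) *\<^sub>C \<tau> g) ^ k w g) gs)) \<le> S"
    and "\<And>g. \<bar>y g\<bar> \<le> c"
  shows "norm (\<Sum>w\<in>W. prod_list (map (\<lambda>g. complex_of_real (y g) ^ k w g) gs) *\<^sub>C C w) \<le> 2 ^ length gs * S"
  using assms
proof (induction gs arbitrary: C y)
  case Nil
  from Nil(5)[of "\<lambda>_. 0"] Nil(6)[of undefined] show ?case by (simp add: scaleC_one)
next
  case (Cons g gs)
  let ?P = "\<lambda>w. prod_list (map (\<lambda>g. complex_of_real (y g) ^ k w g) gs)"
  define X where "X = (\<lambda>s. \<Sum>w\<in>W. ?P w *\<^sub>C (C w * (complex_of_real (s * y g) *\<^sub>C \<tau> g) ^ k w g))"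
  have X: "norm (X s) \<le> 2 ^ length gs * S" if "\<bar>s\<bar> = 1" for s
    unfolding X_def
  proof (rule Cons.IH)
    fix y' :: "'g \<Rightarrow> real" assume y': "\<And>g. \<bar>y' g\<bar> \<le> c"
    define z where "z = y'(g := s * y g)"
    have zg: "z g = s * y g" by (simp add: z_def)
    have zgs: "map (\<lambda>g'. (complex_of_real (z g') *\<^sub>C \<tau> g') ^ k w g') gs =
          map (\<lambda>g'. (complex_of_real (y' g') *\<^sub>C \<tau> g') ^ k w g') gs" for w
      using Cons.prems(2) by (auto simp: z_def)
    have "\<bar>z g'\<bar> \<le> c" for g'
      using y' Cons.prems(6)[of g] that by (simp add: z_def abs_mult)
    from Cons.prems(5)[of z, OF this] show "norm (\<Sum>w\<in>W. C w * (complex_of_real (s * y g) *\<^sub>C \<tau> g) ^ k w g *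
        prod_list (map (\<lambda>g. (complex_of_real (y' g) *\<^sub>C \<tau> g) ^ k w g) gs)) \<le> S"
      by (simp add: zg zgs mult.assoc)
  qed (use Cons.prems in auto)
  have tau2: "\<tau> g ^ (2 * i) = 1" "\<tau> g ^ Suc (2 * i) = \<tau> g" for i
    using Cons.prems(3)[of g] by (simp_all add: power_mult power2_eq_square)
  \<comment> \<open>For even exponents the two sign choices agree and the weights
    \<open>(1 + \<tau> g) / 2\<close> and \<open>(1 - \<tau> g) / 2\<close> add up to 1. For odd
    exponents a factor \<open>\<tau> g\<close> is left and the second choice changes sign, so the
    same weights combine to \<open>\<tau> g * \<tau> g = 1\<close>. As the weights
    \<open>1 + \<tau> g\<close> and \<open>1 - \<tau> g\<close> have norm at most 2, each generator
    doubles the bound.\<close>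
  have eq: "prod_list (map (\<lambda>g. complex_of_real (y g) ^ k w g) (g # gs)) *\<^sub>C C w =
      (1/2) *\<^sub>C (?P w *\<^sub>C (C w * (complex_of_real (1 * y g) *\<^sub>C \<tau> g) ^ k w g) * (1 + \<tau> g)) +
      (1/2) *\<^sub>C (?P w *\<^sub>C (C w * (complex_of_real ((-1) * y g) *\<^sub>C \<tau> g) ^ k w g) * (1 - \<tau> g))" for w
  proof (cases "even (k w g)")
    case True
    then obtain i where i: "k w g = 2 * i" by (elim evenE)
    have "(1/2) *\<^sub>C (Z * (1 + \<tau> g)) + (1/2) *\<^sub>C (Z * (1 - \<tau> g)) = Z" for Z
      by (simp add: distrib_left right_diff_distrib scaleC_add_right scaleC_diff_right)
        (simp add: scaleC_one flip: scaleC_add_left)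
    moreover have "complex_of_real (- 1 * y g) ^ k w g = complex_of_real (y g) ^ k w g"
      by (simp add: i)
    ultimately show ?thesis
      unfolding scaleC_power i tau2 by (simp add: mult_scaleC_right scaleC_scaleC mult_ac i)
  next
    case False
    then obtain i where i: "k w g = Suc (2 * i)" using oddE by fastforce
    have "(1/2) *\<^sub>C (Z * \<tau> g * (1 + \<tau> g)) + (1/2) *\<^sub>C (- (Z * \<tau> g) * (1 - \<tau> g)) = Z" for Z
      using Cons.prems(3)[of g]
      by (simp add: distrib_left right_diff_distrib scaleC_add_right scaleC_diff_right scaleC_minus_right mult.assoc)
        (simp add: scaleC_one flip: scaleC_add_left)
    from this[of "(?P w * complex_of_real (y g) ^ k w g) *\<^sub>C C w"] show ?thesis
      unfolding scaleC_power i tau2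
      by (simp add: mult_scaleC_right mult_scaleC_left scaleC_scaleC scaleC_minus_left scaleC_minus_right mult_ac i)
  qed
  have "(\<Sum>w\<in>W. prod_list (map (\<lambda>g. complex_of_real (y g) ^ k w g) (g # gs)) *\<^sub>C C w) =
      (1/2) *\<^sub>C (X 1 * (1 + \<tau> g)) + (1/2) *\<^sub>C (X (-1) * (1 - \<tau> g))"
    unfolding eq X_def sum.distrib scaleC_sum_right sum_distrib_right ..
  also have "norm \<dots> \<le> 1/2 * (2 ^ length gs * S * 2) + 1/2 * (2 ^ length gs * S * 2)"
  proof (intro norm_triangle_mono)
    have t: "norm (1 + \<tau> g) \<le> 2" "norm (1 - \<tau> g) \<le> 2"
      using norm_triangle_ineq[of 1 "\<tau> g"] norm_triangle_ineq4[of 1 "\<tau> g"] Cons.prems(4)[of g] by simp_all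
    have S: "0 \<le> 2 ^ length gs * S" using order_trans[OF norm_ge_zero X[of 1]] by simp
    have "norm (X 1 * (1 + \<tau> g)) \<le> 2 ^ length gs * S * 2"
      using X[of 1] t(1) S by (intro order_trans[OF norm_mult_ineq] mult_mono) auto
    then show "norm ((1/2) *\<^sub>C (X 1 * (1 + \<tau> g))) \<le> 1/2 * (2 ^ length gs * S * 2)"
      by (simp add: norm_scaleC norm_divide)
    have "norm (X (-1) * (1 - \<tau> g)) \<le> 2 ^ length gs * S * 2"
      using X[of "-1"] t(2) S by (intro order_trans[OF norm_mult_ineq] mult_mono) auto
    then show "norm ((1/2) *\<^sub>C (X (-1) * (1 - \<tau> g))) \<le> 1/2 * (2 ^ length gs * S * 2)"
      by (simp add: norm_scaleC norm_divide)
  qed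
  finally show ?case by (simp add: mult_ac)
qed

section \<open>Complex matrices with the operator norm\<close>

instance complex :: cstar_algebra
  by standard
    (simp_all add: scaleC_complex_def adj_complex_def scaleR_conv_of_real norm_mult power2_eq_square)

lemma bounded_linear_matrix_vector_mult:
  "bounded_linear (\<lambda>v. (M :: complex^'n::finite^'m::finite) *v v)"
proof -
  have "linear (\<lambda>v. M *v v)"
    by (rule linearI)
      (simp_all add: matrix_vector_right_distrib,
       simp add: vec_eq_iff matrix_vector_mult_def scaleR_sum_right)
  then show ?thesis by (simp add: linear_conv_bounded_linear)
qed

lemma matrix_vector_mult_axis:
  fixes M :: "'a::semiring_1^'n::finite^'m"
  shows "(M *v axis j 1) $ i = M $ i $ j"
  by (simp add: matrix_vector_mult_def axis_def if_distrib cong: if_cong)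

definition conj_transpose :: "complex^'n^'m \<Rightarrow> complex^'m^'n" where
  "conj_transpose M = (\<chi> i j. cnj (M$j$i))"

lemma conj_transpose_mult: "conj_transpose (M ** N) = conj_transpose N ** conj_transpose M"
  by (simp add: conj_transpose_def matrix_matrix_mult_def vec_eq_iff mult.commute)

lemma inner_matrix_vector_mult:
  fixes v :: "complex^'m::finite" and w :: "complex^'n::finite"
  shows "v \<bullet> (M *v w) = (conj_transpose M *v v) \<bullet> w"
proof -
  have re: "x \<bullet> y = Re (\<Sum>i\<in>UNIV. cnj (x$i) * y$i)" for x y :: "complex^'k::finite"
    by (simp add: inner_vec_def inner_complex_def)
  have "(\<Sum>i\<in>UNIV. cnj (v$i) * (M *v w)$i) = (\<Sum>i\<in>UNIV. cnj ((conj_transpose M *v v)$i) * w$i)"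
    unfolding matrix_vector_mult_def conj_transpose_def
    by (simp add: sum_distrib_left sum_distrib_right, subst sum.swap) (simp add: mult_ac)
  then show ?thesis by (simp add: re del: Re_sum)
qed

text \<open>By Cauchy-Schwarz, because the squared norm of \<open>M *v v\<close> is the inner
  product of \<open>v\<close> with the image of \<open>v\<close> under
  \<open>conj_transpose M ** M\<close>. The real inner product suffices, as it is the real part of
  the Hermitian one.\<close>

lemma onorm_cstar_le:
  fixes M :: "complex^'n::finite^'n"
  shows "(onorm (\<lambda>v. M *v v))\<^sup>2 \<le> onorm (\<lambda>v. (conj_transpose M ** M) *v v)"
proof -
  let ?K = "onorm (\<lambda>v. (conj_transpose M ** M) *v v)"
  have K: "0 \<le> ?K" by (rule onorm_pos_le[OF bounded_linear_matrix_vector_mult])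
  have "norm (M *v v) \<le> sqrt ?K * norm v" for v
  proof (rule power2_le_imp_le)
    have "(norm (M *v v))\<^sup>2 = (M *v v) \<bullet> (M *v v)" by (simp add: power2_norm_eq_inner)
    also have "\<dots> = v \<bullet> ((conj_transpose M ** M) *v v)"
      unfolding inner_matrix_vector_mult[of "M *v v"] matrix_vector_mul_assoc by (rule inner_commute)
    also have "\<dots> \<le> norm v * (?K * norm v)"
      by (rule order_trans[OF norm_cauchy_schwarz])
        (intro mult_left_mono onorm[OF bounded_linear_matrix_vector_mult] norm_ge_zero)
    also have "\<dots> = (sqrt ?K * norm v)\<^sup>2"
      using K by (simp add: power_mult_distrib) (simp add: power2_eq_square)
    finally show "(norm (M *v v))\<^sup>2 \<le> (sqrt ?K * norm v)\<^sup>2" .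
  qed (use K in simp)
  then have "onorm (\<lambda>v. M *v v) \<le> sqrt ?K" by (rule onorm_le)
  then have "(onorm (\<lambda>v. M *v v))\<^sup>2 \<le> (sqrt ?K)\<^sup>2"
    by (intro power_mono onorm_pos_le[OF bounded_linear_matrix_vector_mult])
  then show ?thesis using K by simp
qed

text \<open>A copy of the matrix type, so that the norm can be the operator norm instead of the
  Euclidean norm that \<open>complex^'n^'n\<close> already carries.\<close>

typedef 'n cmat = "UNIV :: (complex^'n^'n) set" morphisms mat_of Cmat ..

setup_lifting type_definition_cmat

instantiation cmat :: (finite) ring_1
begin
lift_definition zero_cmat :: "'a cmat" is 0 .
lift_definition one_cmat :: "'a cmat" is "mat 1" .
lift_definition plus_cmat :: "'a cmat \<Rightarrow> 'a cmat \<Rightarrow> 'a cmat" is "(+)" .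
lift_definition minus_cmat :: "'a cmat \<Rightarrow> 'a cmat \<Rightarrow> 'a cmat" is "(-)" .
lift_definition uminus_cmat :: "'a cmat \<Rightarrow> 'a cmat" is uminus .
lift_definition times_cmat :: "'a cmat \<Rightarrow> 'a cmat \<Rightarrow> 'a cmat" is "(**)" .
instance
proof
  show "(0 :: 'a cmat) \<noteq> 1" by transfer (simp add: mat_def vec_eq_iff)
  fix x y z :: "'a cmat"
  show "(x + y) * z = x * z + y * z"
    by transfer (simp add: matrix_matrix_mult_def vec_eq_iff distrib_right sum.distrib)
  show "x * y * z = x * (y * z)" by transfer (simp add: matrix_mul_assoc)
  show "x * (y + z) = x * y + x * z" by transfer (simp add: matrix_add_ldistrib)
  show "1 * x = x" "x * 1 = x" by (transfer; simp)+
  show "x + y + z = x + (y + z)" by transfer simp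
  show "x + y = y + x" by transfer simp
  show "0 + x = x" by transfer simp
  show "- x + x = 0" by transfer simp
  show "x - y = x + - y" by transfer simp
qed
end

instantiation cmat :: (finite) complex_star_algebra
begin
lift_definition scaleC_cmat :: "complex \<Rightarrow> 'a cmat \<Rightarrow> 'a cmat" is "\<lambda>c M. \<chi> i j. c * M$i$j" .
lift_definition adj_cmat :: "'a cmat \<Rightarrow> 'a cmat" is conj_transpose .
instance
proof
  fix c d :: complex and x y :: "'a cmat"
  show "c *\<^sub>C (x + y) = c *\<^sub>C x + c *\<^sub>C y" by transfer (simp add: vec_eq_iff distrib_left)
  show "(c + d) *\<^sub>C x = c *\<^sub>C x + d *\<^sub>C x" by transfer (simp add: vec_eq_iff distrib_right)
  show "c *\<^sub>C d *\<^sub>C x = (c * d) *\<^sub>C x" by transfer (simp add: vec_eq_iff)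
  show "1 *\<^sub>C x = x" by transfer (simp add: vec_eq_iff)
  show "c *\<^sub>C x * y = c *\<^sub>C (x * y)"
    by transfer (simp add: vec_eq_iff matrix_matrix_mult_def sum_distrib_left mult.assoc)
  show "x * c *\<^sub>C y = c *\<^sub>C (x * y)"
    by transfer (simp add: vec_eq_iff matrix_matrix_mult_def sum_distrib_left mult_ac)
  show "adj (adj x) = x" by transfer (simp add: vec_eq_iff conj_transpose_def)
  show "adj (x + y) = adj x + adj y" by transfer (simp add: vec_eq_iff conj_transpose_def)
  show "adj (c *\<^sub>C x) = cnj c *\<^sub>C adj x" by transfer (simp add: vec_eq_iff conj_transpose_def)
  show "adj (x * y) = adj y * adj x" by transfer (rule conj_transpose_mult)
qed
end

instantiation cmat :: (finite) real_normed_algebra_1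
begin
definition scaleR_cmat :: "real \<Rightarrow> 'a cmat \<Rightarrow> 'a cmat" where
  "scaleR_cmat r M = complex_of_real r *\<^sub>C M"
lift_definition norm_cmat :: "'a cmat \<Rightarrow> real" is "\<lambda>M. onorm (\<lambda>v. M *v v)" .
definition dist_cmat :: "'a cmat \<Rightarrow> 'a cmat \<Rightarrow> real" where "dist_cmat x y = norm (x - y)"
definition sgn_cmat :: "'a cmat \<Rightarrow> 'a cmat" where "sgn_cmat x = inverse (norm x) *\<^sub>R x"
definition uniformity_cmat :: "('a cmat \<times> 'a cmat) filter" where
  "uniformity_cmat = (INF e\<in>{0 <..}. principal {(x, y). dist x y < e})"
definition open_cmat :: "'a cmat set \<Rightarrow> bool" where
  "open_cmat U = (\<forall>x\<in>U. \<forall>\<^sub>F (x', y) in uniformity. x' = x \<longrightarrow> y \<in> U)"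
instance
proof
  fix x y :: "'a cmat" and a b :: real
  show "a *\<^sub>R (x + y) = a *\<^sub>R x + a *\<^sub>R y" "(a + b) *\<^sub>R x = a *\<^sub>R x + b *\<^sub>R x"
    "a *\<^sub>R b *\<^sub>R x = (a * b) *\<^sub>R x" "1 *\<^sub>R x = x"
    "a *\<^sub>R x * y = a *\<^sub>R (x * y)" "x * a *\<^sub>R y = a *\<^sub>R (x * y)"
    by (simp_all add: scaleR_cmat_def scaleC_add_right scaleC_add_left scaleC_scaleC scaleC_one
        mult_scaleC_left mult_scaleC_right)
  note bl = bounded_linear_matrix_vector_mult
  show "(norm x = 0) = (x = 0)"
  proof transfer
    fix M :: "complex^'a^'a"
    have "M = 0" if "\<forall>v. M *v v = 0"
    proof -
      have "M $ i $ j = 0" for i j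
        using that matrix_vector_mult_axis[of M j i] by simp
      then show ?thesis by (simp add: vec_eq_iff)
    qed
    then show "(onorm (\<lambda>v. M *v v) = 0) = (M = 0)"
      using onorm_eq_0[OF bl[of M]] by auto
  qed
  show "norm (x + y) \<le> norm x + norm y"
  proof transfer
    fix M N :: "complex^'a^'a"
    have "(M + N) *v v = M *v v + N *v v" for v
      by (simp add: vec_eq_iff matrix_vector_mult_def distrib_right sum.distrib)
    then show "onorm (\<lambda>v. (M + N) *v v) \<le> onorm (\<lambda>v. M *v v) + onorm (\<lambda>v. N *v v)"
      using onorm_triangle[OF bl[of M] bl[of N]] by simp
  qed
  show "norm (a *\<^sub>R x) = \<bar>a\<bar> * norm x"
    unfolding scaleR_cmat_def
  proof transfer
    fix a :: real and M :: "complex^'a^'a"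
    have "(\<chi> i j. complex_of_real a * M $ i $ j) *v v = a *\<^sub>R (M *v v)" for v
      by (simp add: vec_eq_iff matrix_vector_mult_def scaleR_sum_right mult_ac)
        (simp add: scaleR_conv_of_real)
    then show "onorm (\<lambda>v. (\<chi> i j. complex_of_real a * M $ i $ j) *v v) = \<bar>a\<bar> * onorm (\<lambda>v. M *v v)"
      by (simp add: onorm_scaleR[OF bl])
  qed
  show "norm (x * y) \<le> norm x * norm y"
  proof transfer
    fix M N :: "complex^'a^'a"
    show "onorm (\<lambda>v. (M ** N) *v v) \<le> onorm (\<lambda>v. M *v v) * onorm (\<lambda>v. N *v v)"
      using onorm_compose[OF bl[of M] bl[of N]] by (simp add: o_def matrix_vector_mul_assoc)
  qed
  show "norm (1 :: 'a cmat) = 1"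
  proof transfer
    have "(axis undefined 1 :: complex^'a) \<noteq> 0" by (simp add: axis_eq_0_iff)
    then have "onorm (\<lambda>v :: complex^'a. v) = 1"
    proof -
      assume ne: "(axis undefined 1 :: complex^'a) \<noteq> 0"
      have "norm (axis undefined 1 :: complex^'a) \<le> onorm (\<lambda>v :: complex^'a. v) * norm (axis undefined 1 :: complex^'a)"
        by (rule onorm) simp
      moreover have "onorm (\<lambda>v :: complex^'a. v) \<le> 1" by (rule onorm_le) simp
      ultimately show ?thesis using ne by simp
    qed
    then show "onorm (\<lambda>v :: complex^'a. mat 1 *v v) = 1" by simp
  qed
  show "dist x y = norm (x - y)" by (rule dist_cmat_def)
  show "uniformity = (INF e\<in>{0 <..}. principal {(x :: 'a cmat, y). dist x y < e})"
    by (rule uniformity_cmat_def)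
  show "open U = (\<forall>x\<in>U. \<forall>\<^sub>F (x', y) in uniformity. x' = x \<longrightarrow> y \<in> U)" for U :: "'a cmat set"
    by (rule open_cmat_def)
qed (rule sgn_cmat_def)
end

lemma norm_mat_of_entry_le: "cmod (mat_of M $ i $ j) \<le> norm M"
proof transfer
  fix M :: "complex^'a^'a" and i j
  have "cmod (M $ i $ j) = cmod ((M *v axis j 1) $ i)"
    by (simp only: matrix_vector_mult_axis)
  also have "\<dots> \<le> norm (M *v axis j 1)" by (rule Finite_Cartesian_Product.norm_nth_le)
  also have "\<dots> \<le> onorm (\<lambda>v. M *v v) * norm (axis j 1 :: complex^'a)"
    by (rule onorm[OF bounded_linear_matrix_vector_mult])
  finally show "cmod (M $ i $ j) \<le> onorm (\<lambda>v. M *v v)" by simp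
qed

lemma norm_cmat_le_sum: "norm M \<le> (\<Sum>i\<in>UNIV. \<Sum>j\<in>UNIV. cmod (mat_of M $ i $ j))"
proof transfer
  fix M :: "complex^'a^'a"
  show "onorm (\<lambda>v. M *v v) \<le> (\<Sum>i\<in>UNIV. \<Sum>j\<in>UNIV. cmod (M $ i $ j))"
  proof (rule onorm_le)
    fix v :: "complex^'a"
    have "norm (M *v v) \<le> (\<Sum>i\<in>UNIV. norm ((M *v v) $ i))" unfolding norm_vec_def by (rule L2_set_le_sum) simp
    also have "\<dots> \<le> (\<Sum>i\<in>UNIV. \<Sum>j\<in>UNIV. cmod (M $ i $ j) * norm v)"
      unfolding matrix_vector_mult_def
      by (auto intro!: sum_mono order_trans[OF norm_sum] mult_left_mono Finite_Cartesian_Product.norm_nth_le simp: norm_mult)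
    finally show "norm (M *v v) \<le> (\<Sum>i\<in>UNIV. \<Sum>j\<in>UNIV. cmod (M $ i $ j)) * norm v"
      by (simp add: sum_distrib_right)
  qed
qed

instance cmat :: (finite) banach
proof
  fix X :: "nat \<Rightarrow> 'a cmat" assume X: "Cauchy X"
  have "Cauchy (\<lambda>n. mat_of (X n) $ i $ j)" for i j
  proof (rule metric_CauchyI)
    fix e :: real assume "e > 0"
    then obtain N where N: "\<forall>m\<ge>N. \<forall>n\<ge>N. dist (X m) (X n) < e" using X metric_CauchyD by blast
    have "dist (mat_of (X m) $ i $ j) (mat_of (X n) $ i $ j) \<le> dist (X m) (X n)" for m n
      using norm_mat_of_entry_le[of "X m - X n" i j] by (simp add: dist_norm minus_cmat.rep_eq)
    then show "\<exists>N. \<forall>m\<ge>N. \<forall>n\<ge>N. dist (mat_of (X m) $ i $ j) (mat_of (X n) $ i $ j) < e"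
      using N by (meson le_less_trans)
  qed
  then have "\<exists>L. (\<lambda>n. mat_of (X n) $ i $ j) \<longlonglongrightarrow> L" for i j
    using Cauchy_convergent unfolding convergent_def by blast
  then obtain L where L: "\<And>i j. (\<lambda>n. mat_of (X n) $ i $ j) \<longlonglongrightarrow> L i j" by metis
  define M where "M = Cmat (\<chi> i j. L i j)"
  have Mij: "mat_of M $ i $ j = L i j" for i j by (simp add: M_def Cmat_inverse)
  have "(\<lambda>n. \<Sum>i\<in>UNIV. \<Sum>j\<in>UNIV. cmod (mat_of (X n) $ i $ j - L i j)) \<longlonglongrightarrow> (\<Sum>i\<in>(UNIV::'a set). \<Sum>j\<in>(UNIV::'a set). 0)"
    by (intro tendsto_sum tendsto_norm_zero LIM_zero L)
  then have "(\<lambda>n. X n - M) \<longlonglongrightarrow> 0"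
    by (intro Lim_null_comparison[OF always_eventually, of "\<lambda>n. X n - M"])
      (auto intro: order_trans[OF norm_cmat_le_sum] simp: minus_cmat.rep_eq Mij)
  then have "X \<longlonglongrightarrow> M" by (rule LIM_zero_cancel)
  then show "convergent X" by (auto simp: convergent_def)
qed

instance cmat :: (finite) cstar_algebra
proof
  fix x :: "'a cmat" and r :: real and c :: complex
  show "r *\<^sub>R x = complex_of_real r *\<^sub>C x" by (simp add: scaleR_cmat_def)
  have le: "norm (c *\<^sub>C x) \<le> cmod c * norm x" for c and x :: "'a cmat"
  proof transfer
    fix c and M :: "complex^'a^'a"
    show "onorm (\<lambda>v. (\<chi> i j. c * M $ i $ j) *v v) \<le> cmod c * onorm (\<lambda>v. M *v v)"
    proof (rule onorm_le)
      fix v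
      have "(\<chi> i j. c * M $ i $ j) *v v = c *s (M *v v)"
        by (simp add: vec_eq_iff matrix_vector_mult_def sum_distrib_left mult_ac)
      moreover have "norm (c *s w) = cmod c * norm w" for w :: "complex^'a"
        by (simp add: norm_vec_def L2_set_def norm_mult power_mult_distrib real_sqrt_mult flip: sum_distrib_left)
      ultimately show "norm ((\<chi> i j. c * M $ i $ j) *v v) \<le> cmod c * onorm (\<lambda>v. M *v v) * norm v"
        using onorm[OF bounded_linear_matrix_vector_mult, of M v]
        by (simp add: mult.assoc mult_left_mono)
    qed
  qed
  show "norm (c *\<^sub>C x) = cmod c * norm x"
  proof (cases "c = 0")
    case False
    have "norm x = norm (inverse c *\<^sub>C c *\<^sub>C x)" using False by (simp add: scaleC_scaleC scaleC_one)
    also have "\<dots> \<le> cmod (inverse c) * norm (c *\<^sub>C x)" by (rule le)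
    finally have "cmod c * norm x \<le> norm (c *\<^sub>C x)"
      using False by (simp add: norm_inverse norm_divide field_simps)
    then show ?thesis using le[of c x] by simp
  qed simp
  have 1: "(norm x)\<^sup>2 \<le> norm (adj x * x)" for x :: "'a cmat"
    by transfer (rule onorm_cstar_le)
  have 2: "norm x \<le> norm (adj x)" for x :: "'a cmat"
  proof (cases "x = 0")
    case False
    have "norm x * norm x \<le> norm (adj x) * norm x"
      using 1[of x] norm_mult_ineq[of "adj x" x] by (simp add: power2_eq_square)
    then show ?thesis using False by simp
  qed simp
  have "norm (adj x * x) \<le> norm x * norm x"
    using norm_mult_ineq[of "adj x" x] mult_right_mono[OF 2[of "adj x"], of "norm x"] by (simp add: adj_adj)
  then show "norm (adj x * x) = (norm x)\<^sup>2" using 1[of x] by (simp add: power2_eq_square)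
qed

section \<open>Evaluation on the free algebra and the universal property\<close>

abbreviation (input) permanent :: "'a::{comm_monoid_add,times}^3^3 \<Rightarrow> 'a" where
  "permanent A \<equiv> (\<Sum>\<sigma> | \<sigma> permutes (UNIV :: 3 set). A$1$(\<sigma> 1) * A$2$(\<sigma> 2) * A$3$(\<sigma> 3))"

lemma eval_free_superset:
  assumes "finite K" "Poly_Mapping.keys p \<subseteq> K"
  shows "eval_free A p =
    (\<Sum>w\<in>K. Poly_Mapping.lookup p w *\<^sub>C prod_list (map (\<lambda>(i, j). A$i$j) (letters w)))"
  unfolding eval_free_def using assms
  by (intro sum.mono_neutral_left) (auto simp: in_keys_iff)

lemma eval_free_single:
  "eval_free A (Poly_Mapping.single w c) = c *\<^sub>C prod_list (map (\<lambda>(i, j). A$i$j) (letters w))"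
  by (subst eval_free_superset[of "{w}"]) (auto simp: lookup_single)

lemma eval_free_add: "eval_free A (p + q) = eval_free A p + eval_free A q"
proof -
  let ?K = "Poly_Mapping.keys p \<union> Poly_Mapping.keys q"
  have "eval_free A (p + q) = (\<Sum>w\<in>?K. Poly_Mapping.lookup (p + q) w *\<^sub>C
      prod_list (map (\<lambda>(i, j). A$i$j) (letters w)))"
    by (rule eval_free_superset) (auto dest: subsetD[OF Poly_Mapping.keys_add])
  also have "\<dots> = eval_free A p + eval_free A q"
    by (simp add: lookup_add scaleC_add_left sum.distrib eval_free_superset[of ?K])
  finally show ?thesis .
qed

lemma scaleC_single: "c *\<^sub>C Poly_Mapping.single w b = Poly_Mapping.single w (c *\<^sub>C b)"
  by (intro poly_mapping_eqI) (simp add: scaleC_poly_mapping.rep_eq lookup_single when_def)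

lemma adj_single: "adj (Poly_Mapping.single w b) = Poly_Mapping.single (flip w) (adj b)"
  by (intro poly_mapping_eqI)
    (auto simp: adj_poly_mapping.rep_eq lookup_single when_def flip_flip)

lemma eval_free_scaleC: "eval_free A (c *\<^sub>C p) = c *\<^sub>C eval_free A p"
  by (induction p rule: single_sum_induct)
    (simp_all add: scaleC_single eval_free_single eval_free_add scaleC_add_right scaleC_scaleC
      scaleC_complex_def)

lemma eval_free_mult: "eval_free A (p * q) = eval_free A p * eval_free A q"
proof (induction p rule: single_sum_induct)
  case (1 w a)
  show ?case
    by (induction q rule: single_sum_induct)
      (simp_all add: mult_single eval_free_single eval_free_add distrib_left plus_word_def
        mult_scaleC_left mult_scaleC_right scaleC_scaleC mult.commute)
qed (simp add: distrib_right eval_free_add)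

lemma adj_prod_list: "adj (prod_list xs) = prod_list (rev (map adj xs))"
  by (induction xs) (simp_all add: adj_mult)

lemma eval_free_adj:
  assumes "\<And>i j. adj (A$i$j) = A$i$j"
  shows "eval_free A (adj p) = adj (eval_free A p)"
proof (induction p rule: single_sum_induct)
  case (1 w c)
  have "map adj (map (\<lambda>(i, j). A$i$j) ws) = map (\<lambda>(i, j). A$i$j) ws" for ws
    by (induction ws) (auto simp: assms)
  then show ?case
    by (simp add: adj_single eval_free_single flip_word_def adj_complex_def adj_scaleC adj_prod_list
        rev_map del: map_map)
qed (simp add: adj_add eval_free_add)

lemma eval_free_one: "eval_free A 1 = 1"
  using eval_free_single[of A 0 1] by (simp add: scaleC_one) (simp add: zero_word_def)

lemma star_hom_eval_free:
  assumes "\<And>i j. adj (A$i$j) = A$i$j"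
  shows "star_hom (eval_free A)"
  unfolding star_hom_def clinear_map_def
  using assms by (simp add: eval_free_add eval_free_scaleC eval_free_mult eval_free_one eval_free_adj)

lemma eval_free_gen [simp]: "eval_free A (free_gen$i$j) = A$i$j"
  by (simp add: free_gen_def eval_free_single scaleC_one)

lemma star_hom_prod_list: "star_hom f \<Longrightarrow> f (prod_list xs) = prod_list (map f xs)"
  by (induction xs) (simp_all add: star_homD)

lemma star_hom_eval:
  assumes "star_hom f"
  shows "f (eval_free A p) = eval_free (\<chi> i j. f (A$i$j)) p"
proof (induction p rule: single_sum_induct)
  case (1 w c)
  have "map f (map (\<lambda>(i, j). A$i$j) ws) = map (\<lambda>(i, j). (\<chi> i j. f (A$i$j))$i$j) ws" for ws
    by (induction ws) auto
  then show ?case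
    by (simp add: eval_free_single star_homD[OF assms] star_hom_prod_list[OF assms] del: map_map)
qed (simp add: eval_free_add star_homD[OF assms])

lemma so_relators_intros:
  shows "adj (A$i$j) - A$i$j \<in> so_relators A"
    "(A ** transpose A - mat 1)$i$j \<in> so_relators A"
    "(transpose A ** A - mat 1)$i$j \<in> so_relators A"
    "k \<noteq> j \<Longrightarrow> A$i$j * A$i$k + A$i$k * A$i$j \<in> so_relators A"
    "k \<noteq> i \<Longrightarrow> A$i$j * A$k$j + A$k$j * A$i$j \<in> so_relators A"
    "i \<noteq> k \<Longrightarrow> j \<noteq> l \<Longrightarrow> A$i$j * A$k$l - A$k$l * A$i$j \<in> so_relators A"
    "permanent A - 1 \<in> so_relators A"
  unfolding so_relators_def Un_iff mem_Collect_eq singleton_iff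
  subgoal by (rule disjI1, rule disjI1, rule disjI1, rule disjI1, rule disjI1, rule disjI1, blast)
  subgoal by (rule disjI1, rule disjI1, rule disjI1, rule disjI1, rule disjI1, rule disjI2, blast)
  subgoal by (rule disjI1, rule disjI1, rule disjI1, rule disjI1, rule disjI2, blast)
  subgoal by (rule disjI1, rule disjI1, rule disjI1, rule disjI2, blast)
  subgoal by (rule disjI1, rule disjI1, rule disjI2, blast)
  subgoal by (rule disjI1, rule disjI2, blast)
  subgoal by (rule disjI2, rule refl)
  done

lemma so_relatorsE:
  assumes "r \<in> so_relators A"
  obtains i j where "r = adj (A$i$j) - A$i$j"
  | i j where "r = (A ** transpose A - mat 1)$i$j"
  | i j where "r = (transpose A ** A - mat 1)$i$j"
  | i j k where "r = A$i$j * A$i$k + A$i$k * A$i$j" "k \<noteq> j"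
  | i j k where "r = A$i$j * A$k$j + A$k$j * A$i$j" "k \<noteq> i"
  | i j k l where "r = A$i$j * A$k$l - A$k$l * A$i$j" "i \<noteq> k" "j \<noteq> l"
  | "r = permanent A - 1"
  using assms unfolding so_relators_def by blast

lemma star_hom_so_relators:
  assumes f: "star_hom f" and r: "r \<in> so_relators A"
  shows "f r \<in> so_relators (\<chi> i j. f (A$i$j))"
proof -
  note s = star_homD[OF f] clinear_map_zero[OF star_hom_clinear[OF f]]
    clinear_map_diff[OF star_hom_clinear[OF f]] clinear_map_sum[OF star_hom_clinear[OF f]]
  let ?B = "\<chi> i j. f (A$i$j)"
  have m: "f ((A ** transpose A - mat 1)$i$j) = (?B ** transpose ?B - mat 1)$i$j"
    "f ((transpose A ** A - mat 1)$i$j) = (transpose ?B ** ?B - mat 1)$i$j" for i j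
    by (simp_all add: matrix_matrix_mult_def transpose_def mat_def s)
  have d: "f (permanent A - 1) =
     permanent ?B - 1"
    by (simp add: s)
  from r show ?thesis
  proof (cases rule: so_relatorsE)
    case (1 i j)
    then have "f r = adj (?B$i$j) - ?B$i$j" by (simp add: s)
    then show ?thesis using so_relators_intros(1)[of ?B i j] by simp
  next
    case (2 i j)
    then have "f r = (?B ** transpose ?B - mat 1)$i$j" using m by simp
    then show ?thesis using so_relators_intros(2)[of ?B i j] by simp
  next
    case (3 i j)
    then have "f r = (transpose ?B ** ?B - mat 1)$i$j" using m by simp
    then show ?thesis using so_relators_intros(3)[of ?B i j] by simp
  next
    case (4 i j k)
    then have "f r = ?B$i$j * ?B$i$k + ?B$i$k * ?B$i$j" by (simp add: s)
    then show ?thesis using so_relators_intros(4)[OF \<open>k \<noteq> j\<close>, of ?B] by simp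
  next
    case (5 i j k)
    then have "f r = ?B$i$j * ?B$k$j + ?B$k$j * ?B$i$j" by (simp add: s)
    then show ?thesis using so_relators_intros(5)[OF \<open>k \<noteq> i\<close>, of ?B] by simp
  next
    case (6 i j k l)
    then have "f r = ?B$i$j * ?B$k$l - ?B$k$l * ?B$i$j" by (simp add: s)
    then show ?thesis using so_relators_intros(6)[OF 6(2,3), of ?B] by simp
  next
    case 7
    then show ?thesis using d so_relators_intros(7)[of ?B] by simp
  qed
qed

lemma so_relatorsD:
  assumes "so_relators A \<subseteq> {0}"
  shows "adj (A$i$j) = A$i$j" "A ** transpose A = mat 1" "transpose A ** A = mat 1"
    "k \<noteq> j \<Longrightarrow> A$i$j * A$i$k = - (A$i$k * A$i$j)"
    "k \<noteq> i \<Longrightarrow> A$i$j * A$k$j = - (A$k$j * A$i$j)"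
    "i \<noteq> k \<Longrightarrow> j \<noteq> l \<Longrightarrow> A$i$j * A$k$l = A$k$l * A$i$j"
    "permanent A = 1"
proof -
  have z: "r = 0" if "r \<in> so_relators A" for r using that assms by blast
  have "adj (A$i$j) - A$i$j = 0" by (rule z) (rule so_relators_intros)
  then show "adj (A$i$j) = A$i$j" by simp
  have "(A ** transpose A - mat 1)$i$j = 0" for i j by (rule z) (rule so_relators_intros)
  then show "A ** transpose A = mat 1" by (simp add: vec_eq_iff)
  have "(transpose A ** A - mat 1)$i$j = 0" for i j by (rule z) (rule so_relators_intros)
  then show "transpose A ** A = mat 1" by (simp add: vec_eq_iff)
  show "A$i$j * A$i$k = - (A$i$k * A$i$j)" if "k \<noteq> j"
  proof -
    have "A$i$j * A$i$k + A$i$k * A$i$j = 0" by (rule z, rule so_relators_intros) (use that in auto)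
    then show ?thesis by (simp add: eq_neg_iff_add_eq_0)
  qed
  show "A$i$j * A$k$j = - (A$k$j * A$i$j)" if "k \<noteq> i"
  proof -
    have "A$i$j * A$k$j + A$k$j * A$i$j = 0" by (rule z, rule so_relators_intros) (use that in auto)
    then show ?thesis by (simp add: eq_neg_iff_add_eq_0)
  qed
  show "A$i$j * A$k$l = A$k$l * A$i$j" if "i \<noteq> k" "j \<noteq> l"
  proof -
    have "A$i$j * A$k$l - A$k$l * A$i$j = 0" by (rule z, rule so_relators_intros) (use that in auto)
    then show ?thesis by simp
  qed
  have "permanent A - 1 = 0"
    by (rule z) (rule so_relators_intros)
  then show "permanent A = 1" by simp
qed

lemma so_relatorsI:
  assumes "\<And>i j. adj (A$i$j) = A$i$j" "A ** transpose A = mat 1" "transpose A ** A = mat 1"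
    "\<And>i j k. k \<noteq> j \<Longrightarrow> A$i$j * A$i$k = - (A$i$k * A$i$j)"
    "\<And>i j k. k \<noteq> i \<Longrightarrow> A$i$j * A$k$j = - (A$k$j * A$i$j)"
    "\<And>i j k l. i \<noteq> k \<Longrightarrow> j \<noteq> l \<Longrightarrow> A$i$j * A$k$l = A$k$l * A$i$j"
    "permanent A = 1"
  shows "so_relators A \<subseteq> {0}"
proof
  fix r assume "r \<in> so_relators A"
  then have "r = 0"
  proof (cases rule: so_relatorsE)
    case (4 i j k)
    then show ?thesis using assms(4)[of k j i] by simp
  next
    case (5 i j k)
    then show ?thesis using assms(5)[of k i j] by simp
  qed (simp_all add: assms)
  then show "r \<in> {0}" by simp
qed

lemma star_hom_so_relators_zero:
  assumes "star_hom f" "so_relators A \<subseteq> {0}"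
  shows "so_relators (\<chi> i j. f (A$i$j)) \<subseteq> {0}"
proof -
  note s = star_homD[OF assms(1)] clinear_map_zero[OF star_hom_clinear[OF assms(1)]]
    clinear_map_minus[OF star_hom_clinear[OF assms(1)]] clinear_map_sum[OF star_hom_clinear[OF assms(1)]]
  note r = so_relatorsD[OF assms(2)]
  let ?B = "\<chi> i j. f (A$i$j)"
  have m1: "f (mat 1$i$j) = mat 1$i$j" for i j :: 3 by (simp add: mat_def s)
  have "(?B ** transpose ?B)$i$j = f ((A ** transpose A)$i$j)"
    "(transpose ?B ** ?B)$i$j = f ((transpose A ** A)$i$j)" for i j
    by (simp_all add: matrix_matrix_mult_def transpose_def s)
  then have m: "?B ** transpose ?B = mat 1" "transpose ?B ** ?B = mat 1"
    by (simp_all add: vec_eq_iff r m1)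
  have p: "?B$i$j * ?B$k$l = f (A$i$j * A$k$l)" for i j k l by (simp add: s)
  show ?thesis
  proof (rule so_relatorsI)
    show "adj (?B$i$j) = ?B$i$j" for i j by (simp add: r flip: s)
    show "?B$i$j * ?B$i$k = - (?B$i$k * ?B$i$j)" if "k \<noteq> j" for i j k
      unfolding p r(4)[OF that] by (simp add: s)
    show "?B$i$j * ?B$k$j = - (?B$k$j * ?B$i$j)" if "k \<noteq> i" for i j k
      unfolding p r(5)[OF that] by (simp add: s)
    show "?B$i$j * ?B$k$l = ?B$k$l * ?B$i$j" if "i \<noteq> k" "j \<noteq> l" for i j k l
      unfolding p r(6)[OF that] by simp
    have "f (permanent A) = f 1"
      by (simp only: r)
    then show "permanent ?B = 1"
      by (simp add: s)
  qed (fact m)+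
qed

section \<open>The universal property, derived from maximality of the norm\<close>

lemma cstar_seminorm_star_hom:
  fixes f :: "'p::complex_star_algebra \<Rightarrow> 'c::cstar_algebra"
  assumes "star_hom f"
  shows "cstar_seminorm (\<lambda>p. norm (f p))"
  unfolding cstar_seminorm_def
  by (simp add: star_homD[OF assms] norm_triangle_ineq norm_scaleC norm_mult_ineq cstar_identity)

text \<open>The norm of \<open>eval_free B\<close> is one of the seminorms over which
  \<open>is_C_SO\<close> quantifies, whatever the type of the target algebra.\<close>

lemma norm_eval_free_le:
  fixes A :: "'a::cstar_algebra^3^3" and B :: "'c::cstar_algebra^3^3"
  assumes "is_C_SO A" "so_relators B \<subseteq> {0}"
  shows "norm (eval_free B p) \<le> norm (eval_free A p)"
proof -
  have h: "star_hom (eval_free B)" using so_relatorsD(1)[OF assms(2)] by (intro star_hom_eval_free)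
  have "eval_free B r = 0" if "r \<in> so_relators free_gen" for r
    using star_hom_so_relators[OF h that] assms(2) by auto
  then show ?thesis
    using assms(1) cstar_seminorm_star_hom[OF h] unfolding is_C_SO_def by auto
qed

text \<open>The homomorphism is given by a relation, its would-be graph on a dense subalgebra, so
  that no well-definedness has to be settled in advance: contractivity applied to differences makes
  the closure of \<open>R\<close> single-valued, and completeness makes it total.\<close>

lemma dense_star_hom_extension:
  fixes R :: "('a::cstar_algebra \<times> 'c::cstar_algebra) set"
  assumes add: "\<And>x y x' y'. (x, y) \<in> R \<Longrightarrow> (x', y') \<in> R \<Longrightarrow> (x + x', y + y') \<in> R"
    and scale: "\<And>c x y. (x, y) \<in> R \<Longrightarrow> (c *\<^sub>C x, c *\<^sub>C y) \<in> R"
    and mult: "\<And>x y x' y'. (x, y) \<in> R \<Longrightarrow> (x', y') \<in> R \<Longrightarrow> (x * x', y * y') \<in> R"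
    and adj: "\<And>x y. (x, y) \<in> R \<Longrightarrow> (adj x, adj y) \<in> R"
    and one: "(1, 1) \<in> R"
    and norm: "\<And>x y. (x, y) \<in> R \<Longrightarrow> norm y \<le> norm x"
    and dense: "closure (fst ` R) = UNIV"
  obtains f where "star_hom f" "\<And>x y. (x, y) \<in> R \<Longrightarrow> f x = y"
proof -
  define G where "G = closure R"
  have seq: "(\<exists>X Y. (\<forall>n. (X n, Y n) \<in> R) \<and> X \<longlonglongrightarrow> x \<and> Y \<longlonglongrightarrow> y) \<longleftrightarrow> (x, y) \<in> G" for x y
  proof
    assume "(x, y) \<in> G"
    then obtain Z where Z: "\<forall>n. Z n \<in> R" "Z \<longlonglongrightarrow> (x, y)" unfolding G_def closure_sequential by blast
    then show "\<exists>X Y. (\<forall>n. (X n, Y n) \<in> R) \<and> X \<longlonglongrightarrow> x \<and> Y \<longlonglongrightarrow> y"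
      using tendsto_fst[OF Z(2)] tendsto_snd[OF Z(2)]
      by (intro exI[of _ "fst \<circ> Z"] exI[of _ "snd \<circ> Z"]) (simp add: o_def)
  next
    assume "\<exists>X Y. (\<forall>n. (X n, Y n) \<in> R) \<and> X \<longlonglongrightarrow> x \<and> Y \<longlonglongrightarrow> y"
    then obtain X Y where XY: "\<forall>n. (X n, Y n) \<in> R" "X \<longlonglongrightarrow> x" "Y \<longlonglongrightarrow> y" by blast
    have "(\<lambda>n. (X n, Y n)) \<longlonglongrightarrow> (x, y)" by (rule tendsto_Pair[OF XY(2,3)])
    then show "(x, y) \<in> G" unfolding G_def closure_sequential using XY(1)
      by (intro exI[of _ "\<lambda>n. (X n, Y n)"]) simp
  qed
  have diffR: "(x - x', y - y') \<in> R" if "(x, y) \<in> R" "(x', y') \<in> R" for x y x' y'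
    using add[OF that(1) scale[OF that(2), of "-1"]] by (simp add: scaleC_minus_left scaleC_one)
  have ex: "\<exists>y. (x, y) \<in> G" for x
  proof -
    have "x \<in> closure (fst ` R)" using dense by simp
    then obtain X where X: "\<forall>n. X n \<in> fst ` R" "X \<longlonglongrightarrow> x" unfolding closure_sequential by blast
    then have "\<forall>n. \<exists>y. (X n, y) \<in> R" by force
    then obtain Y where Y: "\<forall>n. (X n, Y n) \<in> R" by metis
    have "Cauchy Y"
    proof (rule metric_CauchyI)
      fix e :: real assume "e > 0"
      then obtain N where N: "\<forall>m\<ge>N. \<forall>n\<ge>N. dist (X m) (X n) < e"
        using X(2) LIMSEQ_imp_Cauchy metric_CauchyD by blast
      have "dist (Y m) (Y n) \<le> dist (X m) (X n)" for m n
        unfolding dist_norm using Y by (intro norm diffR) auto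
      then show "\<exists>N. \<forall>m\<ge>N. \<forall>n\<ge>N. dist (Y m) (Y n) < e" using N by (meson le_less_trans)
    qed
    then obtain y where "Y \<longlonglongrightarrow> y" using Cauchy_convergent_iff convergent_def by blast
    then show ?thesis using seq X(2) Y by blast
  qed
  have addG: "(x + x', y + y') \<in> G" if "(x, y) \<in> G" "(x', y') \<in> G" for x y x' y'
  proof -
    from that obtain X Y X' Y' where "\<forall>n. (X n, Y n) \<in> R" "X \<longlonglongrightarrow> x" "Y \<longlonglongrightarrow> y"
      "\<forall>n. (X' n, Y' n) \<in> R" "X' \<longlonglongrightarrow> x'" "Y' \<longlonglongrightarrow> y'" unfolding seq[symmetric] by blast
    then show ?thesis unfolding seq[symmetric]
      by (intro exI[of _ "\<lambda>n. X n + X' n"] exI[of _ "\<lambda>n. Y n + Y' n"]) (auto intro!: tendsto_add add)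
  qed
  have multG: "(x * x', y * y') \<in> G" if "(x, y) \<in> G" "(x', y') \<in> G" for x y x' y'
  proof -
    from that obtain X Y X' Y' where "\<forall>n. (X n, Y n) \<in> R" "X \<longlonglongrightarrow> x" "Y \<longlonglongrightarrow> y"
      "\<forall>n. (X' n, Y' n) \<in> R" "X' \<longlonglongrightarrow> x'" "Y' \<longlonglongrightarrow> y'" unfolding seq[symmetric] by blast
    then show ?thesis unfolding seq[symmetric]
      by (intro exI[of _ "\<lambda>n. X n * X' n"] exI[of _ "\<lambda>n. Y n * Y' n"]) (auto intro!: tendsto_mult mult)
  qed
  have scaleG: "(c *\<^sub>C x, c *\<^sub>C y) \<in> G" if "(x, y) \<in> G" for c x y
  proof -
    from that obtain X Y where "\<forall>n. (X n, Y n) \<in> R" "X \<longlonglongrightarrow> x" "Y \<longlonglongrightarrow> y" unfolding seq[symmetric] by blast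
    then show ?thesis unfolding seq[symmetric]
      by (intro exI[of _ "\<lambda>n. c *\<^sub>C X n"] exI[of _ "\<lambda>n. c *\<^sub>C Y n"]) (auto intro!: tendsto_scaleC scale)
  qed
  have adjG: "(adj x, adj y) \<in> G" if "(x, y) \<in> G" for x y
  proof -
    from that obtain X Y where "\<forall>n. (X n, Y n) \<in> R" "X \<longlonglongrightarrow> x" "Y \<longlonglongrightarrow> y" unfolding seq[symmetric] by blast
    then show ?thesis unfolding seq[symmetric]
      by (intro exI[of _ "\<lambda>n. adj (X n)"] exI[of _ "\<lambda>n. adj (Y n)"]) (auto intro!: tendsto_adj adj)
  qed
  have normG: "norm y \<le> norm x" if "(x, y) \<in> G" for x y
  proof -
    from that obtain X Y where XY: "\<forall>n. (X n, Y n) \<in> R" "X \<longlonglongrightarrow> x" "Y \<longlonglongrightarrow> y" unfolding seq[symmetric] by blast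
    show ?thesis
      by (rule LIMSEQ_le[OF tendsto_norm[OF XY(3)] tendsto_norm[OF XY(2)]]) (use XY(1) norm in blast)
  qed
  have uniq: "y = y'" if "(x, y) \<in> G" "(x, y') \<in> G" for x y y'
  proof -
    have "(x + (-1) *\<^sub>C x, y + (-1) *\<^sub>C y') \<in> G" by (intro addG scaleG that)
    then have "norm (y + (-1) *\<^sub>C y') \<le> 0"
      using normG by (fastforce simp: scaleC_minus_left scaleC_one)
    then show ?thesis by (simp add: scaleC_minus_left scaleC_one)
  qed
  obtain f where f: "\<And>x. (x, f x) \<in> G" using ex by metis
  have fG: "f x = y" if "(x, y) \<in> G" for x y using uniq f that by blast
  have RG: "R \<subseteq> G" unfolding G_def by (rule closure_subset)
  have "star_hom f"
    unfolding star_hom_def clinear_map_def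
    using RG one by (intro conjI allI fG addG scaleG multG adjG f) auto
  then show thesis using that fG RG by blast
qed

lemma universal_star_hom:
  fixes A :: "'a::cstar_algebra^3^3" and B :: "'c::cstar_algebra^3^3"
  assumes A: "is_C_SO A" and B: "so_relators B \<subseteq> {0}"
  obtains f where "star_hom f" "\<And>i j. f (A$i$j) = B$i$j"
proof -
  have "so_relators A \<subseteq> {0}" and d: "closure (range (eval_free A)) = UNIV" using A by (auto simp: is_C_SO_def)
  then have a: "star_hom (eval_free A)" using so_relatorsD(1)[of A] by (intro star_hom_eval_free)
  have b: "star_hom (eval_free B)" using so_relatorsD(1)[OF B] by (intro star_hom_eval_free)
  define R where "R = range (\<lambda>p. (eval_free A p, eval_free B p))"
  have Rp: "(eval_free A p, eval_free B p) \<in> R" for p by (simp add: R_def)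
  obtain f where f: "star_hom f" "\<And>x y. (x, y) \<in> R \<Longrightarrow> f x = y"
  proof (rule dense_star_hom_extension[of R])
    fix x y x' y' assume "(x, y) \<in> R" "(x', y') \<in> R"
    then obtain p q where pq: "x = eval_free A p" "y = eval_free B p" "x' = eval_free A q" "y' = eval_free B q"
      by (auto simp: R_def)
    show "(x + x', y + y') \<in> R" using Rp[of "p + q"] by (simp add: pq star_homD[OF a] star_homD[OF b])
    show "(x * x', y * y') \<in> R" using Rp[of "p * q"] by (simp add: pq star_homD[OF a] star_homD[OF b])
  next
    fix c x y assume "(x, y) \<in> R"
    then obtain p where p: "x = eval_free A p" "y = eval_free B p" by (auto simp: R_def)
    show "(c *\<^sub>C x, c *\<^sub>C y) \<in> R" using Rp[of "c *\<^sub>C p"] by (simp add: p star_homD[OF a] star_homD[OF b])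
    show "(adj x, adj y) \<in> R" using Rp[of "adj p"] by (simp add: p star_homD[OF a] star_homD[OF b])
    show "norm y \<le> norm x" unfolding p by (rule norm_eval_free_le[OF A B])
  next
    show "(1, 1) \<in> R" using Rp[of 1] by (simp add: star_homD[OF a] star_homD[OF b])
    show "closure (fst ` R) = UNIV" using d by (simp add: R_def image_image)
  qed blast
  have "f (eval_free A p) = eval_free B p" for p using f(2) Rp by blast
  from this[of "free_gen$i$j" for i j] show thesis using that f(1) by simp
qed

lemma star_hom_eq_on_dense:
  fixes f g :: "'a::cstar_algebra \<Rightarrow> 'c::cstar_algebra"
  assumes "star_hom f" "star_hom g" "closure S = UNIV" "\<And>x. x \<in> S \<Longrightarrow> f x = g x"
  shows "f = g"
proof -
  have c: "continuous_on UNIV f" "continuous_on UNIV g"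
    using assms(1,2) star_hom_bounded_linear by (blast intro: linear_continuous_on)+
  have "closed {x. f x = g x}" by (intro closed_Collect_eq c)
  then have "closure S \<subseteq> {x. f x = g x}" using assms(4) by (intro closure_minimal) auto
  then show ?thesis using assms(3) by auto
qed

lemma star_hom_eq_on_generators:
  fixes f g :: "'a::cstar_algebra \<Rightarrow> 'c::cstar_algebra"
  assumes A: "is_C_SO A" and "star_hom f" "star_hom g" "\<And>i j. f (A$i$j) = g (A$i$j)"
  shows "f = g"
  by (rule star_hom_eq_on_dense[of f g "range (eval_free A)"])
    (use A assms in \<open>auto simp: is_C_SO_def star_hom_eval\<close>)

section \<open>The representations attached to rotations\<close>

text \<open>The unit quaternions \<open>i\<close>, \<open>j\<close>, \<open>k\<close>, \<open>1\<close> are indexed by \<open>1\<close>, \<open>2\<close>, \<open>3\<close>, \<open>4\<close>: the product of the units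
  with indices \<open>a\<close> and \<open>b\<close> is \<open>quat_sign a b\<close> times the unit with index \<open>quat_index a b\<close>.\<close>

definition quat_index :: "4 \<Rightarrow> 4 \<Rightarrow> 4" where
  "quat_index a b = (if a = b then 4 else if a = 4 then b else if b = 4 then a else 2 - a - b)"

definition quat_sign :: "4 \<Rightarrow> 4 \<Rightarrow> complex" where
  "quat_sign a b = (if a = 4 \<or> b = 4 then 1 else if a = b then -1
     else if (a, b) \<in> {(1, 2), (2, 3), (3, 1)} then 1 else -1)"

definition quat_conj_sign :: "4 \<Rightarrow> complex" where
  "quat_conj_sign a = (if a = 4 then 1 else -1)"

text \<open>The indices form the Klein four-group with neutral element 4. In the numeral type
  \<open>4\<close> the imaginary indices add up to 6 = 2, so \<open>2 - a - b\<close> is the third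
  one.\<close>

lemma quat_index_assoc: "quat_index (quat_index a b) c = quat_index a (quat_index b c)"
  using exhaust_4[of a] exhaust_4[of b] exhaust_4[of c]
  by (elim disjE) (simp_all add: quat_index_def)

text \<open>Associativity of the quaternions in terms of signs: \<open>quat_sign\<close> is a
  2-cocycle on the Klein four-group.\<close>

lemma quat_sign_assoc:
  "quat_sign a b * quat_sign (quat_index a b) c = quat_sign a (quat_index b c) * quat_sign b c"
  using exhaust_4[of a] exhaust_4[of b] exhaust_4[of c]
  by (elim disjE) (simp_all add: quat_index_def quat_sign_def)

lemma quat_index_commute: "quat_index a b = quat_index b a"
  by (auto simp: quat_index_def algebra_simps)

lemma quat_index_cancel [simp]: "quat_index a (quat_index a b) = b"
  using exhaust_4[of a] exhaust_4[of b]
  by (elim disjE) (simp_all add: quat_index_def)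

lemma quat_simps [simp]:
  "quat_index a a = 4" "quat_index a 4 = a" "quat_index 4 a = a"
  "quat_sign a 4 = 1" "quat_sign 4 a = 1" "quat_sign a a = quat_conj_sign a"
  "cnj (quat_sign a b) = quat_sign a b" "quat_sign a b * quat_sign a b = 1"
  "cnj (quat_conj_sign a) = quat_conj_sign a" "quat_conj_sign a * quat_conj_sign a = 1"
  by (auto simp: quat_index_def quat_sign_def quat_conj_sign_def)

text \<open>Quaternion conjugation reverses products; these are the signs on its two sides.\<close>

lemma quat_conj_sign_mult:
  "quat_conj_sign a * quat_conj_sign b * quat_sign b a = quat_sign a b * quat_conj_sign (quat_index a b)"
  using exhaust_4[of a] exhaust_4[of b]
  by (elim disjE) (simp_all add: quat_index_def quat_sign_def quat_conj_sign_def)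

definition quat_left :: "4 \<Rightarrow> 4 cmat" where
  "quat_left a = Cmat (\<chi> i j. if i = quat_index a j then quat_sign a j else 0)"

text \<open>Right multiplication by the conjugate unit. The conjugation undoes the reversal of
  order, so that these operators multiply by the same rule as \<open>quat_left\<close>.\<close>

definition quat_right :: "4 \<Rightarrow> 4 cmat" where
  "quat_right a = Cmat (\<chi> i j. if i = quat_index j a then quat_conj_sign a * quat_sign j a else 0)"

lemma cmat_eqI: "(\<And>i j. mat_of M $ i $ j = mat_of N $ i $ j) \<Longrightarrow> M = N"
  by (metis mat_of_inject vec_eq_iff)

lemma mat_of_entries:
  "mat_of (c *\<^sub>C M) $ i $ j = c * mat_of M $ i $ j"
  "mat_of (M * N) $ i $ j = (\<Sum>k\<in>UNIV. mat_of M $ i $ k * mat_of N $ k $ j)"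
  "mat_of (adj M) $ i $ j = cnj (mat_of M $ j $ i)"
  "mat_of (M + N) $ i $ j = mat_of M $ i $ j + mat_of N $ i $ j"
  "mat_of 1 $ i $ j = (if i = j then 1 else 0)"
  "mat_of 0 $ i $ j = 0"
  "mat_of (quat_left a) $ p $ q = (if p = quat_index a q then quat_sign a q else 0)"
  "mat_of (quat_right a) $ p $ q = (if p = quat_index q a then quat_conj_sign a * quat_sign q a else 0)"
  by (simp_all add: scaleC_cmat.rep_eq times_cmat.rep_eq matrix_matrix_mult_def adj_cmat.rep_eq
      conj_transpose_def plus_cmat.rep_eq one_cmat.rep_eq mat_def zero_cmat.rep_eq
      quat_left_def quat_right_def Cmat_inverse)

lemma sum_mono_entry:
  fixes f :: "'a::finite \<Rightarrow> complex"
  shows "(\<Sum>k\<in>UNIV. f k * (if k = l then g k else 0)) = f l * g l"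
  by (simp add: if_distrib cong: if_cong)

lemma quat_left_mult: "quat_left a * quat_left b = quat_sign a b *\<^sub>C quat_left (quat_index a b)"
  by (rule cmat_eqI) (simp add: mat_of_entries sum_mono_entry quat_index_assoc quat_sign_assoc)

lemma quat_right_mult: "quat_right a * quat_right b = quat_sign a b *\<^sub>C quat_right (quat_index a b)"
proof (rule cmat_eqI)
  fix i j
  have 1: "quat_index (quat_index j b) a = quat_index j (quat_index a b)"
    by (metis quat_index_assoc quat_index_commute)
  have "quat_conj_sign a * quat_sign (quat_index j b) a * (quat_conj_sign b * quat_sign j b) =
      quat_conj_sign a * quat_conj_sign b * (quat_sign j b * quat_sign (quat_index j b) a)"
    by (simp add: mult_ac)
  also have "\<dots> = (quat_conj_sign a * quat_conj_sign b * quat_sign b a) * quat_sign j (quat_index a b)"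
    unfolding quat_sign_assoc by (simp add: mult_ac quat_index_commute)
  also have "\<dots> = quat_sign a b * (quat_conj_sign (quat_index a b) * quat_sign j (quat_index a b))"
    unfolding quat_conj_sign_mult by (simp add: mult_ac)
  finally show "mat_of (quat_right a * quat_right b) $ i $ j =
      mat_of (quat_sign a b *\<^sub>C quat_right (quat_index a b)) $ i $ j"
    by (simp add: mat_of_entries sum_mono_entry 1)
qed

lemma quat_left_right_commute: "quat_right b * quat_left a = quat_left a * quat_right b"
proof (rule cmat_eqI)
  fix i j
  show "mat_of (quat_right b * quat_left a) $ i $ j = mat_of (quat_left a * quat_right b) $ i $ j"
    using quat_sign_assoc[of a j b]
    by (simp only: mat_of_entries sum_mono_entry quat_index_assoc) (auto simp: mult_ac)
qed

lemma quat_left_right_commute': "quat_right b * (quat_left a * x) = quat_left a * (quat_right b * x)"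
  by (metis mult.assoc quat_left_right_commute)

lemma quat_left_4 [simp]: "quat_left 4 = 1" and quat_right_4 [simp]: "quat_right 4 = 1"
  by (rule cmat_eqI; simp add: mat_of_entries quat_conj_sign_def)+

lemma adj_quat_left: "adj (quat_left a) = quat_conj_sign a *\<^sub>C quat_left a"
proof (rule cmat_eqI)
  fix i j
  have "quat_sign a (quat_index a j) = quat_conj_sign a * quat_sign a j"
    using quat_sign_assoc[of a a j] by (metis mult.assoc mult.commute mult.left_neutral quat_simps(1,5,6,8))
  then show "mat_of (adj (quat_left a)) $ i $ j = mat_of (quat_conj_sign a *\<^sub>C quat_left a) $ i $ j"
    by (auto simp: mat_of_entries)
qed

lemma adj_quat_right: "adj (quat_right a) = quat_conj_sign a *\<^sub>C quat_right a"
proof (rule cmat_eqI)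
  fix i j
  have "quat_sign (quat_index j a) a = quat_conj_sign a * quat_sign j a"
    using quat_sign_assoc[of j a a] by (metis mult.assoc mult.commute mult.left_neutral quat_simps(1,4,6,8))
  moreover have "quat_index (quat_index i a) a = i" for i by (simp add: quat_index_assoc)
  ultimately show "mat_of (adj (quat_right a)) $ i $ j = mat_of (quat_conj_sign a *\<^sub>C quat_right a) $ i $ j"
    by (auto simp: mat_of_entries)
qed

section \<open>The nine generating operators and their relations\<close>

definition quat_unit :: "3 \<Rightarrow> 4" where
  "quat_unit i = (if i = 1 then 1 else if i = 2 then 2 else 3)"

lemma quat_unit_simps [simp]:
  "quat_unit 1 = 1" "quat_unit 2 = 2" "quat_unit 3 = 3" "quat_conj_sign (quat_unit i) = -1"
  using exhaust_3[of i] by (auto simp: quat_unit_def quat_conj_sign_def)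

lemma quat_unit_anticommute:
  "quat_sign (quat_unit i) (quat_unit k) =
    (if i = k then 1 else -1) * quat_sign (quat_unit k) (quat_unit i)"
  using exhaust_3[of i] exhaust_3[of k]
  by (elim disjE) (simp_all add: quat_sign_def)

definition quat_gen :: "3 \<times> 3 \<Rightarrow> 4 cmat" where
  "quat_gen g = quat_left (quat_unit (fst g)) * quat_right (quat_unit (snd g))"

text \<open>The exchange sign of two generators: -1 if they share exactly one of row and column, and
  1 otherwise, which covers the relations (2) to (4).\<close>

definition gen_sign :: "3 \<times> 3 \<Rightarrow> 3 \<times> 3 \<Rightarrow> complex" where
  "gen_sign g h = (if fst g = fst h then 1 else -1) * (if snd g = snd h then 1 else -1)"

lemma quat_gen_mult: "quat_gen g * quat_gen h =
    (quat_left (quat_unit (fst g)) * quat_left (quat_unit (fst h))) *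
    (quat_right (quat_unit (snd g)) * quat_right (quat_unit (snd h)))"
  by (simp add: quat_gen_def mult.assoc quat_left_right_commute')

lemma quat_gen_commute: "quat_gen g * quat_gen h = gen_sign g h *\<^sub>C (quat_gen h * quat_gen g)"
  unfolding quat_gen_mult quat_left_mult quat_right_mult gen_sign_def
  by (simp add: mult_scaleC_left mult_scaleC_right scaleC_scaleC
      quat_unit_anticommute[of "fst g"] quat_unit_anticommute[of "snd g"] quat_index_commute mult_ac)

lemma quat_gen_square: "quat_gen g * quat_gen g = 1"
  unfolding quat_gen_mult quat_left_mult quat_right_mult
  by (simp add: mult_scaleC_left mult_scaleC_right scaleC_scaleC scaleC_one)

lemma adj_quat_gen: "adj (quat_gen g) = quat_gen g"
  by (simp add: quat_gen_def adj_mult adj_quat_left adj_quat_right mult_scaleC_left mult_scaleC_right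
      scaleC_scaleC scaleC_one quat_left_right_commute)

lemma norm_quat_gen: "norm (quat_gen g) = 1"
  by (rule norm_unitary_le) (simp add: adj_quat_gen quat_gen_square)

text \<open>Defined for every real matrix, since the norm estimates let \<open>y\<close> range over
  a box. Self-adjointness and the exchange relations hold for all \<open>y\<close>; only
  orthogonality and the permanent relation single out the rotations.\<close>

definition quat_rep :: "real^3^3 \<Rightarrow> 4 cmat^3^3" where
  "quat_rep y = (\<chi> i j. y$i$j *\<^sub>R quat_gen (i, j))"

definition rotations :: "(real^3^3) set" where
  "rotations = {g. g ** transpose g = mat 1 \<and> det g = 1}"

lemma sum_permutations_3:
  "(\<Sum>\<sigma> | \<sigma> permutes (UNIV :: 3 set). f (\<sigma> 1) (\<sigma> 2) (\<sigma> 3)) =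
    f 1 2 3 + f 1 3 2 + f 2 1 3 + f 2 3 1 + f 3 1 2 + (f 3 2 1 :: 'a::comm_monoid_add)"
proof -
  have f123: "finite {2::3, 3}" "1 \<notin> {2::3, 3}" by auto
  have f23: "finite {3::3}" "2 \<notin> {3::3}" by auto
  show ?thesis
    unfolding UNIV_3 sum_over_permutations_insert[OF f123] sum_over_permutations_insert[OF f23]
      permutes_sing
    by (simp add: transpose_def swap_id_eq ac_simps)
qed

text \<open>In the product of the generators \<open>(i, k)\<close> and \<open>(j, k)\<close> the two
  equal right multiplications give -1 whatever \<open>k\<close> is, so the sum over \<open>k\<close>
  is a sum of scalars times one fixed operator.\<close>

lemma quat_rep_orthogonal_relator:
  "(quat_rep y ** transpose (quat_rep y) - mat 1)$i$j =
    - complex_of_real ((y ** transpose y - mat 1)$i$j) *\<^sub>C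
      (quat_left (quat_unit i) * quat_left (quat_unit j))"
proof -
  have *: "quat_gen (i, k) * quat_gen (j, k) = - (quat_left (quat_unit i) * quat_left (quat_unit j))" for k
    unfolding quat_gen_mult by (simp add: quat_right_mult[of "quat_unit k" "quat_unit k"]
        scaleC_minus_left scaleC_one)
  have "(quat_rep y ** transpose (quat_rep y))$i$j =
      - complex_of_real ((y ** transpose y)$i$j) *\<^sub>C (quat_left (quat_unit i) * quat_left (quat_unit j))"
    by (simp add: matrix_matrix_mult_def transpose_def quat_rep_def mult_scaleC_left mult_scaleC_right scaleC_scaleC * scaleR_scaleC scaleC_sum_left
        scaleC_minus_left scaleC_minus_right sum_negf mult_ac)
  moreover have "(mat 1 :: 4 cmat^3^3)$i$j =
      - complex_of_real ((mat 1 :: real^3^3)$i$j) *\<^sub>C (quat_left (quat_unit i) * quat_left (quat_unit j))"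
    by (simp add: mat_def quat_left_mult scaleC_scaleC scaleC_one)
  ultimately show ?thesis by (simp add: scaleC_minus_left scaleC_add_left algebra_simps)
      (simp add: scaleC_minus_left flip: scaleC_add_left)
qed

text \<open>The left factors contribute \<open>ijk = -1\<close> and the right factors contribute
  minus the sign of the permutation. The sum without signs in the relation thus becomes the
  determinant of \<open>y\<close>.\<close>

lemma quat_rep_det_relator:
  "permanent (quat_rep y) - 1 =
    complex_of_real (det y - 1) *\<^sub>C 1"
proof -
  have g: "quat_gen (1, a) * quat_gen (2, b) * quat_gen (3, c) =
      - (quat_right (quat_unit a) * quat_right (quat_unit b) * quat_right (quat_unit c))" for a b c
  proof -
    have "quat_gen (1, a) * quat_gen (2, b) * quat_gen (3, c) =
        (quat_left 1 * quat_left 2 * quat_left 3) *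
        (quat_right (quat_unit a) * quat_right (quat_unit b) * quat_right (quat_unit c))"
      by (simp add: quat_gen_def mult.assoc quat_left_right_commute')
    also have "quat_left 1 * quat_left 2 * quat_left 3 = -1"
      by (simp add: quat_left_mult mult_scaleC_left scaleC_scaleC quat_sign_def quat_index_def
          scaleC_minus_left scaleC_one)
    finally show ?thesis by simp
  qed
  have t: "quat_gen (1, 1) * quat_gen (2, 2) * quat_gen (3, 3) = 1 *\<^sub>C 1"
    "quat_gen (1, 1) * quat_gen (2, 3) * quat_gen (3, 2) = (-1) *\<^sub>C 1"
    "quat_gen (1, 2) * quat_gen (2, 1) * quat_gen (3, 3) = (-1) *\<^sub>C 1"
    "quat_gen (1, 2) * quat_gen (2, 3) * quat_gen (3, 1) = 1 *\<^sub>C 1"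
    "quat_gen (1, 3) * quat_gen (2, 1) * quat_gen (3, 2) = 1 *\<^sub>C 1"
    "quat_gen (1, 3) * quat_gen (2, 2) * quat_gen (3, 1) = (-1) *\<^sub>C 1"
    unfolding g by (simp_all add: quat_right_mult mult_scaleC_left scaleC_scaleC quat_sign_def
        quat_index_def scaleC_minus_left scaleC_one)
  have e: "quat_rep y$1$a * quat_rep y$2$b * quat_rep y$3$c =
      complex_of_real (y$1$a * y$2$b * y$3$c) *\<^sub>C (quat_gen (1, a) * quat_gen (2, b) * quat_gen (3, c))" for a b c
    by (simp add: quat_rep_def scaleR_scaleC mult_scaleC_left mult_scaleC_right scaleC_scaleC mult_ac)
  have one: "x - 1 = x + (-1) *\<^sub>C 1" for x :: "4 cmat" by (simp add: scaleC_minus_left scaleC_one)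
  have "permanent (quat_rep y) =
      quat_rep y$1$1 * quat_rep y$2$2 * quat_rep y$3$3 + quat_rep y$1$1 * quat_rep y$2$3 * quat_rep y$3$2 +
      quat_rep y$1$2 * quat_rep y$2$1 * quat_rep y$3$3 + quat_rep y$1$2 * quat_rep y$2$3 * quat_rep y$3$1 +
      quat_rep y$1$3 * quat_rep y$2$1 * quat_rep y$3$2 + quat_rep y$1$3 * quat_rep y$2$2 * quat_rep y$3$1"
    by (rule sum_permutations_3[of "\<lambda>a b c. quat_rep y$1$a * quat_rep y$2$b * quat_rep y$3$c"])
  then show ?thesis
    unfolding e t scaleC_scaleC one det_3
    by (simp only: flip: scaleC_add_left) (rule arg_cong[where f = "\<lambda>c. c *\<^sub>C 1"], simp)
qed

lemma quat_rep_commute: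
  "quat_rep y$i$j * quat_rep y$k$l = gen_sign (i, j) (k, l) *\<^sub>C (quat_rep y$k$l * quat_rep y$i$j)"
  using quat_gen_commute[of "(i, j)" "(k, l)"]
  by (simp add: quat_rep_def scaleR_scaleC mult_scaleC_left mult_scaleC_right scaleC_scaleC mult_ac)

lemma adj_quat_rep: "adj (quat_rep y$i$j) = quat_rep y$i$j"
  by (simp add: quat_rep_def scaleR_scaleC adj_scaleC adj_quat_gen)

lemma rotations_transpose: "g \<in> rotations \<Longrightarrow> transpose g \<in> rotations"
  by (simp add: rotations_def det_transpose) (metis matrix_left_right_inverse)

lemma quat_rep_transpose_relator:
  assumes "transpose y ** y = mat 1"
  shows "transpose (quat_rep y) ** quat_rep y = mat 1"
proof -
  have *: "quat_gen (k, i) * quat_gen (k, j) = - (quat_right (quat_unit i) * quat_right (quat_unit j))" for i j k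
    unfolding quat_gen_mult by (simp add: quat_left_mult[of "quat_unit k" "quat_unit k"]
        scaleC_minus_left scaleC_one)
  have "(transpose (quat_rep y) ** quat_rep y)$i$j =
      - complex_of_real ((transpose y ** y)$i$j) *\<^sub>C (quat_right (quat_unit i) * quat_right (quat_unit j))" for i j
    by (simp add: matrix_matrix_mult_def transpose_def quat_rep_def mult_scaleC_left mult_scaleC_right scaleC_scaleC * scaleR_scaleC scaleC_sum_left
        scaleC_minus_left scaleC_minus_right sum_negf mult_ac)
  then show ?thesis
    by (simp add: vec_eq_iff assms mat_def quat_right_mult scaleC_scaleC scaleC_one scaleC_minus_left)
qed

lemma so_relators_quat_rep:
  assumes g: "g \<in> rotations"
  shows "so_relators (quat_rep g) \<subseteq> {0}"
proof (rule so_relatorsI)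
  have o: "g ** transpose g = mat 1" "transpose g ** g = mat 1" "det g = 1"
    using g rotations_transpose[OF g] by (auto simp: rotations_def)
  have "(quat_rep g ** transpose (quat_rep g) - mat 1)$i$j = 0" for i j
    unfolding quat_rep_orthogonal_relator by (simp add: o scaleC_minus_left)
  then show "quat_rep g ** transpose (quat_rep g) = mat 1" by (simp add: vec_eq_iff)
  show "transpose (quat_rep g) ** quat_rep g = mat 1" by (rule quat_rep_transpose_relator[OF o(2)])
  show "permanent (quat_rep g) = 1"
    using quat_rep_det_relator[of g] by (simp add: o)
  show "quat_rep g$i$j * quat_rep g$i$k = - (quat_rep g$i$k * quat_rep g$i$j)" if "k \<noteq> j" for i j k
    unfolding quat_rep_commute[of g i j i k] using that
    by (simp add: gen_sign_def scaleC_minus_left scaleC_one)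
  show "quat_rep g$i$j * quat_rep g$k$j = - (quat_rep g$k$j * quat_rep g$i$j)" if "k \<noteq> i" for i j k
    unfolding quat_rep_commute[of g i j k j] using that
    by (simp add: gen_sign_def scaleC_minus_left scaleC_one)
  show "quat_rep g$i$j * quat_rep g$k$l = quat_rep g$k$l * quat_rep g$i$j" if "i \<noteq> k" "j \<noteq> l" for i j k l
    unfolding quat_rep_commute[of g i j k l] using that
    by (simp add: gen_sign_def scaleC_one)
qed (rule adj_quat_rep)

section \<open>Rotations determine the norm\<close>

text \<open>If \<open>Y < X\<close>, the powers of \<open>X / Y\<close> with exponent
  \<open>N = 2 ^ m\<close> would be bounded by a polynomial in \<open>N\<close>. The exponent 9 is
  the number of generators.\<close>

lemma power_growth_le:
  fixes X Y C d :: real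
  assumes "0 \<le> X" "0 \<le> Y" "0 < d" "0 < C" and le: "\<And>m. X ^ (2 ^ m) \<le> (2 * d * 2 ^ m + 1) ^ 9 * C * Y ^ (2 ^ m)"
  shows "X \<le> Y"
proof (rule ccontr)
  assume "\<not> X \<le> Y"
  then have XY: "Y < X" by simp
  then have "X > 0" using assms by simp
  show False
  proof (cases "Y = 0")
    case True
    then show ?thesis using le[of 0] \<open>X > 0\<close> by simp
  next
    case False
    define r where "r = X / Y"
    have r: "r > 1" using XY False assms by (simp add: r_def)
    have "((\<lambda>n. (2 * d * real n + 1) ^ 9 * C / r ^ n) \<longlongrightarrow> 0) sequentially"
      using r \<open>0 < d\<close> \<open>0 < C\<close> by real_asymp
    then have "\<forall>\<^sub>F n in sequentially. (2 * d * real n + 1) ^ 9 * C / r ^ n < 1"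
      by (rule order_tendstoD) simp
    then obtain N where N: "\<And>n. n \<ge> N \<Longrightarrow> (2 * d * real n + 1) ^ 9 * C / r ^ n < 1"
      unfolding eventually_sequentially by blast
    have "N \<le> 2 ^ N" by (simp add: less_imp_le)
    from N[OF this] have "(2 * d * 2 ^ N + 1) ^ 9 * C < r ^ (2 ^ N)" using r by simp
    moreover have "r ^ (2 ^ N) \<le> (2 * d * 2 ^ N + 1) ^ 9 * C"
      using le[of N] False assms(2) by (simp add: r_def power_divide divide_le_eq)
    ultimately show False by simp
  qed
qed

definition word_degree_le :: "free_so \<Rightarrow> nat \<Rightarrow> bool" where
  "word_degree_le p n \<longleftrightarrow> (\<forall>w\<in>Poly_Mapping.keys p. length (letters w) \<le> n)"

lemma word_degree_exists: "\<exists>n. word_degree_le p n"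
proof -
  have "finite ((\<lambda>w. length (letters w)) ` Poly_Mapping.keys p)" by simp
  then show ?thesis unfolding word_degree_le_def using Max_ge by (metis imageI)
qed

lemma word_degree_mult:
  assumes "word_degree_le p m" "word_degree_le q n"
  shows "word_degree_le (p * q) (m + n)"
  unfolding word_degree_le_def
proof
  fix w assume "w \<in> Poly_Mapping.keys (p * q)"
  then obtain a b where "w = a + b" "a \<in> Poly_Mapping.keys p" "b \<in> Poly_Mapping.keys q"
    using keys_mult[of p q] by blast
  then show "length (letters w) \<le> m + n"
    using assms by (simp add: word_degree_le_def plus_word_def add_mono)
qed

lemma word_degree_power: "word_degree_le p m \<Longrightarrow> word_degree_le (p ^ k) (k * m)"
proof (induction k)
  case 0
  then show ?case by (simp add: word_degree_le_def zero_word_def)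
next
  case (Suc k)
  then show ?case using word_degree_mult[of p m "p ^ k" "k * m"] by simp
qed

lemma generators_commute:
  assumes "so_relators A \<subseteq> {0}"
  shows "A$i$j * A$k$l = gen_sign (i, j) (k, l) *\<^sub>C (A$k$l * A$i$j)"
proof (cases "i = k"; cases "j = l")
  assume "i = k" "j = l"
  then show ?thesis by (simp add: gen_sign_def scaleC_one)
next
  assume *: "i = k" "j \<noteq> l"
  then have "gen_sign (i, j) (k, l) = -1" by (simp add: gen_sign_def)
  then show ?thesis unfolding \<open>i = k\<close> using so_relatorsD(4)[OF assms, of l j k] *
    by (metis scaleC_minus_left scaleC_one)
next
  assume *: "i \<noteq> k" "j = l"
  then have "gen_sign (i, j) (k, l) = -1" by (simp add: gen_sign_def)
  then show ?thesis unfolding \<open>j = l\<close> using so_relatorsD(5)[OF assms, of k i l] *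
    by (metis scaleC_minus_left scaleC_one)
next
  assume *: "i \<noteq> k" "j \<noteq> l"
  then have "gen_sign (i, j) (k, l) = 1" by (simp add: gen_sign_def)
  then show ?thesis using so_relatorsD(6)[OF assms *] by (metis scaleC_one)
qed

lemma eval_free_ordered:
  assumes "\<And>i j k l. B$i$j * B$k$l = gen_sign (i, j) (k, l) *\<^sub>C (B$k$l * B$i$j)"
    and "distinct gs" "set gs = UNIV"
  shows "eval_free B p = (\<Sum>w\<in>Poly_Mapping.keys p.
    (Poly_Mapping.lookup p w * reordering_sign gen_sign gs (letters w)) *\<^sub>C
    prod_list (map (\<lambda>(i, j). (B$i$j) ^ count_list (letters w) (i, j)) gs))"
proof -
  have "prod_list (map (\<lambda>(i, j). B$i$j) ws) = reordering_sign gen_sign gs ws *\<^sub>C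
      prod_list (map (\<lambda>g. (case g of (i, j) \<Rightarrow> B$i$j) ^ count_list ws g) gs)" for ws
  proof (rule prod_list_reordering)
    fix g h :: "3 \<times> 3"
    show "(case g of (i, j) \<Rightarrow> B$i$j) * (case h of (i, j) \<Rightarrow> B$i$j) =
        gen_sign g h *\<^sub>C ((case h of (i, j) \<Rightarrow> B$i$j) * (case g of (i, j) \<Rightarrow> B$i$j))"
      using assms(1)[of "fst g" "snd g" "fst h" "snd h"] by (simp only: split_def prod.collapse)
  qed (use assms(2,3) in auto)
  moreover have "(case g of (i, j) \<Rightarrow> B$i$j) ^ count_list ws g =
      (case g of (i, j) \<Rightarrow> (B$i$j) ^ count_list ws (i, j))" for g ws
    by (simp split: prod.splits)
  ultimately show ?thesis unfolding eval_free_def by (simp add: scaleC_scaleC)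
qed

text \<open>Sorting the letters brings every word into one fixed order, with the same coefficients
  for \<open>A\<close> and for all \<open>quat_rep y\<close>, because both obey the same exchange
  signs. Replacing the nine generators by real numbers costs \<open>2 * n + 1\<close> each; putting
  the operators \<open>quat_gen\<close> back costs 2 each.\<close>

lemma norm_eval_free_polynomial_bound:
  fixes A :: "'a::cstar_algebra^3^3"
  assumes A: "so_relators A \<subseteq> {0}" and c: "c > 0" "\<And>i j. norm (A$i$j) \<le> c / 2"
    and deg: "word_degree_le p n"
    and S: "\<And>y. (\<And>i j. \<bar>y$i$j\<bar> \<le> c) \<Longrightarrow> norm (eval_free (quat_rep y) p) \<le> S"
  shows "norm (eval_free A p) \<le> (2 * real n + 1) ^ 9 * (2 ^ 9 * S)"
proof -
  obtain gs where gs: "set gs = (UNIV :: (3 \<times> 3) set)" "distinct gs"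
    using finite_distinct_list[of "UNIV :: (3 \<times> 3) set"] by auto
  have len: "length gs = 9" using distinct_card[OF gs(2)] gs(1) by simp
  define W where "W = Poly_Mapping.keys p"
  define C where "C = (\<lambda>w. Poly_Mapping.lookup p w * reordering_sign gen_sign gs (letters w))"
  define k where "k = (\<lambda>w :: (3 \<times> 3) word. count_list (letters w))"
  have ev: "eval_free B p = (\<Sum>w\<in>W. C w *\<^sub>C prod_list (map (\<lambda>g. (B $ fst g $ snd g) ^ k w g) gs))"
    if "\<And>i j k l. B$i$j * B$k$l = gen_sign (i, j) (k, l) *\<^sub>C (B$k$l * B$i$j)"
    for B :: "'z::complex_star_algebra^3^3"
    using eval_free_ordered[OF that gs(2,1)]
    by (simp add: W_def C_def k_def split_def)
  have "norm (eval_free A p) \<le> (2 * real n + 1) ^ length gs * (2 ^ 9 * S)"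
    unfolding ev[OF generators_commute[OF A]]
  proof (rule ordered_monomials_bound)
    show "k w g \<le> n" if "w \<in> W" for w g
      using that deg count_le_length[of "letters w" g] by (auto simp: W_def word_degree_le_def k_def)
    fix y :: "3 \<times> 3 \<Rightarrow> real" assume y: "\<And>g. \<bar>y g\<bar> \<le> c"
    have "norm (\<Sum>w\<in>W. prod_list (map (\<lambda>g. complex_of_real (y g) ^ k w g) gs) *\<^sub>C (C w *\<^sub>C (1 :: 4 cmat)))
        \<le> 2 ^ length gs * S"
    \<comment> \<open>The coefficients are taken as multiples of the identity, so that the norm on
      the left is the modulus of an ordinary polynomial in the coordinates of
      \<open>y\<close>.\<close>
    proof (rule involution_twist_bound[where \<tau> = quat_gen and c = c])
      fix y :: "3 \<times> 3 \<Rightarrow> real" assume y: "\<And>g. \<bar>y g\<bar> \<le> c"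
      have "norm (eval_free (quat_rep (\<chi> i j. y (i, j))) p) \<le> S" by (rule S) (simp add: y)
      then show "norm (\<Sum>w\<in>W. C w *\<^sub>C (1 :: 4 cmat) *
          prod_list (map (\<lambda>g. (complex_of_real (y g) *\<^sub>C quat_gen g) ^ k w g) gs)) \<le> S"
        unfolding ev[OF quat_rep_commute]
        by (simp add: quat_rep_def scaleR_scaleC mult_scaleC_left)
    qed (use y gs in \<open>auto simp: W_def quat_gen_square norm_quat_gen\<close>)
    also have "(\<Sum>w\<in>W. prod_list (map (\<lambda>g. complex_of_real (y g) ^ k w g) gs) *\<^sub>C (C w *\<^sub>C (1 :: 4 cmat))) =
        (\<Sum>w\<in>W. C w * prod_list (map (\<lambda>g. complex_of_real (y g) ^ k w g) gs)) *\<^sub>C 1"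
      unfolding scaleC_scaleC scaleC_sum_left by (intro sum.cong refl arg_cong2[where f = scaleC] mult.commute)
    finally show "cmod (\<Sum>w\<in>W. C w * prod_list (map (\<lambda>g. complex_of_real (y g) ^ k w g) gs)) \<le> 2 ^ 9 * S"
      by (simp add: len norm_scaleC)
  qed (use A c gs in \<open>auto simp: W_def so_relatorsD\<close>)
  then show ?thesis by (simp add: len)
qed

text \<open>For the powers \<open>(adj p * p) ^ (2 ^ m)\<close> the degree, hence the factor, grows
  polynomially in \<open>2 ^ m\<close>, whereas the norms are exact powers because
  \<open>adj p * p\<close> becomes self-adjoint under every evaluation involved.\<close>

lemma norm_eval_free_le_box:
  fixes A :: "'a::cstar_algebra^3^3"
  assumes A: "so_relators A \<subseteq> {0}" and c: "c > 0" "\<And>i j. norm (A$i$j) \<le> c / 2"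
    and S: "\<And>y. (\<And>i j. \<bar>y$i$j\<bar> \<le> c) \<Longrightarrow> norm (eval_free (quat_rep y) p) \<le> S"
  shows "norm (eval_free A p) \<le> S"
proof -
  have "norm (eval_free (quat_rep 0) p) \<le> S" by (rule S) (use c(1) in simp)
  then have S0: "0 \<le> S" by (rule order_trans[OF norm_ge_zero])
  obtain d0 where "word_degree_le (adj p * p) d0" using word_degree_exists by blast
  \<comment> \<open>The successor makes the degree bound positive, as \<open>power_growth_le\<close>
    demands.\<close>
  then have d: "word_degree_le (adj p * p) (Suc d0)" by (auto simp: word_degree_le_def)
  define d where "d = Suc d0"
  note d = d[folded d_def]
  have a: "star_hom (eval_free A)" using so_relatorsD(1)[OF A] by (rule star_hom_eval_free)
  have q: "star_hom (eval_free (quat_rep y))" for y by (rule star_hom_eval_free) (rule adj_quat_rep)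
  have pw: "norm ((adj x * x) ^ (2 ^ m)) = ((norm x)\<^sup>2) ^ (2 ^ m)" for x :: "'c::cstar_algebra" and m
    by (simp add: norm_selfadjoint_power adj_mult adj_adj cstar_identity)
  have "(norm (eval_free A p))\<^sup>2 \<le> S\<^sup>2"
  proof (rule power_growth_le[of _ _ "real d" "2 ^ 9"])
    fix m :: nat
    have "norm (eval_free A ((adj p * p) ^ (2 ^ m))) \<le> (2 * real (2 ^ m * d) + 1) ^ 9 * (2 ^ 9 * (S\<^sup>2) ^ (2 ^ m))"
    proof (rule norm_eval_free_polynomial_bound[OF A c word_degree_power[OF d]])
      fix y :: "real^3^3" assume y: "\<And>i j. \<bar>y$i$j\<bar> \<le> c"
      show "norm (eval_free (quat_rep y) ((adj p * p) ^ 2 ^ m)) \<le> (S\<^sup>2) ^ 2 ^ m"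
        using S[OF y] by (simp add: star_hom_power[OF q] star_homD[OF q] pw power_mono)
    qed
    then show "((norm (eval_free A p))\<^sup>2) ^ 2 ^ m \<le> (2 * real d * 2 ^ m + 1) ^ 9 * 2 ^ 9 * (S\<^sup>2) ^ 2 ^ m"
      by (simp add: star_hom_power[OF a] star_homD[OF a] pw mult_ac)
  qed (use S0 in \<open>auto simp: d_def\<close>)
  then show ?thesis using S0 by (simp add: power2_le_iff_abs_le)
qed

section \<open>Concentration of the estimate on rotations\<close>

definition rotation_defect :: "real^3^3 \<Rightarrow> real" where
  "rotation_defect y = (\<Sum>i\<in>UNIV. \<Sum>j\<in>UNIV. ((y ** transpose y - mat 1)$i$j)\<^sup>2) + (det y - 1)\<^sup>2"

definition rotation_relator :: free_so where
  "rotation_relator =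
    (let r = \<lambda>i j. (free_gen ** transpose free_gen - mat 1)$i$j;
         d = permanent free_gen - 1
     in (\<Sum>i\<in>UNIV. \<Sum>j\<in>UNIV. adj (r i j) * r i j) + adj d * d)"

lemma eval_rotation_relator:
  fixes B :: "'c::complex_star_algebra^3^3"
  assumes B: "\<And>i j. adj (B$i$j) = B$i$j"
  shows "eval_free B rotation_relator =
    (let r = \<lambda>i j. (B ** transpose B - mat 1)$i$j;
         d = permanent B - 1
     in (\<Sum>i\<in>UNIV. \<Sum>j\<in>UNIV. adj (r i j) * r i j) + adj d * d)"
proof -
  have h: "star_hom (eval_free B)" by (rule star_hom_eval_free[OF B])
  note s = star_homD[OF h] clinear_map_zero[OF star_hom_clinear[OF h]]
    clinear_map_diff[OF star_hom_clinear[OF h]] clinear_map_sum[OF star_hom_clinear[OF h]]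
  have "eval_free B ((free_gen ** transpose free_gen - mat 1)$i$j) = (B ** transpose B - mat 1)$i$j" for i j
    by (simp add: matrix_matrix_mult_def transpose_def mat_def s)
  then show ?thesis unfolding rotation_relator_def Let_def by (simp add: s)
qed

lemma rotation_defect_zero_iff: "rotation_defect y = 0 \<longleftrightarrow> y \<in> rotations"
proof -
  have "(\<Sum>i\<in>UNIV. \<Sum>j\<in>UNIV. ((y ** transpose y - mat 1)$i$j)\<^sup>2) = 0 \<longleftrightarrow> y ** transpose y = mat 1"
    by (simp add: sum_nonneg_eq_0_iff sum_nonneg vec_eq_iff)
  moreover have "0 \<le> (\<Sum>i\<in>UNIV. \<Sum>j\<in>UNIV. ((y ** transpose y - mat 1)$i$j)\<^sup>2)" by (simp add: sum_nonneg)
  ultimately show ?thesis by (simp add: rotation_defect_def rotations_def add_nonneg_eq_0_iff)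
qed

lemma rotation_defect_nonneg: "0 \<le> rotation_defect y"
  by (simp add: rotation_defect_def sum_nonneg)

text \<open>Each relator is a scalar times a unitary here, so its square is a scalar. Multiplication
  by a polynomial in \<open>rotation_relator\<close> therefore only weights the value at
  \<open>y\<close>, while it leaves an evaluation satisfying the relations unchanged if the constant
  term is 1.\<close>

lemma eval_quat_rep_rotation_relator:
  "eval_free (quat_rep y) rotation_relator = complex_of_real (rotation_defect y) *\<^sub>C 1"
proof -
  have u: "adj (quat_left a * quat_left b) * (quat_left a * quat_left b) = 1" for a b
  proof -
    have "adj (quat_left a) * quat_left a = 1" for a
      by (simp add: adj_quat_left quat_left_mult mult_scaleC_left scaleC_scaleC scaleC_one)
    then have "adj (quat_left a) * (quat_left a * x) = x" for a x by (simp flip: mult.assoc)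
    with this[of b 1] show ?thesis by (simp add: adj_mult mult.assoc)
  qed
  have "adj (c *\<^sub>C v) * (c *\<^sub>C v) = complex_of_real ((cmod c)\<^sup>2) *\<^sub>C (adj v * v)" for c and v :: "4 cmat"
    unfolding complex_norm_square
    by (simp add: adj_scaleC mult_scaleC_left mult_scaleC_right scaleC_scaleC)
  then show ?thesis
    unfolding eval_rotation_relator[OF adj_quat_rep] quat_rep_orthogonal_relator quat_rep_det_relator Let_def
    by (simp add: u rotation_defect_def scaleC_add_left scaleC_sum_left norm_minus_cancel power2_abs
        del: of_real_diff vector_minus_component minus_mult_left of_real_power)
qed

lemma continuous_on_eval_quat_rep: "continuous_on UNIV (\<lambda>y. eval_free (quat_rep y) p)"
proof (induction p rule: single_sum_induct)
  case (1 w c)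
  have "continuous_on UNIV (\<lambda>y. prod_list (map (\<lambda>(i, j). quat_rep y$i$j) ws))" for ws
  proof (induction ws)
    case (Cons g ws)
    then show ?case by (cases g) (auto simp: quat_rep_def intro!: continuous_intros)
  qed simp
  then show ?case
    unfolding eval_free_single by (rule bounded_linear.continuous_on[OF bounded_linear_scaleC])
qed (auto simp: eval_free_add intro!: continuous_on_add)

lemma continuous_on_rotation_defect: "continuous_on UNIV rotation_defect"
  unfolding rotation_defect_def det_3 matrix_matrix_mult_def transpose_def
  by (auto intro!: continuous_intros)

lemma compact_box: "compact {y :: real^3^3. \<forall>i j. \<bar>y$i$j\<bar> \<le> c}"
proof -
  have "closed {y :: real^3^3. \<forall>i j. \<bar>y$i$j\<bar> \<le> c}"
    by (intro closed_Collect_all closed_Collect_le continuous_intros)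
  moreover have "bounded {y :: real^3^3. \<forall>i j. \<bar>y$i$j\<bar> \<le> c}"
  proof (rule boundedI)
    fix y :: "real^3^3" assume y: "y \<in> {y. \<forall>i j. \<bar>y$i$j\<bar> \<le> c}"
    have "norm y \<le> (\<Sum>i\<in>UNIV. norm (y$i))" unfolding norm_vec_def by (rule L2_set_le_sum) simp
    also have "\<dots> \<le> (\<Sum>i\<in>UNIV. \<Sum>j\<in>UNIV. \<bar>y$i$j\<bar>)" by (intro sum_mono norm_le_l1_cart)
    also have "\<dots> \<le> (\<Sum>i\<in>(UNIV::3 set). \<Sum>j\<in>(UNIV::3 set). c)" using y by (intro sum_mono) auto
    finally show "norm y \<le> (\<Sum>i\<in>(UNIV::3 set). \<Sum>j\<in>(UNIV::3 set). c)" .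
  qed
  ultimately show ?thesis by (simp add: compact_eq_bounded_closed)
qed

lemma norm_eval_free_le_rotations:
  fixes A :: "'a::cstar_algebra^3^3"
  assumes A: "so_relators A \<subseteq> {0}"
    and S: "\<And>g. g \<in> rotations \<Longrightarrow> norm (eval_free (quat_rep g) p) \<le> S"
  shows "norm (eval_free A p) \<le> S"
proof (rule field_le_epsilon)
  fix e :: real assume e: "e > 0"
  have "mat 1 \<in> rotations" by (simp add: rotations_def transpose_mat)
  then have S0: "0 \<le> S" using S norm_ge_zero order_trans by blast
  \<comment> \<open>Large enough for every generator to have norm at most \<open>c / 2\<close>, and
    positive even if all of them vanish.\<close>
  define c where "c = 1 + 2 * (\<Sum>i\<in>UNIV. \<Sum>j\<in>UNIV. norm (A$i$j))"
  have c0: "c > 0" by (simp add: c_def sum_nonneg add_pos_nonneg)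
  have cA: "norm (A$i$j) \<le> c / 2" for i j
  proof -
    have "norm (A$i$j) \<le> (\<Sum>j\<in>UNIV. norm (A$i$j))" by (rule member_le_sum) auto
    also have "\<dots> \<le> (\<Sum>i\<in>UNIV. \<Sum>j\<in>UNIV. norm (A$i$j))"
      by (rule member_le_sum[of i UNIV "\<lambda>i. \<Sum>j\<in>UNIV. norm (A$i$j)"]) (auto simp: sum_nonneg)
    finally show ?thesis by (simp add: c_def)
  qed
  define K where "K = {y :: real^3^3. \<forall>i j. \<bar>y$i$j\<bar> \<le> c}"
  have K: "compact K" unfolding K_def by (rule compact_box)
  have "0 \<in> K" using c0 by (simp add: K_def)
  then have K0: "K \<noteq> {}" by blast
  define P where "P = (\<lambda>y. norm (eval_free (quat_rep y) p))"
  have cP: "continuous_on UNIV P" unfolding P_def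
    by (intro continuous_on_norm continuous_on_eval_quat_rep)
  obtain b where b: "\<And>y. y \<in> K \<Longrightarrow> rotation_defect y \<le> b"
    using continuous_attains_sup[OF K K0 continuous_on_subset[OF continuous_on_rotation_defect subset_UNIV]] by blast
  obtain b' where b': "\<And>y. y \<in> K \<Longrightarrow> P y \<le> b'"
    using continuous_attains_sup[OF K K0 continuous_on_subset[OF cP subset_UNIV]] by blast
  \<comment> \<open>Dividing the defect by \<open>c1\<close> keeps
    \<open>1 - rotation_defect y / c1\<close> in [0, 1] on the box; the maximum with 1 guards
    against \<open>b = 0\<close>.\<close>
  define c1 where "c1 = max b 1"
  have c1: "c1 > 0" "\<And>y. y \<in> K \<Longrightarrow> rotation_defect y \<le> c1" using b by (force simp: c1_def)+
  \<comment> \<open>The part of the box where the value is too large. It is compact and contains no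
    rotation, so the defect has a positive minimum on it and the weight decays there uniformly in
    \<open>M\<close>.\<close>
  define K1 where "K1 = K \<inter> {y. S + e \<le> P y}"
  have K1: "compact K1" unfolding K1_def
    by (intro compact_Int_closed K closed_Collect_le cP continuous_intros)
  obtain M where M: "\<And>y. y \<in> K \<Longrightarrow> P y * (1 - rotation_defect y / c1) ^ M \<le> S + e"
  proof (cases "K1 = {}")
    case True
    have "P y * (1 - rotation_defect y / c1) ^ 0 \<le> S + e" if "y \<in> K" for y
      using that True by (force simp: K1_def)
    then show thesis by (rule that)
  next
    case False
    obtain y0 where y0: "y0 \<in> K1" "\<And>y. y \<in> K1 \<Longrightarrow> rotation_defect y0 \<le> rotation_defect y"
      using continuous_attains_inf[OF K1 False continuous_on_subset[OF continuous_on_rotation_defect subset_UNIV]]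
      by blast
    define \<delta> where "\<delta> = rotation_defect y0 / c1"
    have "y0 \<notin> rotations"
    proof
      assume "y0 \<in> rotations"
      then have "P y0 \<le> S" unfolding P_def by (rule S)
      then show False using y0(1) e by (simp add: K1_def)
    qed
    then have \<delta>: "0 < \<delta>" "\<delta> \<le> 1"
      using rotation_defect_nonneg[of y0] rotation_defect_zero_iff[of y0] c1 y0(1)
      by (auto simp: \<delta>_def K1_def less_le)
    have b'0: "0 \<le> b'" using b'[of y0] y0(1) by (auto simp: K1_def P_def intro: order_trans[OF norm_ge_zero])
    have "(\<lambda>M. b' * (1 - \<delta>) ^ M) \<longlonglongrightarrow> b' * 0"
      using \<delta> by (intro tendsto_mult tendsto_const LIMSEQ_realpow_zero) auto
    then have "\<forall>\<^sub>F M in sequentially. b' * (1 - \<delta>) ^ M < S + e"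
      using S0 e by (intro order_tendstoD) auto
    then obtain M where M: "b' * (1 - \<delta>) ^ M < S + e" unfolding eventually_sequentially by blast
    have "P y * (1 - rotation_defect y / c1) ^ M \<le> S + e" if "y \<in> K" for y
    proof -
      have f: "0 \<le> 1 - rotation_defect y / c1" "1 - rotation_defect y / c1 \<le> 1"
        using c1 that rotation_defect_nonneg[of y] by (auto simp: divide_le_eq)
      show ?thesis
      proof (cases "y \<in> K1")
        case True
        have "1 - rotation_defect y / c1 \<le> 1 - \<delta>"
          using y0(2)[OF True] c1 by (simp add: \<delta>_def divide_right_mono)
        then have "P y * (1 - rotation_defect y / c1) ^ M \<le> b' * (1 - \<delta>) ^ M"
          using b'[OF that] f b'0 by (intro mult_mono power_mono) auto
        then show ?thesis using M by simp
      next
        case False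
        then have "P y \<le> S + e" using that by (simp add: K1_def)
        moreover have "P y * (1 - rotation_defect y / c1) ^ M \<le> P y * 1"
          using f by (intro mult_left_mono power_le_one) (auto simp: P_def)
        ultimately show ?thesis by simp
      qed
    qed
    then show thesis by (rule that)
  qed
  \<comment> \<open>The factor evaluates to 1 at \<open>A\<close>, where the relators vanish, and to
    the weight chosen above at \<open>quat_rep y\<close>.\<close>
  define q where "q = p * (1 - complex_of_real (1 / c1) *\<^sub>C rotation_relator) ^ M"
  have a: "star_hom (eval_free A)" using so_relatorsD(1)[OF A] by (rule star_hom_eval_free)
  have h: "star_hom (eval_free (quat_rep y))" for y by (rule star_hom_eval_free) (rule adj_quat_rep)
  have "eval_free A rotation_relator = 0"
    unfolding eval_rotation_relator[OF so_relatorsD(1)[OF A]]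
    by (simp add: so_relatorsD(2,7)[OF A])
  then have "eval_free A q = eval_free A p"
    by (simp add: q_def star_homD[OF a] star_hom_power[OF a] clinear_map_diff[OF star_hom_clinear[OF a]])
  moreover have "norm (eval_free A q) \<le> S + e"
  proof (rule norm_eval_free_le_box[OF A c0 cA])
    fix y :: "real^3^3" assume "\<And>i j. \<bar>y$i$j\<bar> \<le> c"
    then have y: "y \<in> K" by (simp add: K_def)
    have "eval_free (quat_rep y) (1 - complex_of_real (1 / c1) *\<^sub>C rotation_relator) =
        complex_of_real (1 - rotation_defect y / c1) *\<^sub>C 1"
      by (simp add: star_homD[OF h] clinear_map_diff[OF star_hom_clinear[OF h]]
          eval_quat_rep_rotation_relator scaleC_scaleC)
        (metis (no_types, opaque_lifting) diff_conv_add_uminus scaleC_add_left scaleC_minus_left scaleC_one)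
    then have "eval_free (quat_rep y) q =
        complex_of_real ((1 - rotation_defect y / c1) ^ M) *\<^sub>C eval_free (quat_rep y) p"
      by (simp add: q_def star_homD[OF h] star_hom_power[OF h] scaleC_power mult_scaleC_right)
    moreover have "0 \<le> 1 - rotation_defect y / c1" using c1(1) c1(2)[OF y] by (simp add: divide_le_eq)
    ultimately show "norm (eval_free (quat_rep y) q) \<le> S + e"
      using M[OF y] by (simp add: norm_scaleC P_def mult.commute norm_power del: of_real_diff of_real_divide)
  qed
  ultimately show "norm (eval_free A p) \<le> S + e" by simp
qed

section \<open>The family of representations indexed by rotations is faithful\<close>

definition rotation_rep :: "'a::cstar_algebra^3^3 \<Rightarrow> real^3^3 \<Rightarrow> 'a \<Rightarrow> 4 cmat" where
  "rotation_rep A g = (SOME f. star_hom f \<and> (\<forall>i j. f (A$i$j) = quat_rep g$i$j))"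

lemma rotation_rep:
  assumes "is_C_SO A" "g \<in> rotations"
  shows "star_hom (rotation_rep A g)" "rotation_rep A g (A$i$j) = quat_rep g$i$j"
proof -
  obtain f where "star_hom f" "\<And>i j. f (A$i$j) = quat_rep g$i$j"
    using universal_star_hom[OF assms(1) so_relators_quat_rep[OF assms(2)]] by blast
  then have "\<exists>f. star_hom f \<and> (\<forall>i j. f (A$i$j) = quat_rep g$i$j)" by blast
  from someI_ex[OF this]
  show "star_hom (rotation_rep A g)" "rotation_rep A g (A$i$j) = quat_rep g$i$j"
    unfolding rotation_rep_def by auto
qed

lemma rotation_rep_eval:
  assumes "is_C_SO A" "g \<in> rotations"
  shows "rotation_rep A g (eval_free A p) = eval_free (quat_rep g) p"
proof -
  have "(\<chi> i j. rotation_rep A g (A$i$j)) = quat_rep g"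
    by (simp add: vec_eq_iff rotation_rep(2)[OF assms])
  then show ?thesis by (simp add: star_hom_eval[OF rotation_rep(1)[OF assms]])
qed

lemma eval_free_dense:
  assumes "is_C_SO A" "e > 0"
  obtains p where "norm (x - eval_free A p) < e"
proof -
  have "x \<in> closure (range (eval_free A))" using assms(1) by (simp add: is_C_SO_def)
  then obtain y where "y \<in> range (eval_free A)" "dist y x < e"
    using assms(2) unfolding closure_approachable by blast
  then show thesis using that by (auto simp: dist_norm norm_minus_commute)
qed

lemma rotation_rep_separates:
  assumes A: "is_C_SO A" and x: "\<And>g. g \<in> rotations \<Longrightarrow> rotation_rep A g x = 0"
  shows "x = 0"
proof -
  have "norm x \<le> 0 + e" if e: "e > 0" for e
  proof -
    obtain p where p: "norm (x - eval_free A p) < e / 2" using eval_free_dense[OF A, of "e / 2" x] half_gt_zero[OF e] by blast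
    have "norm (eval_free A p) \<le> e / 2"
    proof (rule norm_eval_free_le_rotations)
      fix g assume g: "g \<in> rotations"
      note h = rotation_rep(1)[OF A g]
      have "rotation_rep A g (x - eval_free A p) = - eval_free (quat_rep g) p"
        by (simp add: clinear_map_diff[OF star_hom_clinear[OF h]] x g rotation_rep_eval[OF A g])
      then show "norm (eval_free (quat_rep g) p) \<le> e / 2"
        using star_hom_norm_le[OF h, of "x - eval_free A p"] p by simp
    qed (use A in \<open>simp add: is_C_SO_def\<close>)
    then show ?thesis using p norm_triangle_ineq[of "x - eval_free A p" "eval_free A p"] by simp
  qed
  then have "norm x \<le> 0" by (rule field_le_epsilon)
  then show ?thesis by simp
qed

lemma rotations_mult: "g \<in> rotations \<Longrightarrow> h \<in> rotations \<Longrightarrow> g ** h \<in> rotations"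
  unfolding rotations_def
  by (simp add: det_mul matrix_transpose_mul) (metis matrix_mul_assoc matrix_mul_rid)

section \<open>The twisted evaluation functionals\<close>

text \<open>\<open>quat_functional\<close> takes the value \<open>1\<close> at each of the 16 operators \<open>v \<mapsto> e v f\<^sup>*\<close>, where \<open>e\<close>, \<open>f\<close> run
  through the unit quaternions \<open>1, i, j, k\<close>.\<close>

definition quat_functional :: "4 cmat \<Rightarrow> complex" where
  "quat_functional M = mat_of M$4$4 + mat_of M$2$1 + mat_of M$3$2 + mat_of M$1$3"

lemma quat_functional_unit: "quat_functional (quat_left a * quat_right b) = 1"
  unfolding quat_functional_def mat_of_entries sum_mono_entry
  using exhaust_4[of a] exhaust_4[of b]
  by (elim disjE) (simp_all add: quat_index_def quat_sign_def quat_conj_sign_def)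

lemma quat_functional_linear:
  "quat_functional (M + N) = quat_functional M + quat_functional N"
  "quat_functional (c *\<^sub>C M) = c * quat_functional M"
  by (simp_all add: quat_functional_def mat_of_entries algebra_simps)

lemma norm_quat_functional_le: "cmod (quat_functional M) \<le> 4 * norm M"
proof -
  have "cmod (quat_functional M) \<le> cmod (mat_of M$4$4) + cmod (mat_of M$2$1) + cmod (mat_of M$3$2) + cmod (mat_of M$1$3)"
    unfolding quat_functional_def by (intro norm_triangle_mono order_refl)
  also have "\<dots> \<le> norm M + norm M + norm M + norm M" by (intro add_mono norm_mat_of_entry_le)
  finally show ?thesis by simp
qed

definition twisted_eval :: "'a::cstar_algebra^3^3 \<Rightarrow> real^3^3 \<Rightarrow> 'a \<Rightarrow> complex" where
  "twisted_eval A g x = quat_functional (rotation_rep A g x)"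

lemma clinear_twisted_eval:
  assumes "is_C_SO A" "g \<in> rotations"
  shows "clinear_map (twisted_eval A g)"
  unfolding clinear_map_def twisted_eval_def
  by (simp add: star_homD[OF rotation_rep(1)[OF assms]] quat_functional_linear scaleC_complex_def)

lemma norm_twisted_eval_le:
  assumes "is_C_SO A" "g \<in> rotations"
  shows "cmod (twisted_eval A g x) \<le> 4 * norm x"
  unfolding twisted_eval_def
  using norm_quat_functional_le[of "rotation_rep A g x"] star_hom_norm_le[OF rotation_rep(1)[OF assms], of x]
  by simp

text \<open>The sign and the index of a product of unit quaternions.\<close>

fun quat_word :: "3 list \<Rightarrow> complex \<times> 4" where
  "quat_word [] = (1, 4)"
| "quat_word (i # I) =
    (fst (quat_word I) * quat_sign (quat_unit i) (snd (quat_word I)), quat_index (quat_unit i) (snd (quat_word I)))"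

lemma prod_list_quat_left:
  "prod_list (map (\<lambda>i. quat_left (quat_unit i)) I) = fst (quat_word I) *\<^sub>C quat_left (snd (quat_word I))"
  by (induction I) (simp_all add: scaleC_one mult_scaleC_right quat_left_mult scaleC_scaleC)

lemma prod_list_quat_right:
  "prod_list (map (\<lambda>i. quat_right (quat_unit i)) I) = fst (quat_word I) *\<^sub>C quat_right (snd (quat_word I))"
  by (induction I) (simp_all add: scaleC_one mult_scaleC_right quat_right_mult scaleC_scaleC)

lemma quat_word_sign_square: "fst (quat_word I) * fst (quat_word I) = 1"
proof (induction I)
  case (Cons i I)
  have "fst (quat_word (i # I)) * fst (quat_word (i # I)) =
      (fst (quat_word I) * fst (quat_word I)) *
      (quat_sign (quat_unit i) (snd (quat_word I)) * quat_sign (quat_unit i) (snd (quat_word I)))"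
    by (simp only: quat_word.simps fst_conv mult_ac)
  then show ?case by (simp add: Cons)
qed simp

lemma prod_list_quat_gen:
  "prod_list (map quat_gen w) = prod_list (map (\<lambda>g. quat_left (quat_unit (fst g))) w) *
     prod_list (map (\<lambda>g. quat_right (quat_unit (snd g))) w)"
proof (induction w)
  case (Cons g w)
  have "quat_right b * (prod_list (map (\<lambda>g. quat_left (quat_unit (fst g))) w) * x) =
      prod_list (map (\<lambda>g. quat_left (quat_unit (fst g))) w) * (quat_right b * x)" for b x
    by (induction w) (simp_all add: mult.assoc quat_left_right_commute')
  then show ?case by (simp only: list.map prod_list.Cons Cons) (simp add: quat_gen_def mult.assoc)
qed simp

definition gen_word :: "'a::monoid_mult^3^3 \<Rightarrow> (3 \<times> 3) list \<Rightarrow> 'a" where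
  "gen_word A w = prod_list (map (\<lambda>(i, j). A$i$j) w)"

lemma eval_free_gen_word: "eval_free A (Poly_Mapping.single w c) = c *\<^sub>C gen_word A (letters w)"
  by (simp add: eval_free_single gen_word_def)

lemma gen_word_star_hom:
  assumes "star_hom f"
  shows "f (gen_word A w) = gen_word (\<chi> i j. f (A$i$j)) w"
  using star_hom_eval[OF assms, of A "Poly_Mapping.single (Word w) 1"]
  by (simp add: eval_free_gen_word scaleC_one)

text \<open>The operators of a word split into left and right multiplications, whose products are
  signed units, and \<open>quat_functional\<close> is 1 on all units. What remains is a commutative
  monomial in the entries of \<open>g\<close>, twisted by one sign for the rows and one for the
  columns; the functional is not multiplicative in general.\<close>

lemma twisted_eval_gen_word:
  assumes "is_C_SO A" "g \<in> rotations"
  shows "twisted_eval A g (gen_word A w) =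
    fst (quat_word (map fst w)) * fst (quat_word (map snd w)) * complex_of_real (gen_word g w)"
proof -
  have "rotation_rep A g (gen_word A w) = gen_word (quat_rep g) w"
    using rotation_rep_eval[OF assms, of "Poly_Mapping.single (Word w) 1"]
    by (simp add: eval_free_gen_word scaleC_one)
  also have "\<dots> = complex_of_real (gen_word g w) *\<^sub>C prod_list (map quat_gen w)"
    by (induction w)
      (auto simp: gen_word_def scaleC_one quat_rep_def scaleR_scaleC mult_scaleC_left mult_scaleC_right scaleC_scaleC mult_ac)
  also have "prod_list (map quat_gen w) = (fst (quat_word (map fst w)) * fst (quat_word (map snd w))) *\<^sub>C
      (quat_left (snd (quat_word (map fst w))) * quat_right (snd (quat_word (map snd w))))"
    using prod_list_quat_left[of "map fst w"] prod_list_quat_right[of "map snd w"]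
    by (simp add: prod_list_quat_gen o_def mult_scaleC_left mult_scaleC_right scaleC_scaleC mult.commute)
  finally show ?thesis
    by (simp add: twisted_eval_def quat_functional_linear quat_functional_unit)
qed

lemma twisted_eval_gen:
  assumes "is_C_SO A" "g \<in> rotations"
  shows "twisted_eval A g (A$i$j) = complex_of_real (g$i$j)"
  using twisted_eval_gen_word[OF assms, of "[(i, j)]"] by (simp add: gen_word_def)

section \<open>Half-turns, and separation of points by a single functional\<close>

definition klein_sign :: "4 \<Rightarrow> 3 \<Rightarrow> real" where
  "klein_sign a i = (if a = 4 \<or> a = quat_unit i then 1 else -1)"

text \<open>The action of the unit with index \<open>a\<close> on the imaginary quaternions by
  conjugation: the half-turn about the axis \<open>a\<close>, and the identity for
  \<open>a = 4\<close>.\<close>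

definition klein :: "4 \<Rightarrow> real^3^3" where
  "klein a = (\<chi> i j. if i = j then klein_sign a i else 0)"

lemma klein_rotations: "klein a \<in> rotations"
  using exhaust_4[of a]
  by (elim disjE) (simp_all add: rotations_def klein_def klein_sign_def vec_eq_iff forall_3
      matrix_matrix_mult_def transpose_def mat_def sum_3 det_3)

lemma klein_mult: "(klein a ** g)$i$j = klein_sign a i * g$i$j" "(g ** klein a)$i$j = g$i$j * klein_sign a j"
  by (simp_all add: matrix_matrix_mult_def klein_def if_distrib if_distribR cong: if_cong)

lemma quat_left_conjugate:
  "quat_left a * quat_left (quat_unit i) * adj (quat_left a) = complex_of_real (klein_sign a i) *\<^sub>C quat_left (quat_unit i)"
proof -
  have 1: "quat_index (quat_index a (quat_unit i)) a = quat_unit i"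
    by (metis quat_index_cancel quat_index_commute)
  have "quat_conj_sign a * (quat_sign a (quat_unit i) * quat_sign (quat_index a (quat_unit i)) a) =
      complex_of_real (klein_sign a i)"
    using exhaust_4[of a] exhaust_3[of i]
    by (elim disjE) (simp_all add: quat_conj_sign_def quat_sign_def quat_index_def klein_sign_def)
  then show ?thesis
    by (simp add: adj_quat_left quat_left_mult mult_scaleC_left mult_scaleC_right scaleC_scaleC 1)
qed

lemma quat_right_conjugate:
  "quat_right a * quat_right (quat_unit i) * adj (quat_right a) = complex_of_real (klein_sign a i) *\<^sub>C quat_right (quat_unit i)"
proof -
  have 1: "quat_index (quat_index a (quat_unit i)) a = quat_unit i"
    by (metis quat_index_cancel quat_index_commute)
  have "quat_conj_sign a * (quat_sign a (quat_unit i) * quat_sign (quat_index a (quat_unit i)) a) =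
      complex_of_real (klein_sign a i)"
    using exhaust_4[of a] exhaust_3[of i]
    by (elim disjE) (simp_all add: quat_conj_sign_def quat_sign_def quat_index_def klein_sign_def)
  then show ?thesis
    by (simp add: adj_quat_right quat_right_mult mult_scaleC_left mult_scaleC_right scaleC_scaleC 1)
qed

lemma adj_quat_left_left: "adj (quat_left a) * quat_left a = 1" "quat_left a * adj (quat_left a) = 1"
  and adj_quat_right_right: "adj (quat_right a) * quat_right a = 1" "quat_right a * adj (quat_right a) = 1"
  by (simp_all add: adj_quat_left quat_left_mult adj_quat_right quat_right_mult
      mult_scaleC_left mult_scaleC_right scaleC_scaleC scaleC_one)

lemma star_hom_unitary_conjugation:
  fixes u :: "'c::complex_star_algebra"
  assumes "star_hom f" "adj u * u = 1" "u * adj u = 1"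
  shows "star_hom (\<lambda>x. u * f x * adj u)"
proof -
  have "adj u * (u * z) = z" for z using assms(2) by (simp flip: mult.assoc)
  then show ?thesis
    unfolding star_hom_def clinear_map_def
    by (simp add: star_homD[OF assms(1)] assms adj_mult adj_adj mult.assoc distrib_left distrib_right
        mult_scaleC_left mult_scaleC_right)
qed

text \<open>Conjugation by \<open>u\<close> changes the generators by the same signs as multiplying
  \<open>g\<close> by half-turns on both sides. Varying \<open>g\<close> within a double coset of
  the half-turns thus gives access to \<open>quat_functional\<close> composed with all these
  conjugations.\<close>

lemma rotation_rep_klein:
  fixes a b
  defines "u \<equiv> quat_left a * quat_right b"
  assumes A: "is_C_SO A" and g: "g \<in> rotations"
  shows "rotation_rep A (klein a ** g ** klein b) x = u * rotation_rep A g x * adj u"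
proof -
  let ?g = "klein a ** g ** klein b"
  have g': "?g \<in> rotations" by (intro rotations_mult klein_rotations g)
  have u: "adj u * u = 1" "u * adj u = 1"
  proof -
    have "adj (quat_left a) * (quat_left a * z) = z" "quat_right b * (adj (quat_right b) * z) = z" for z
      by (simp_all add: adj_quat_left_left adj_quat_right_right flip: mult.assoc)
    then show "adj u * u = 1" "u * adj u = 1"
      unfolding u_def by (simp_all add: adj_mult mult.assoc adj_quat_left_left adj_quat_right_right)
  qed
  have "u * (quat_left p * quat_right q) * adj u =
      (quat_left a * quat_left p * adj (quat_left a)) * (quat_right b * quat_right q * adj (quat_right b))" for p q
    unfolding u_def adj_mult adj_quat_left adj_quat_right
    by (simp add: mult.assoc mult_scaleC_left mult_scaleC_right scaleC_scaleC quat_left_right_commute'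
        quat_left_right_commute mult_ac)
  then have c: "u * quat_gen (i, j) * adj u = complex_of_real (klein_sign a i * klein_sign b j) *\<^sub>C quat_gen (i, j)" for i j
    by (simp only: quat_gen_def fst_conv snd_conv quat_left_conjugate quat_right_conjugate
        mult_scaleC_left mult_scaleC_right scaleC_scaleC of_real_mult mult.commute)
  have "rotation_rep A ?g = (\<lambda>x. u * rotation_rep A g x * adj u)"
  proof (rule star_hom_eq_on_generators[OF A rotation_rep(1)[OF A g'] star_hom_unitary_conjugation[OF rotation_rep(1)[OF A g] u]])
    fix i j
    have "u * quat_rep g$i$j * adj u = quat_rep ?g$i$j"
      by (simp add: quat_rep_def klein_mult scaleR_scaleC mult_scaleC_left mult_scaleC_right c scaleC_scaleC)
        (simp add: mult_ac)
    then show "rotation_rep A ?g (A$i$j) = u * rotation_rep A g (A$i$j) * adj u"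
      by (simp add: rotation_rep(2)[OF A g] rotation_rep(2)[OF A g'])
  qed
  then show ?thesis by (rule fun_cong)
qed

lemma quat_unit_conjugate_entry:
  fixes a b p
  defines "s \<equiv> \<lambda>q. quat_sign a (quat_index q b) * (quat_conj_sign b * quat_sign q b)"
  shows "mat_of ((quat_left a * quat_right b) * M * adj (quat_left a * quat_right b))$p$q =
    s (quat_index a (quat_index p b)) * s (quat_index a (quat_index q b)) *
    mat_of M$(quat_index a (quat_index p b))$(quat_index a (quat_index q b))"
proof -
  have inv: "p = quat_index a (quat_index q b) \<longleftrightarrow> q = quat_index a (quat_index p b)" for p q
    by (auto simp: quat_index_assoc)
  have U: "mat_of (quat_left a * quat_right b)$p$q = (if q = quat_index a (quat_index p b) then s q else 0)" for p q
    unfolding mat_of_entries(2,7,8) sum_mono_entry by (simp add: s_def inv[of p q])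
  have "cnj (s q) = s q" for q by (simp add: s_def)
  then show ?thesis
    unfolding mat_of_entries(2)[of "_ * M"] mat_of_entries(2)[of _ M] mat_of_entries(3) U
    by (simp add: sum_distrib_left sum_distrib_right if_distrib if_distribR mult_ac cong: if_cong)
qed

lemma quat_table:
  "quat_index 1 2 = 3" "quat_index 2 3 = 1" "quat_index 3 1 = 2" "quat_index 2 1 = 3" "quat_index 3 2 = 1" "quat_index 1 3 = 2"
  "quat_sign 1 2 = 1" "quat_sign 2 3 = 1" "quat_sign 3 1 = 1" "quat_sign 2 1 = -1" "quat_sign 3 2 = -1" "quat_sign 1 3 = -1"
  "quat_conj_sign 1 = -1" "quat_conj_sign 2 = -1" "quat_conj_sign 3 = -1" "quat_conj_sign 4 = 1"
  by (simp_all add: quat_index_def quat_sign_def quat_conj_sign_def)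

text \<open>Conjugation by a pair of units permutes the matrix entries up to sign. Which four
  entries \<open>quat_functional\<close> then adds depends only on \<open>quat_index a b\<close>;
  the four pairs with a given index yield the sign patterns of a Hadamard matrix, inverted by
  \<open>h\<close>, and the four indices exhaust all 16 entries.\<close>

lemma quat_functional_separates:
  assumes "\<And>a b. quat_functional ((quat_left a * quat_right b) * M * adj (quat_left a * quat_right b)) = 0"
  shows "M = 0"
proof -
  have h: "x = 0 \<and> y = 0 \<and> z = 0 \<and> w = 0"
    if "x + y + z + w = 0" "x + y - z - w = 0" "x - y + z - w = 0" "x - y - z + w = 0" for x y z w :: complex
  proof -
    have "4 * x = 0" "4 * y = 0" "4 * z = 0" "4 * w = 0" using that by algebra+
    then show ?thesis by simp
  qed
  let ?m = "\<lambda>p q. mat_of M$p$q"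
  note e = assms[unfolded quat_functional_def quat_unit_conjugate_entry]
  have "?m 4 4 = 0 \<and> ?m 2 1 = 0 \<and> ?m 3 2 = 0 \<and> ?m 1 3 = 0"
    by (intro h) (use e[of 4 4] in \<open>simp add: quat_table add_ac\<close>,
      (use e[of 1 1] e[of 2 2] e[of 3 3] in \<open>simp add: quat_table algebra_simps\<close>)+)
  moreover have "?m 1 1 = 0 \<and> ?m 3 4 = 0 \<and> ?m 2 3 = 0 \<and> ?m 4 2 = 0"
    using e[of 4 1] e[of 1 4] e[of 2 3] e[of 3 2]
    by (intro h) (simp_all add: quat_table algebra_simps)
  moreover have "?m 2 2 = 0 \<and> ?m 4 3 = 0 \<and> ?m 1 4 = 0 \<and> ?m 3 1 = 0"
    using e[of 4 2] e[of 2 4] e[of 1 3] e[of 3 1]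
    by (intro h) (simp_all add: quat_table algebra_simps)
  moreover have "?m 3 3 = 0 \<and> ?m 1 2 = 0 \<and> ?m 4 1 = 0 \<and> ?m 2 4 = 0"
    using e[of 4 3] e[of 3 4] e[of 1 2] e[of 2 1]
    by (intro h) (simp_all add: quat_table algebra_simps)
  ultimately have "\<forall>p q. ?m p q = 0" unfolding forall_4 by blast
  then show ?thesis by (intro cmat_eqI) (simp add: mat_of_entries)
qed

lemma twisted_eval_separates:
  assumes A: "is_C_SO A" and x: "\<And>g. g \<in> rotations \<Longrightarrow> twisted_eval A g x = 0"
  shows "x = 0"
proof (rule rotation_rep_separates[OF A])
  fix g assume g: "g \<in> rotations"
  show "rotation_rep A g x = 0"
  proof (rule quat_functional_separates)
    fix a b
    show "quat_functional ((quat_left a * quat_right b) * rotation_rep A g x * adj (quat_left a * quat_right b)) = 0"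
      using x[of "klein a ** g ** klein b"] g
      by (simp add: twisted_eval_def rotation_rep_klein[OF A g] rotations_mult klein_rotations)
  qed
qed

section \<open>Functionals on the spatial tensor product\<close>

lemma tfun_Nil [simp]: "tfun \<phi> \<psi> [] = 0"
  and tfun_Cons [simp]: "tfun \<phi> \<psi> ((x, y) # ts) = \<phi> x * \<psi> y + tfun \<phi> \<psi> ts"
  and tfun_append [simp]: "tfun \<phi> \<psi> (ts @ us) = tfun \<phi> \<psi> ts + tfun \<phi> \<psi> us"
  by (simp_all add: tfun_def)

lemma tsum_Nil [simp]: "tsum tens [] = 0"
  and tsum_Cons [simp]: "tsum tens ((x, y) # ts) = tens x y + tsum tens ts"
  and tsum_append [simp]: "tsum tens (ts @ us) = tsum tens ts + tsum tens us"
  by (simp_all add: tsum_def)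

lemma tprod_one: "tprod ts [(1, 1)] = ts"
  by (induction ts) (auto simp: tprod_def)

lemma tprod_Cons: "tprod ((x, y) # ts) us = map (\<lambda>(u, v). (x * u, y * v)) us @ tprod ts us"
  by (simp add: tprod_def split_def)

lemma tprod_Nil [simp]: "tprod [] us = []"
  by (simp add: tprod_def)

lemma tadj_simps [simp]: "tadj [] = []" "tadj ((x, y) # ts) = (adj x, adj y) # tadj ts"
  by (simp_all add: tadj_def)

lemma is_min_tensorD:
  assumes "is_min_tensor tens"
  shows "tens (x + x') y = tens x y + tens x' y" "tens (c *\<^sub>C x) y = c *\<^sub>C tens x y"
    "tens x (y + y') = tens x y + tens x y'" "tens x (c *\<^sub>C y) = c *\<^sub>C tens x y"
    "tens 1 1 = 1" "tens x y * tens u v = tens (x * u) (y * v)" "adj (tens x y) = tens (adj x) (adj y)"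
    "closure (range (tsum tens)) = UNIV" "spatial_bound ts (norm (tsum tens ts))"
    "spatial_bound ts C \<Longrightarrow> norm (tsum tens ts) \<le> C"
  using assms unfolding is_min_tensor_def clinear_map_def by blast+

lemma is_min_tensor_sum:
  assumes "is_min_tensor tens"
  shows "tens (\<Sum>i\<in>I. f i) y = (\<Sum>i\<in>I. tens (f i) y)" "tens x (\<Sum>i\<in>I. g i) = (\<Sum>i\<in>I. tens x (g i))"
  using assms clinear_map_sum unfolding is_min_tensor_def by blast+

lemma tsum_map_scaleC:
  assumes "is_min_tensor tens"
  shows "tsum tens (map (\<lambda>(x, y). (c *\<^sub>C x, y)) ts) = c *\<^sub>C tsum tens ts"
  by (induction ts) (auto simp: is_min_tensorD(2)[OF assms] scaleC_add_right)

lemma tfun_map_scaleC: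
  assumes "clinear_map \<phi>"
  shows "tfun \<phi> \<psi> (map (\<lambda>(x, y). (c *\<^sub>C x, y)) ts) = c * tfun \<phi> \<psi> ts"
  using assms unfolding clinear_map_def
  by (induction ts) (auto simp: scaleC_complex_def algebra_simps)

lemma state_matrix_coefficient:
  fixes f :: "'a::cstar_algebra \<Rightarrow> 'n::finite cmat"
  assumes "star_hom f"
  shows "state (\<lambda>x. mat_of (f x)$b$b)"
proof -
  have "mat_of (f (adj x * x))$b$b = complex_of_real (\<Sum>k\<in>UNIV. (cmod (mat_of (f x)$k$b))\<^sup>2)" for x
    by (simp only: star_homD[OF assms] mat_of_entries of_real_sum complex_norm_square mult.commute)
  then show ?thesis
    unfolding state_def clinear_map_def
    by (simp add: star_homD[OF assms] mat_of_entries scaleC_complex_def sum_nonneg del: of_real_sum)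
qed

text \<open>\<open>tfun\<close> of matrix coefficients is an entry of the operator \<open>(f \<otimes> h)(t)\<close>, whose column at the basis
  vector \<open>e\<^sub>b \<otimes> e\<^sub>d\<close> is controlled by the product of the two vector states.\<close>

lemma matrix_coefficient_tensor_bound:
  fixes f :: "'a::cstar_algebra \<Rightarrow> 'n::finite cmat" and h :: "'c::cstar_algebra \<Rightarrow> 'm::finite cmat"
    and tens :: "'a \<Rightarrow> 'c \<Rightarrow> 'b::cstar_algebra"
  assumes tens: "is_min_tensor tens" and f: "star_hom f" and h: "star_hom h"
  shows "cmod (tfun (\<lambda>x. mat_of (f x)$a$b) (\<lambda>y. mat_of (h y)$c$d) ts) \<le> norm (tsum tens ts)"
proof -
  define Z where "Z = (\<lambda>a c. tfun (\<lambda>x. mat_of (f x)$a$b) (\<lambda>y. mat_of (h y)$c$d))"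
  let ?\<phi> = "\<lambda>x. mat_of (f x)$b$b" and ?\<psi> = "\<lambda>y. mat_of (h y)$d$d"
  have 1: "tfun ?\<phi> ?\<psi> (map (\<lambda>(u, v). (adj x * u, adj y * v)) us) =
      (\<Sum>a\<in>UNIV. \<Sum>c\<in>UNIV. cnj (mat_of (f x)$a$b * mat_of (h y)$c$d) * Z a c us)" for x y us
  proof (induction us)
    case (Cons p us)
    obtain u v where p: "p = (u, v)" by (cases p)
    have "?\<phi> (adj x * u) * ?\<psi> (adj y * v) =
        (\<Sum>a\<in>UNIV. \<Sum>c\<in>UNIV. cnj (mat_of (f x)$a$b * mat_of (h y)$c$d) * (mat_of (f u)$a$b * mat_of (h v)$c$d))"
      by (simp only: star_homD[OF f] star_homD[OF h] mat_of_entries sum_product) (simp add: mult_ac)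
    then show ?case using Cons by (simp add: p Z_def distrib_left sum.distrib)
  qed (simp add: Z_def)
  have 2: "tfun ?\<phi> ?\<psi> (tprod (tadj ts) us) = (\<Sum>a\<in>UNIV. \<Sum>c\<in>UNIV. cnj (Z a c ts) * Z a c us)" for ts us
  proof (induction ts)
    case (Cons p ts)
    then show ?case by (cases p) (simp add: tprod_Cons 1 Z_def distrib_right sum.distrib)
  qed (simp add: Z_def)
  have "spatial_bound ts (norm (tsum tens ts))" by (rule is_min_tensorD(9)[OF tens])
  \<comment> \<open>The spatial bound is tested on the unit vector represented by
    \<open>[(1, 1)]\<close>.\<close>
  then have "Re (tfun ?\<phi> ?\<psi> (tprod (tadj (tprod ts [(1, 1)])) (tprod ts [(1, 1)])))
      \<le> (norm (tsum tens ts))\<^sup>2 * Re (tfun ?\<phi> ?\<psi> (tprod (tadj [(1, 1)]) [(1, 1)]))"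
    unfolding spatial_bound_def using state_matrix_coefficient[OF f] state_matrix_coefficient[OF h] by blast
  then have "Re (tfun ?\<phi> ?\<psi> (tprod (tadj ts) ts)) \<le> (norm (tsum tens ts))\<^sup>2"
    by (simp add: tprod_one tprod_Cons star_homD[OF f] star_homD[OF h] mat_of_entries)
  moreover have "tfun ?\<phi> ?\<psi> (tprod (tadj ts) ts) = complex_of_real (\<Sum>a\<in>UNIV. \<Sum>c\<in>UNIV. (cmod (Z a c ts))\<^sup>2)"
    unfolding 2 by (simp only: of_real_sum complex_norm_square mult.commute)
  ultimately have "(\<Sum>a\<in>UNIV. \<Sum>c\<in>UNIV. (cmod (Z a c ts))\<^sup>2) \<le> (norm (tsum tens ts))\<^sup>2" by simp
  moreover have "(cmod (Z a c ts))\<^sup>2 \<le> (\<Sum>c\<in>UNIV. (cmod (Z a c ts))\<^sup>2)"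
    by (rule member_le_sum) auto
  moreover have "(\<Sum>c\<in>UNIV. (cmod (Z a c ts))\<^sup>2) \<le> (\<Sum>a\<in>UNIV. \<Sum>c\<in>UNIV. (cmod (Z a c ts))\<^sup>2)"
    by (rule member_le_sum[of a UNIV "\<lambda>a. \<Sum>c\<in>UNIV. (cmod (Z a c ts))\<^sup>2"]) (auto simp: sum_nonneg)
  ultimately have "(cmod (Z a c ts))\<^sup>2 \<le> (norm (tsum tens ts))\<^sup>2" by linarith
  then show ?thesis unfolding Z_def by (rule power2_le_imp_le) simp
qed

lemma tfun_add:
  "tfun (\<lambda>x. \<phi> x + \<phi>' x) \<psi> ts = tfun \<phi> \<psi> ts + tfun \<phi>' \<psi> ts"
  "tfun \<phi> (\<lambda>y. \<psi> y + \<psi>' y) ts = tfun \<phi> \<psi> ts + tfun \<phi> \<psi>' ts"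
  by (induction ts) (auto simp: algebra_simps)

text \<open>Each functional is a sum of four matrix coefficients, so a product of two is a sum of 16
  tensor coefficients, each bounded by the spatial norm.\<close>

lemma twisted_eval_tensor_bound:
  fixes A :: "'a::cstar_algebra^3^3" and tens :: "'a \<Rightarrow> 'a \<Rightarrow> 'b::cstar_algebra"
  assumes tens: "is_min_tensor tens" and A: "is_C_SO A" and g: "g \<in> rotations" and h: "h \<in> rotations"
  shows "cmod (tfun (twisted_eval A g) (twisted_eval A h) ts) \<le> 16 * norm (tsum tens ts)"
proof -
  note b = matrix_coefficient_tensor_bound[OF tens rotation_rep(1)[OF A g] rotation_rep(1)[OF A h]]
  have t: "cmod (z + w) \<le> m + n" if "cmod z \<le> m" "cmod w \<le> n" for z w m n
    using that norm_triangle_mono by blast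
  let ?N = "norm (tsum tens ts)"
  have "cmod (tfun (twisted_eval A g) (twisted_eval A h) ts) \<le>
     (((?N + ?N) + ?N) + ?N) + (((?N + ?N) + ?N) + ?N) + (((?N + ?N) + ?N) + ?N) + (((?N + ?N) + ?N) + ?N)"
    unfolding twisted_eval_def quat_functional_def tfun_add by (intro t b)
  then show ?thesis by simp
qed

text \<open>The terms \<open>(u, v)\<close> of the iterated coproduct of a word \<open>w\<close>, which share the middle indices.\<close>

fun coproduct_words :: "(3 \<times> 3) list \<Rightarrow> ((3 \<times> 3) list \<times> (3 \<times> 3) list) list" where
  "coproduct_words [] = [([], [])]"
| "coproduct_words (g # w) =
     concat (map (\<lambda>k. map (\<lambda>(u, v). ((fst g, k) # u, (k, snd g) # v)) (coproduct_words w)) [1, 2, 3])"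

lemma coproduct_words_indices:
  "(u, v) \<in> set (coproduct_words w) \<Longrightarrow>
    map fst u = map fst w \<and> map snd v = map snd w \<and> map snd u = map fst v"
  by (induction w arbitrary: u v) auto

lemma gen_word_simps: "gen_word A [] = 1" "gen_word A ((i, j) # w) = A$i$j * gen_word A w"
  by (simp_all add: gen_word_def)

lemma sum_list_coproduct_words:
  fixes g h :: "real^3^3"
  shows "(\<Sum>(u, v)\<leftarrow>coproduct_words w. gen_word g u * gen_word h v) = gen_word (g ** h) w"
proof (induction w)
  case (Cons p w)
  obtain i j where p: "p = (i, j)" by (cases p)
  have k: "(\<Sum>(u, v)\<leftarrow>map (\<lambda>(u, v). ((i, k) # u, (k, j) # v)) L. gen_word g u * gen_word h v) =
      g$i$k * h$k$j * (\<Sum>(u, v)\<leftarrow>L. gen_word g u * gen_word h v)" for k L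
    by (induction L) (auto simp: gen_word_simps algebra_simps)
  have gh: "(g ** h)$i$j = g$i$1 * h$1$j + g$i$2 * h$2$j + g$i$3 * h$3$j"
    by (simp add: matrix_matrix_mult_def sum_3)
  show ?case
    unfolding p coproduct_words.simps gen_word_simps gh
    by (simp add: k Cons algebra_simps del: map_map)
qed (simp add: gen_word_simps)

definition coproduct_tensor :: "'a::cstar_algebra^3^3 \<Rightarrow> (3 \<times> 3) list \<Rightarrow> ('a \<times> 'a) list" where
  "coproduct_tensor A w = map (\<lambda>(u, v). (gen_word A u, gen_word A v)) (coproduct_words w)"

lemma coproduct_gen_word:
  assumes tens: "is_min_tensor tens" and D: "is_coproduct tens A \<Delta>"
  shows "\<Delta> (gen_word A w) = tsum tens (coproduct_tensor A w)"
proof (induction w)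
  case Nil
  then show ?case using D is_min_tensorD(5)[OF tens]
    by (simp add: coproduct_tensor_def gen_word_simps is_coproduct_def star_homD)
next
  case (Cons p w)
  obtain i j where p: "p = (i, j)" by (cases p)
  have k: "tsum tens (map (\<lambda>(u, v). (gen_word A u, gen_word A v)) (map (\<lambda>(u, v). ((i, k) # u, (k, j) # v)) L)) =
      tens (A$i$k) (A$k$j) * tsum tens (map (\<lambda>(u, v). (gen_word A u, gen_word A v)) L)" for k L
    by (induction L) (auto simp: gen_word_simps is_min_tensorD(6)[OF tens] distrib_left)
  have "\<Delta> (gen_word A (p # w)) = (\<Sum>k\<in>UNIV. tens (A$i$k) (A$k$j)) * \<Delta> (gen_word A w)"
    using D by (simp add: p gen_word_simps is_coproduct_def star_homD)
  then show ?case
    unfolding p coproduct_tensor_def coproduct_words.simps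
    by (simp add: k Cons coproduct_tensor_def sum_3 distrib_right add.assoc del: map_map)
qed

text \<open>The middle indices form the column word of the first leg and the row word of the second,
  so their sign occurs squared. The signs of the outer words are common to all terms, and the
  remaining monomials add up to the monomial of the matrix product.\<close>

lemma twisted_eval_coproduct_word:
  assumes A: "is_C_SO A" and g: "g \<in> rotations" and h: "h \<in> rotations"
  shows "tfun (twisted_eval A g) (twisted_eval A h) (coproduct_tensor A w) = twisted_eval A (g ** h) (gen_word A w)"
proof -
  let ?c = "\<lambda>I. fst (quat_word I)"
  have "twisted_eval A g (gen_word A u) * twisted_eval A h (gen_word A v) =
      ?c (map fst w) * ?c (map snd w) * complex_of_real (gen_word g u * gen_word h v)"
    if "(u, v) \<in> set (coproduct_words w)" for u v
  proof -
    have "twisted_eval A g (gen_word A u) * twisted_eval A h (gen_word A v) =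
        (?c (map fst v) * ?c (map fst v)) * (?c (map fst w) * ?c (map snd w) * complex_of_real (gen_word g u * gen_word h v))"
      using coproduct_words_indices[OF that]
      by (simp add: twisted_eval_gen_word[OF A g] twisted_eval_gen_word[OF A h])
    then show ?thesis by (simp add: quat_word_sign_square)
  qed
  then have "(\<Sum>(u, v)\<leftarrow>coproduct_words w. twisted_eval A g (gen_word A u) * twisted_eval A h (gen_word A v)) =
      (\<Sum>(u, v)\<leftarrow>coproduct_words w. ?c (map fst w) * ?c (map snd w) * complex_of_real (gen_word g u * gen_word h v))"
    by (intro arg_cong[where f = sum_list] map_cong) auto
  moreover have scale: "(\<Sum>(u, v)\<leftarrow>L. c * complex_of_real (f u v)) = c * complex_of_real (\<Sum>(u, v)\<leftarrow>L. f u v)"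
    for L c and f :: "(3 \<times> 3) list \<Rightarrow> (3 \<times> 3) list \<Rightarrow> real"
    by (induction L) (auto simp: algebra_simps)
  have "(\<Sum>(u, v)\<leftarrow>coproduct_words w. ?c (map fst w) * ?c (map snd w) * complex_of_real (gen_word g u * gen_word h v)) =
      ?c (map fst w) * ?c (map snd w) *
      complex_of_real (\<Sum>(u, v)\<leftarrow>coproduct_words w. gen_word g u * gen_word h v)"
    by (rule scale)
  ultimately show ?thesis
    unfolding sum_list_coproduct_words twisted_eval_gen_word[OF A rotations_mult[OF g h]]
    by (simp add: tfun_def coproduct_tensor_def o_def split_def)
qed

text \<open>The element \<open>x\<close> need not be a polynomial and the representative
  \<open>ts\<close> of its coproduct is arbitrary: the bound in the spatial norm makes the value
  independent of the representative and lets \<open>x\<close> be approximated by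
  polynomials.\<close>

lemma twisted_eval_coproduct:
  fixes A :: "'a::cstar_algebra^3^3" and tens :: "'a \<Rightarrow> 'a \<Rightarrow> 'b::cstar_algebra"
  assumes tens: "is_min_tensor tens" and A: "is_C_SO A" and D: "is_coproduct tens A \<Delta>"
    and g: "g \<in> rotations" and h: "h \<in> rotations" and x: "\<Delta> x = tsum tens ts"
  shows "tfun (twisted_eval A g) (twisted_eval A h) ts = twisted_eval A (g ** h) x"
proof -
  let ?t = "tfun (twisted_eval A g) (twisted_eval A h)"
  note lg = clinear_twisted_eval[OF A g] and lgh = clinear_twisted_eval[OF A rotations_mult[OF g h]]
  have Dh: "star_hom \<Delta>" using D by (simp add: is_coproduct_def)
  have poly: "\<exists>us. \<Delta> (eval_free A p) = tsum tens us \<and> ?t us = twisted_eval A (g ** h) (eval_free A p)" for p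
  proof (induction p rule: single_sum_induct)
    case (1 w c)
    show ?case
      by (rule exI[of _ "map (\<lambda>(x, y). (c *\<^sub>C x, y)) (coproduct_tensor A (letters w))"])
        (use lgh in \<open>simp add: eval_free_gen_word star_homD[OF Dh] tsum_map_scaleC[OF tens] tfun_map_scaleC[OF lg]
          coproduct_gen_word[OF tens D] twisted_eval_coproduct_word[OF A g h] clinear_map_def scaleC_complex_def\<close>)
  next
    case (2 p q)
    then obtain us vs where "\<Delta> (eval_free A p) = tsum tens us" "?t us = twisted_eval A (g ** h) (eval_free A p)"
      "\<Delta> (eval_free A q) = tsum tens vs" "?t vs = twisted_eval A (g ** h) (eval_free A q)" by blast
    then show ?case using lgh
      by (intro exI[of _ "us @ vs"]) (simp add: eval_free_add star_homD[OF Dh] clinear_map_def)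
  qed
  have "cmod (?t ts - twisted_eval A (g ** h) x) \<le> 0 + e" if e: "e > 0" for e
  proof -
    \<comment> \<open>The 20 is 16 + 4: the bound for the tensor functional plus the bound for a
      single functional.\<close>
    obtain p where p: "norm (x - eval_free A p) < e / 20"
      using eval_free_dense[OF A, of "e / 20" x] e by (metis divide_pos_pos zero_less_numeral)
    obtain us where us: "\<Delta> (eval_free A p) = tsum tens us" "?t us = twisted_eval A (g ** h) (eval_free A p)"
      using poly by blast
    let ?d = "ts @ map (\<lambda>(x, y). ((-1) *\<^sub>C x, y)) us"
    have "tsum tens ?d = \<Delta> (x - eval_free A p)"
      unfolding tsum_append tsum_map_scaleC[OF tens]
      by (simp add: us x clinear_map_diff[OF star_hom_clinear[OF Dh]] scaleC_minus_left scaleC_one flip: us)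
    then have "norm (tsum tens ?d) \<le> e / 20" using star_hom_norm_le[OF Dh, of "x - eval_free A p"] p by simp
    moreover have "?t ?d = ?t ts - ?t us" unfolding tfun_append tfun_map_scaleC[OF lg] by simp
    ultimately have 1: "cmod (?t ts - ?t us) \<le> 16 * (e / 20)"
      using twisted_eval_tensor_bound[OF tens A g h, of ?d] by simp
    have "cmod (?t us - twisted_eval A (g ** h) x) = cmod (twisted_eval A (g ** h) (x - eval_free A p))"
      by (simp add: us clinear_map_diff[OF lgh] norm_minus_commute)
    also have "\<dots> \<le> 4 * (e / 20)"
      using norm_twisted_eval_le[OF A rotations_mult[OF g h], of "x - eval_free A p"] p by simp
    finally show ?thesis
      using 1 norm_triangle_ineq[of "?t ts - ?t us" "?t us - twisted_eval A (g ** h) x"] by simp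
  qed
  then have "cmod (?t ts - twisted_eval A (g ** h) x) \<le> 0" by (rule field_le_epsilon)
  then show ?thesis by simp
qed

section \<open>Rigidity of bounded representations of the rotation group\<close>

definition complex_matrix :: "real^3^3 \<Rightarrow> complex^3^3" where
  "complex_matrix g = (\<chi> i j. complex_of_real (g$i$j))"

lemma complex_matrix_mult: "complex_matrix (g ** h) = complex_matrix g ** complex_matrix h"
  by (simp add: complex_matrix_def matrix_matrix_mult_def vec_eq_iff)

definition rot_z :: "real \<Rightarrow> real^3^3" where
  "rot_z a = vector [vector [cos a, - sin a, 0], vector [sin a, cos a, 0], vector [0, 0, 1]]"

definition rot_x :: "real \<Rightarrow> real^3^3" where
  "rot_x a = vector [vector [1, 0, 0], vector [0, cos a, - sin a], vector [0, sin a, cos a]]"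

definition rot_y :: "real \<Rightarrow> real^3^3" where
  "rot_y a = vector [vector [cos a, 0, sin a], vector [0, 1, 0], vector [- sin a, 0, cos a]]"

definition cyclic :: "real^3^3" where
  "cyclic = vector [vector [0, 0, 1], vector [1, 0, 0], vector [0, 1, 0]]"

lemma matrix_3_eq_iff: "M = N \<longleftrightarrow> (\<forall>i j. M$i$j = N$i$j)" for M N :: "'a^3^3"
  by (simp add: vec_eq_iff)

lemmas mat3_simps = matrix_3_eq_iff forall_3 matrix_matrix_mult_def sum_3 transpose_def mat_def det_3
  rot_z_def rot_x_def rot_y_def cyclic_def klein_def klein_sign_def complex_matrix_def

lemma rot_rotations: "rot_z a \<in> rotations" "rot_x a \<in> rotations" "rot_y a \<in> rotations" "cyclic \<in> rotations"
  by (simp_all add: rotations_def mat3_simps) (simp_all flip: power2_eq_square)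

text \<open>The angles \<open>w\<close> and \<open>a\<close> are chosen so that
  \<open>rot_z a ** rot_x w\<close> has the same third column as \<open>g\<close>. The remaining
  factor \<open>h\<close> then fixes the third axis, which makes it a rotation about that
  axis.\<close>

lemma rotation_euler:
  assumes "g \<in> rotations"
  obtains a w b where "g = rot_z a ** rot_x w ** rot_z b"
proof -
  have g: "g ** transpose g = mat 1" "transpose g ** g = mat 1" 
    using assms rotations_transpose[OF assms] by (auto simp: rotations_def)
  have "(transpose g ** g)$3$3 = 1" using g by (simp add: mat_def)
  then have col: "(g$1$3)\<^sup>2 + (g$2$3)\<^sup>2 + (g$3$3)\<^sup>2 = 1"
    by (simp add: matrix_matrix_mult_def transpose_def sum_3 power2_eq_square)
  have "(g$3$3)\<^sup>2 \<le> 1" using col by (metis add_increasing le_add_same_cancel2 order_refl zero_le_power2 add_nonneg_nonneg)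
  then have r: "\<bar>g$3$3\<bar> \<le> 1" by (simp add: abs_square_le_1)
  define w where "w = arccos (g$3$3)"
  have cw: "cos w = g$3$3" using r by (simp add: w_def abs_le_iff cos_arccos)
  have sw: "(sin w)\<^sup>2 = (g$1$3)\<^sup>2 + (g$2$3)\<^sup>2" using col cw by (simp add: sin_squared_eq)
  obtain a where a: "g$1$3 = sin a * sin w" "g$2$3 = - cos a * sin w"
  proof (cases "sin w = 0")
    case True
    then have "g$1$3 = 0" "g$2$3 = 0" using sw by (simp_all add: sum_power2_eq_zero_iff)
    then show thesis using True that by simp
  next
    case False
    then have "(- g$2$3 / sin w)\<^sup>2 + (g$1$3 / sin w)\<^sup>2 = 1"
    proof -
      have "(- g$2$3 / sin w)\<^sup>2 + (g$1$3 / sin w)\<^sup>2 = ((g$1$3)\<^sup>2 + (g$2$3)\<^sup>2) / (sin w)\<^sup>2"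
        by (simp add: power_divide add_divide_distrib add.commute)
      then show ?thesis unfolding sw[symmetric] using False by simp
    qed
    then obtain a where "- g$2$3 / sin w = cos a" "g$1$3 / sin w = sin a"
      using sincos_total_2pi by metis
    then show thesis using False by (intro that[of a]) (auto simp: field_simps)
  qed
  define h where "h = transpose (rot_x w) ** transpose (rot_z a) ** g"
  have hr: "h \<in> rotations" unfolding h_def by (intro rotations_mult rotations_transpose rot_rotations assms)
  have gh: "g = rot_z a ** rot_x w ** h"
  proof -
    have i: "rot_z a ** transpose (rot_z a) = mat 1" "rot_x w ** transpose (rot_x w) = mat 1"
      using rot_rotations by (auto simp: rotations_def)
    have "rot_z a ** rot_x w ** h = rot_z a ** (rot_x w ** transpose (rot_x w)) ** transpose (rot_z a) ** g"
      unfolding h_def by (simp only: matrix_mul_assoc)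
    then show ?thesis using i by simp
  qed
  have h3: "h$1$3 = 0" "h$2$3 = 0" "h$3$3 = 1"
  proof -
    have s: "sin a * (sin a * x) + cos a * (cos a * x) = x" for x
    proof -
      have "sin a * (sin a * x) + cos a * (cos a * x) = ((sin a)\<^sup>2 + (cos a)\<^sup>2) * x"
        by (simp add: distrib_right power2_eq_square)
      then show ?thesis by (simp only: sin_cos_squared_add mult_1_left)
    qed
    show "h$1$3 = 0" by (simp add: h_def mat3_simps a cw[symmetric])
    show "h$2$3 = 0" using s[of "sin w * cos w"] by (simp add: h_def mat3_simps a cw[symmetric] algebra_simps)
    show "h$3$3 = 1" using s[of "sin w * sin w"] sin_cos_squared_add3[of w] by (simp add: h_def mat3_simps a cw[symmetric] algebra_simps)
  qed
  have hh: "h ** transpose h = mat 1" "det h = 1" using hr by (auto simp: rotations_def)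
  have e: "(h ** transpose h)$1$1 = 1" "(h ** transpose h)$2$2 = 1" "(h ** transpose h)$3$3 = 1"
    unfolding hh by (simp_all add: mat_def)
  then have rows: "(h$1$1)\<^sup>2 + (h$1$2)\<^sup>2 = 1" "(h$2$1)\<^sup>2 + (h$2$2)\<^sup>2 = 1" "(h$3$1)\<^sup>2 + (h$3$2)\<^sup>2 = 0"
    by (simp_all add: matrix_matrix_mult_def transpose_def sum_3 h3 power2_eq_square)
  then have h31: "h$3$1 = 0" "h$3$2 = 0" by (simp_all add: sum_power2_eq_zero_iff)
  have "h$1$1 * h$2$2 - h$1$2 * h$2$1 = 1" using hh(2) by (simp add: det_3 h3 h31)
  then have "(h$1$1 - h$2$2)\<^sup>2 + (h$1$2 + h$2$1)\<^sup>2 = 0"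
    using rows by (simp add: power2_eq_square algebra_simps)
  then have h2: "h$2$2 = h$1$1" "h$1$2 = - h$2$1" by (auto simp: sum_power2_eq_zero_iff)
  obtain b where b: "h$1$1 = cos b" "h$2$1 = sin b"
    using sincos_total_2pi[of "h$1$1" "h$2$1"] rows(2) h2 by (auto simp: add.commute)
  have "h = rot_z b" by (simp add: mat3_simps h2 b h3 h31)
  then show thesis using gh that by blast
qed

text \<open>The difference \<open>L\<close> to the identity is additive, bounded, and zero at the
  fractions \<open>m / n\<close>. Writing \<open>y = m / n + r\<close> with \<open>r\<close> at most
  \<open>1 / n\<close> gives \<open>n * L y = L (n * r)\<close>, which stays bounded as
  \<open>n\<close> grows.\<close>

lemma additive_bounded_eq:
  fixes K :: "real \<Rightarrow> complex"
  assumes add: "\<And>y z. 0 \<le> y \<Longrightarrow> 0 \<le> z \<Longrightarrow> y + z \<le> 1 \<Longrightarrow> K (y + z) = K y + K z"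
    and bound: "\<And>y. 0 \<le> y \<Longrightarrow> y \<le> 1 \<Longrightarrow> cmod (K y) \<le> b" and one: "K 1 = 1"
    and y: "0 \<le> y" "y \<le> 1"
  shows "K y = complex_of_real y"
proof -
  define L where "L = (\<lambda>y. K y - complex_of_real y)"
  have Ladd: "L (y + z) = L y + L z" if "0 \<le> y" "0 \<le> z" "y + z \<le> 1" for y z
    using add[OF that] by (simp add: L_def)
  have L0: "L 0 = 0" using Ladd[of 0 0] by simp
  have L1: "L 1 = 0" by (simp add: L_def one)
  have Lb: "cmod (L y) \<le> b + 1" if "0 \<le> y" "y \<le> 1" for y
  proof -
    have "cmod (L y) \<le> cmod (K y) + cmod (complex_of_real y)" unfolding L_def by (rule norm_triangle_ineq4)
    then show ?thesis using bound[OF that] that by simp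
  qed
  have Lmult: "L (real n * z) = of_nat n * L z" if "0 \<le> z" "real n * z \<le> 1" for n z
    using that(2)
  proof (induction n)
    case (Suc n)
    have "real n * z \<le> 1" using Suc.prems that(1) by (simp add: algebra_simps)
    then show ?case using Suc Ladd[of z "real n * z"] that(1) by (simp add: algebra_simps)
  qed (simp add: L0)
  have le: "cmod (L y) * real n \<le> b + 1" if n: "n > 0" for n
  proof -
    define m where "m = nat \<lfloor>real n * y\<rfloor>"
    define r where "r = y - real m * (1 / real n)"
    have fl: "real m \<le> real n * y" "real n * y < real m + 1"
      using y by (simp_all add: m_def)
    have nr: "real n * r = real n * y - real m" using n by (simp add: r_def field_simps)
    have r: "0 \<le> r" "real n * r \<le> 1"
      using fl n nr by (simp_all add: r_def divide_le_eq mult.commute)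
    have mn: "real m \<le> real n" using fl(1) mult_left_le[OF y(2), of "real n"] by simp
    have "L (1 / real n) = 0" using Lmult[of "1 / real n" n] n by (simp add: L1)
    moreover have "L (real m * (1 / real n)) = of_nat m * L (1 / real n)"
      using mn n by (intro Lmult) (auto simp: divide_le_eq)
    ultimately have "L y = L r"
      using Ladd[of "real m * (1 / real n)" r] r y n by (simp add: r_def)
    then have "of_nat n * L y = L (real n * r)" using Lmult[OF r] by simp
    then have "cmod (of_nat n * L y) \<le> b + 1" using Lb[of "real n * r"] r by simp
    then show ?thesis by (simp add: norm_mult mult.commute)
  qed
  have "L y = 0"
  proof (rule ccontr)
    assume "L y \<noteq> 0"
    then obtain n where "b + 1 < real n * cmod (L y)" using reals_Archimedean3[of "cmod (L y)"] by auto
    moreover have "n > 0" using calculation Lb[OF y] norm_ge_zero[of "L y"] by (cases n) auto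
    ultimately show False using le[of n] by (simp add: mult.commute)
  qed
  then show ?thesis by (simp add: L_def)
qed

text \<open>On rotations about an axis the representation is given by a pair of functions \<open>u\<close>, \<open>v\<close> of the angle, and
  \<open>u = K \<circ> cos\<close> by the Euler decomposition. The \<open>(3,3)\<close> entry of \<open>rot_x s ** rot_y t\<close> shows that \<open>K\<close> is
  multiplicative, and together with \<open>(K (cos a))\<^sup>2 + (K (sin a))\<^sup>2 = 1\<close> this makes \<open>K\<close> additive on \<open>[0, 1]\<close>.\<close>

lemma rotation_representation_rigid:
  fixes R :: "real^3^3 \<Rightarrow> complex^3^3"
  assumes hom: "\<And>g h. g \<in> rotations \<Longrightarrow> h \<in> rotations \<Longrightarrow> R (g ** h) = R g ** R h"
    and bound: "\<And>g i j. g \<in> rotations \<Longrightarrow> cmod (R g$i$j) \<le> b"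
    and kl: "\<And>a. R (klein a) = complex_matrix (klein a)" and cyc: "R cyclic = complex_matrix cyclic"
    and g: "g \<in> rotations"
  shows "R g = complex_matrix g"
proof -
  note rr = rot_rotations klein_rotations
  \<comment> \<open>The quarter turn normalizes the group of half-turns; its relations with the
    half-turns and with \<open>cyclic\<close> determine its image up to one sign
    \<open>q\<close>.\<close>
  define t where "t = rot_z (pi / 2)"
  have t: "t \<in> rotations" by (simp add: t_def rr)
  have te: "t = vector [vector [0, -1, 0], vector [1, 0, 0], vector [0, 0, 1]]"
    by (simp add: t_def rot_z_def)
  define T where "T = R t"
  have "klein 3 ** t = t ** klein 3" by (simp add: te mat3_simps)
  from arg_cong[OF this, of R] have "complex_matrix (klein 3) ** T = T ** complex_matrix (klein 3)"
    by (simp add: hom rr t kl T_def)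
  then have T1: "T$1$3 = 0" "T$2$3 = 0" "T$3$1 = 0" "T$3$2 = 0" by (simp_all add: mat3_simps)
  have "t ** klein 1 = klein 2 ** t" by (simp add: te mat3_simps)
  from arg_cong[OF this, of R] have "T ** complex_matrix (klein 1) = complex_matrix (klein 2) ** T"
    by (simp add: hom rr t kl T_def)
  then have T2: "T$1$1 = 0" "T$2$2 = 0" by (simp_all add: mat3_simps)
  have "t ** t = klein 3" by (simp add: te mat3_simps)
  from arg_cong[OF this, of R] have "T ** T = complex_matrix (klein 3)" by (simp add: hom t kl T_def)
  then have T3: "T$1$2 * T$2$1 = -1" "T$3$3 * T$3$3 = 1" by (simp_all add: mat3_simps T1 T2)
  \<comment> \<open>This relation ties the third diagonal entry of \<open>T\<close> to the block of
    the first two coordinates, leaving a single unknown sign.\<close>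
  have "t ** cyclic = cyclic ** (cyclic ** (klein 3 ** t))" by (simp add: te mat3_simps)
  from arg_cong[OF this, of R]
  have "T ** complex_matrix cyclic = complex_matrix cyclic ** (complex_matrix cyclic ** (complex_matrix (klein 3) ** T))"
    by (simp add: hom t rr kl T_def rotations_mult cyc)
  from arg_cong[OF this, of "\<lambda>N. N$2$3"] arg_cong[OF this, of "\<lambda>N. N$1$1"]
  have T4: "T$2$1 = T$3$3" "T$1$2 = - T$2$1"
    by (simp_all add: matrix_matrix_mult_def sum_3 complex_matrix_def klein_def klein_sign_def cyclic_def T1 T2)
  define q where "q = T$3$3"
  have q2: "q * q = 1" using T3(2) by (simp add: q_def)
  have Tq: "T$2$1 = q" "T$1$2 = - q" "T$3$3 = q" using T4 by (simp_all add: q_def)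
  define u where "u = (\<lambda>a. R (rot_z a)$1$1)"
  define v where "v = (\<lambda>a. R (rot_z a)$2$1)"
  define c where "c = (\<lambda>a. R (rot_z a)$3$3)"
  have addz: "rot_z (a + a') = rot_z a ** rot_z a'" for a a'
    by (simp add: mat3_simps cos_add sin_add)
  have M: "R (rot_z a)$1$3 = 0 \<and> R (rot_z a)$2$3 = 0 \<and> R (rot_z a)$3$1 = 0 \<and> R (rot_z a)$3$2 = 0 \<and>
      R (rot_z a)$2$2 = u a \<and> R (rot_z a)$1$2 = - v a \<and> (u a)\<^sup>2 + (v a)\<^sup>2 = 1 \<and> (c a)\<^sup>2 = 1" for a
  proof -
    define N where "N = R (rot_z a)"
    have "klein 3 ** rot_z a = rot_z a ** klein 3" by (simp add: mat3_simps)
    from arg_cong[OF this, of R] have "complex_matrix (klein 3) ** N = N ** complex_matrix (klein 3)"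
      by (simp add: hom rr kl N_def)
    then have M1: "N$1$3 = 0" "N$2$3 = 0" "N$3$1 = 0" "N$3$2 = 0" by (simp_all add: mat3_simps)
    \<comment> \<open>Commuting with the quarter turn gives the block of the first two coordinates
      the form of a complex rotation, with entries \<open>u\<close> and \<open>v\<close>.\<close>
    have "t ** rot_z a = rot_z a ** t" by (simp add: te mat3_simps)
    from arg_cong[OF this, of R] have "T ** N = N ** T" by (simp add: hom rr t T_def N_def)
    from arg_cong[OF this, of "\<lambda>N. N$1$1"] arg_cong[OF this, of "\<lambda>N. N$1$2"]
    have "q * N$1$2 = q * (- N$2$1)" "q * N$2$2 = q * N$1$1"
      by (simp_all add: matrix_matrix_mult_def sum_3 T1 T2 Tq M1 mult.commute)
    moreover have "q \<noteq> 0" using q2 by auto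
    ultimately have M2: "N$1$2 = - N$2$1" "N$2$2 = N$1$1" using mult_left_cancel by blast+
    \<comment> \<open>Conjugation by the half-turn about the first axis inverts
      \<open>rot_z a\<close>; this yields the Pythagorean identity for \<open>u\<close> and
      \<open>v\<close>.\<close>
    have "rot_z a ** (klein 1 ** (rot_z a ** klein 1)) = klein 4"
      by (simp add: mat3_simps) (simp flip: power2_eq_square)
    from arg_cong[OF this, of R]
    have "N ** (complex_matrix (klein 1) ** (N ** complex_matrix (klein 1))) = complex_matrix (klein 4)"
      by (simp add: hom rr kl rotations_mult N_def)
    from arg_cong[OF this, of "\<lambda>N. N$1$1"] arg_cong[OF this, of "\<lambda>N. N$3$3"]
    have "N$1$1 * N$1$1 + N$2$1 * N$2$1 = 1" "N$3$3 * N$3$3 = 1"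
      by (simp_all add: matrix_matrix_mult_def sum_3 complex_matrix_def klein_def klein_sign_def M1 M2)
    then show ?thesis using M1 M2 unfolding N_def by (simp add: u_def v_def c_def power2_eq_square)
  qed
  \<comment> \<open>The halved angle exhibits the sign \<open>c a\<close> as a square of a sign. At
    the quarter turn this settles \<open>q = 1\<close>.\<close>
  have c1: "c a = 1" for a
  proof -
    have "rot_z a = rot_z (a / 2) ** rot_z (a / 2)" by (simp flip: addz)
    then have "R (rot_z a) = R (rot_z (a / 2)) ** R (rot_z (a / 2))" by (simp add: hom rr)
    then have "c a = c (a / 2) * c (a / 2)"
      using M[of "a / 2"] by (simp add: c_def matrix_matrix_mult_def sum_3)
    then show ?thesis using M[of "a / 2"] by (simp add: power2_eq_square)
  qed
  have "q = 1" using c1[of "pi / 2"] by (simp add: q_def T_def t_def c_def)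
  then have uv_t: "u (pi / 2) = 0" "v (pi / 2) = 1"
    using T2 Tq by (simp_all add: u_def v_def T_def t_def)
  have Rz: "R (rot_z a) = vector [vector [u a, - v a, 0], vector [v a, u a, 0], vector [0, 0, 1]]" for a
    using M[of a] c1[of a] by (simp add: matrix_3_eq_iff forall_3 u_def v_def c_def)
  have "rot_x a = cyclic ** (rot_z a ** (cyclic ** cyclic))" for a by (simp add: mat3_simps)
  then have "R (rot_x a) = complex_matrix cyclic ** (R (rot_z a) ** (complex_matrix cyclic ** complex_matrix cyclic))" for a
    by (simp add: hom rr rotations_mult cyc)
  then have Rx: "R (rot_x a) = vector [vector [1, 0, 0], vector [0, u a, - v a], vector [0, v a, u a]]" for a
    unfolding Rz by (simp add: mat3_simps)
  have "rot_y a = cyclic ** (cyclic ** (rot_z a ** cyclic))" for a by (simp add: mat3_simps)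
  then have "R (rot_y a) = complex_matrix cyclic ** (complex_matrix cyclic ** (R (rot_z a) ** complex_matrix cyclic))" for a
    by (simp add: hom rr rotations_mult cyc)
  then have Ry: "R (rot_y a) = vector [vector [u a, 0, v a], vector [0, 1, 0], vector [- v a, 0, u a]]" for a
    unfolding Rz by (simp add: mat3_simps)
  have u_add: "u (a + a') = u a * u a' - v a * v a'" for a a'
    unfolding u_def[THEN fun_cong, of "a + a'"] addz hom[OF rr(1) rr(1)] Rz
    by (simp add: matrix_matrix_mult_def sum_3)
  have u_neg: "u (- a) = u a" for a
  proof -
    have "rot_z (- a) = klein 1 ** (rot_z a ** klein 1)" by (simp add: mat3_simps)
    then have "R (rot_z (- a)) = complex_matrix (klein 1) ** (R (rot_z a) ** complex_matrix (klein 1))"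
      by (simp add: hom rr kl rotations_mult)
    then show ?thesis by (simp add: u_def mat3_simps)
  qed
  define K where "K = (\<lambda>x. u (arccos x))"
  \<comment> \<open>Replacing \<open>a\<close> by the angle \<open>arccos (cos a)\<close> can only
    change the sign of the sine, and \<open>u\<close> is even.\<close>
  have uK: "u a = K (cos a)" for a
  proof -
    define a' where "a' = arccos (cos a)"
    have "cos a' = cos a" by (simp add: a'_def cos_arccos)
    then have "(sin a')\<^sup>2 = (sin a)\<^sup>2" by (simp add: sin_squared_eq)
    then have "sin a' = sin a \<or> sin a' = - sin a" by (simp add: power2_eq_iff)
    then have "rot_z a' = rot_z a \<or> rot_z a' = rot_z (- a)"
      using \<open>cos a' = cos a\<close> by (auto simp: rot_z_def)
    then have "u a' = u a" using u_neg[of a] by (auto simp: u_def)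
    then show ?thesis by (simp add: K_def a'_def)
  qed
  have Kmult: "K (x * y) = K x * K y" if "\<bar>x\<bar> \<le> 1" "\<bar>y\<bar> \<le> 1" for x y
  proof -
    define s where "s = arccos x"
    define r where "r = arccos y"
    have cs: "cos s = x" "cos r = y" using that by (simp_all add: s_def r_def abs_le_iff cos_arccos)
    obtain a w d where e: "rot_x s ** rot_y r = rot_z a ** rot_x w ** rot_z d"
      using rotation_euler[OF rotations_mult[OF rr(2) rr(3)]] by blast
    have "(rot_x s ** rot_y r)$3$3 = (rot_z a ** rot_x w ** rot_z d)$3$3" by (simp add: e)
    then have "cos w = cos s * cos r" by (simp add: mat3_simps)
    moreover have "R (rot_x s) ** R (rot_y r) = R (rot_z a) ** R (rot_x w) ** R (rot_z d)"
      using arg_cong[OF e, of R] by (simp add: hom rr rotations_mult)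
    then have "(R (rot_x s) ** R (rot_y r))$3$3 = (R (rot_z a) ** R (rot_x w) ** R (rot_z d))$3$3" by simp
    then have "u s * u r = u w" unfolding Rx Ry Rz by (simp add: matrix_matrix_mult_def sum_3)
    ultimately show ?thesis by (simp add: uK cs)
  qed
  have K1: "K 1 = 1"
  proof -
    have "rot_z 0 = klein 4" by (simp add: mat3_simps)
    then have "u 0 = 1" by (simp add: u_def kl) (simp add: mat3_simps)
    then show ?thesis using uK[of 0] by simp
  qed
  have Km1: "K (- 1) = - 1"
  proof -
    have "rot_z pi = klein 3" by (simp add: mat3_simps)
    then have "u pi = - 1" by (simp add: u_def kl) (simp add: mat3_simps)
    then show ?thesis using uK[of pi] by simp
  qed
  have vK: "v a = K (sin a)" for a
  proof -
    have "u (a + pi / 2) = - v a" using u_add[of a "pi / 2"] uv_t by simp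
    then have "v a = - K (cos (a + pi / 2))" by (simp add: uK)
    also have "cos (a + pi / 2) = - 1 * sin a" by (simp add: cos_add)
    also have "K (- 1 * sin a) = K (- 1) * K (sin a)" by (rule Kmult) auto
    finally show ?thesis by (simp add: Km1)
  qed
  have Kpos: "K y = complex_of_real y" if "0 \<le> y" "y \<le> 1" for y
  proof (rule additive_bounded_eq[where b = b])
    fix x y :: real assume xy: "0 \<le> x" "0 \<le> y" "x + y \<le> 1"
    show "K (x + y) = K x + K y"
    proof (cases "x + y = 0")
      case True
      then have "x = 0" "y = 0" using xy by auto
      moreover have "K 0 = 0" using uv_t(1) uK[of "pi / 2"] by simp
      ultimately show ?thesis by simp
    next
      case False
      then have s: "x + y > 0" using xy by simp
      \<comment> \<open>Splitting \<open>x + y\<close> in the proportions of the squared cosine and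
        sine reduces additivity to multiplicativity and the Pythagorean identity.\<close>
      obtain a where a: "sqrt (x / (x + y)) = cos a" "sqrt (y / (x + y)) = sin a"
        using sincos_total_2pi[of "sqrt (x / (x + y))" "sqrt (y / (x + y))"] xy s
        by (auto simp flip: add_divide_distrib)
      have xa: "x = (x + y) * (cos a * cos a)" and ya: "y = (x + y) * (sin a * sin a)"
        using s xy by (simp_all flip: a)
      have le: "cos a * cos a \<le> 1" "sin a * sin a \<le> 1"
        using sin_cos_squared_add[of a] zero_le_square[of "cos a"] zero_le_square[of "sin a"]
        unfolding power2_eq_square by linarith+
      have "K x = K (x + y) * (K (cos a) * K (cos a))"
        using Kmult[of "x + y" "cos a * cos a"] Kmult[of "cos a" "cos a"] xy s xa
        by (simp add: abs_mult le)
      moreover have "K y = K (x + y) * (K (sin a) * K (sin a))"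
        using Kmult[of "x + y" "sin a * sin a"] Kmult[of "sin a" "sin a"] xy s ya
        by (simp add: abs_mult le)
      moreover have "K (cos a) * K (cos a) + K (sin a) * K (sin a) = 1"
        using M[of a] by (simp add: uK vK power2_eq_square)
      ultimately show ?thesis by (simp flip: distrib_left)
    qed
  next
    fix y :: real
    show "cmod (K y) \<le> b" unfolding K_def u_def by (rule bound[OF rr(1)])
  qed (use that K1 in auto)
  have Kall: "K y = complex_of_real y" if "\<bar>y\<bar> \<le> 1" for y
  proof (cases "0 \<le> y")
    case False
    then have "K y = K (- 1) * K (- y)" using Kmult[of "- 1" "- y"] that by simp
    then show ?thesis using False that Kpos[of "- y"] by (simp add: Km1)
  qed (use Kpos that in auto)
  have uv: "u a = complex_of_real (cos a)" "v a = complex_of_real (sin a)" for a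
    using Kall[of "cos a"] Kall[of "sin a"] by (simp_all add: uK vK)
  have "R (rot_z a) = complex_matrix (rot_z a)" "R (rot_x a) = complex_matrix (rot_x a)" for a
    unfolding Rz Rx uv by (simp_all add: mat3_simps)
  moreover obtain a w d where "g = rot_z a ** rot_x w ** rot_z d" using rotation_euler[OF g] .
  ultimately show ?thesis by (simp add: hom rr rotations_mult complex_matrix_mult)
qed

section \<open>The tetrahedral group\<close>

text \<open>The matrices of the characters of \<open>C(SO\<^sub>-\<^sub>1(3))\<close>.\<close>

definition tetrahedral :: "(real^3^3) set" where
  "tetrahedral = {X. X ** transpose X = mat 1 \<and> transpose X ** X = mat 1 \<and>
     (\<forall>i j k. j \<noteq> k \<longrightarrow> X$i$j * X$i$k = 0) \<and> (\<forall>i j k. i \<noteq> k \<longrightarrow> X$i$j * X$k$j = 0) \<and>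
     permanent X = 1}"

definition swap12 :: "real^3^3" where
  "swap12 = vector [vector [0, 1, 0], vector [1, 0, 0], vector [0, 0, 1]]"

lemma sum_permutations_matrix:
  fixes X :: "'a::semiring_1^3^3"
  shows "permanent X =
    X$1$1 * X$2$2 * X$3$3 + X$1$1 * X$2$3 * X$3$2 + X$1$2 * X$2$1 * X$3$3 + X$1$2 * X$2$3 * X$3$1 +
    X$1$3 * X$2$1 * X$3$2 + X$1$3 * X$2$2 * X$3$1"
  by (rule sum_permutations_3[of "\<lambda>a b c. X$1$a * X$2$b * X$3$c"])

lemma tetrahedral_transpose: "X \<in> tetrahedral \<Longrightarrow> transpose X \<in> tetrahedral"
  unfolding tetrahedral_def sum_permutations_matrix mem_Collect_eq
  by (elim conjE, intro conjI) (simp_all add: transpose_def mult_ac add_ac)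

text \<open>For scalars the anticommutation relations say that the products vanish, and
  self-adjointness says that the entries are real.\<close>

lemma complex_matrix_relators:
  assumes "so_relators Y \<subseteq> {0}"
  obtains X where "X \<in> tetrahedral" "Y = complex_matrix X"
proof -
  note r = so_relatorsD[OF assms]
  have "Im (Y$i$j) = 0" for i j using r(1)[of i j] by (auto simp: adj_complex_def complex_eq_iff)
  then have Y: "Y$i$j = complex_of_real (Re (Y$i$j))" for i j by (simp add: complex_eq_iff)
  define X :: "real^3^3" where "X = (\<chi> i j. Re (Y$i$j))"
  have X: "Y = complex_matrix X" using Y by (simp add: X_def complex_matrix_def vec_eq_iff)
  have inj: "M = N" if "complex_matrix M = complex_matrix N" for M N
    using that by (simp add: complex_matrix_def vec_eq_iff)
  have tr: "transpose (complex_matrix M) = complex_matrix (transpose M)" and one: "mat 1 = complex_matrix (mat 1)" for M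
    by (simp_all add: complex_matrix_def vec_eq_iff transpose_def mat_def)
  have Xij: "Y$i$j = complex_of_real (X$i$j)" for i j by (simp add: X complex_matrix_def)
  have "X ** transpose X = mat 1" "transpose X ** X = mat 1"
    using r(2,3) unfolding X tr one by (auto intro!: inj simp: complex_matrix_mult)
  moreover have "X$i$j * X$i$k = 0" if "j \<noteq> k" for i j k
  proof -
    have "complex_of_real (X$i$j * X$i$k) = - complex_of_real (X$i$j * X$i$k)"
      using r(4)[of k j i] that by (simp add: Xij mult.commute)
    then show ?thesis by (simp only: of_real_minus[symmetric] of_real_eq_iff)
  qed
  moreover have "X$i$j * X$k$j = 0" if "i \<noteq> k" for i j k
  proof -
    have "complex_of_real (X$i$j * X$k$j) = - complex_of_real (X$i$j * X$k$j)"
      using r(5)[of k i j] that by (simp add: Xij mult.commute)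
    then show ?thesis by (simp only: of_real_minus[symmetric] of_real_eq_iff)
  qed
  moreover have "complex_of_real (permanent X) = 1"
    using r(7) by (simp add: Xij)
  then have "permanent X = 1"
    by (simp only: of_real_eq_1_iff)
  ultimately have "X \<in> tetrahedral" by (simp add: tetrahedral_def)
  then show thesis using that X by blast
qed

lemma tetrahedral_relators:
  assumes "X \<in> tetrahedral"
  shows "so_relators (complex_matrix X) \<subseteq> {0}"
proof (rule so_relatorsI)
  have X: "X ** transpose X = mat 1" "transpose X ** X = mat 1" "\<And>i j k. j \<noteq> k \<Longrightarrow> X$i$j * X$i$k = 0"
    "\<And>i j k. i \<noteq> k \<Longrightarrow> X$i$j * X$k$j = 0"
    "permanent X = 1"
    using assms by (auto simp: tetrahedral_def)
  have tr: "transpose (complex_matrix M) = complex_matrix (transpose M)" and one: "mat 1 = complex_matrix (mat 1)" for M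
    by (simp_all add: complex_matrix_def vec_eq_iff transpose_def mat_def)
  let ?Y = "complex_matrix X"
  show "?Y ** transpose ?Y = mat 1" "transpose ?Y ** ?Y = mat 1"
    unfolding tr one by (simp_all add: X flip: complex_matrix_mult)
  show "?Y$i$j * ?Y$i$k = - (?Y$i$k * ?Y$i$j)" if "k \<noteq> j" for i j k
    using X(3)[of j k i] that by (auto simp: complex_matrix_def)
  show "?Y$i$j * ?Y$k$j = - (?Y$k$j * ?Y$i$j)" if "k \<noteq> i" for i j k
    using X(4)[of i k j] that by (auto simp: complex_matrix_def)
  show "permanent ?Y = 1"
    using arg_cong[OF X(5), of complex_of_real] by (simp add: complex_matrix_def)
qed (simp_all add: complex_matrix_def adj_complex_def mult.commute)

definition perm_matrices :: "(real^3^3) set" where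
  "perm_matrices = {mat 1, cyclic, cyclic ** cyclic, swap12, swap12 ** cyclic, swap12 ** (cyclic ** cyclic)}"

lemma perm_entries:
  fixes M N :: "real^3^3"
  shows "cyclic$1$1 = 0" "cyclic$1$2 = 0" "cyclic$1$3 = 1" "cyclic$2$1 = 1" "cyclic$2$2 = 0" "cyclic$2$3 = 0"
  "cyclic$3$1 = 0" "cyclic$3$2 = 1" "cyclic$3$3 = 0"
  "swap12$1$1 = 0" "swap12$1$2 = 1" "swap12$1$3 = 0" "swap12$2$1 = 1" "swap12$2$2 = 0" "swap12$2$3 = 0"
  "swap12$3$1 = 0" "swap12$3$2 = 0" "swap12$3$3 = 1"
  "(M ** N)$i$j = M$i$1 * N$1$j + M$i$2 * N$2$j + M$i$3 * N$3$j" "(mat 1 :: 'a::semiring_1^3^3)$i$j = (if i = j then 1 else 0)"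
  by (simp_all add: cyclic_def swap12_def matrix_matrix_mult_def sum_3 mat_def)

lemmas tetrahedral_simps = vec_eq_iff forall_3 perm_entries klein_def klein_sign_def

lemma klein_sign_cases:
  assumes "s1 * s1 = (1::real)" "s2 * s2 = 1" "s1 * s2 * s3 = 1"
  obtains a where "s1 = klein_sign a 1" "s2 = klein_sign a 2" "s3 = klein_sign a 3"
proof -
  have s: "s1 = 1 \<or> s1 = -1" "s2 = 1 \<or> s2 = -1" using assms(1,2) by (simp_all add: square_eq_1_iff)
  have "\<exists>a. s1 = klein_sign a 1 \<and> s2 = klein_sign a 2 \<and> s3 = klein_sign a 3"
  proof (cases "s1 = 1"; cases "s2 = 1")
    assume "s1 = 1" "s2 = 1" then show ?thesis using assms(3) by (intro exI[of _ 4]) (simp add: klein_sign_def)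
  next
    assume "s1 = 1" "s2 \<noteq> 1" then show ?thesis using assms(3) s by (intro exI[of _ 1]) (auto simp: klein_sign_def)
  next
    assume "s1 \<noteq> 1" "s2 = 1" then show ?thesis using assms(3) s by (intro exI[of _ 2]) (auto simp: klein_sign_def)
  next
    assume "s1 \<noteq> 1" "s2 \<noteq> 1" then show ?thesis using assms(3) s by (intro exI[of _ 3]) (auto simp: klein_sign_def)
  qed
  then show thesis using that by blast
qed

text \<open>Every row and every column has exactly one nonzero entry, a sign. Since the permanent
  ignores the parity of the permutation, its value 1 forces the three signs to multiply to 1 also
  for odd permutations, so the signs are those of a half-turn or of the identity.\<close>

lemma tetrahedral_decomposition:
  assumes "X \<in> tetrahedral"
  obtains a P where "P \<in> perm_matrices" "X = klein a ** P"
proof -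
  have X: "X ** transpose X = mat 1" "\<And>i j k. j \<noteq> k \<Longrightarrow> X$i$j * X$i$k = 0"
    "\<And>i j k. i \<noteq> k \<Longrightarrow> X$i$j * X$k$j = 0"
    "permanent X = 1"
    using assms by (auto simp: tetrahedral_def)
  note p = X(4)[unfolded sum_permutations_matrix]
  have "(X ** transpose X)$i$i = 1" for i by (simp add: X(1) mat_def)
  then have n: "X$i$1 * X$i$1 + X$i$2 * X$i$2 + X$i$3 * X$i$3 = 1" for i
    by (simp add: matrix_matrix_mult_def transpose_def sum_3)
  have row: "X$i$j = 0" if "X$i$k \<noteq> 0" "j \<noteq> k" for i j k using X(2)[of j k i] that by auto
  have col: "X$i$j = 0" if "X$k$j \<noteq> 0" "i \<noteq> k" for i j k using X(3)[of i k j] that by auto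
  have nz: "X$i$1 \<noteq> 0 \<or> X$i$2 \<noteq> 0 \<or> X$i$3 \<noteq> 0" for i using n[of i] by auto
  note result = that
  have fin: thesis if P: "P \<in> perm_matrices" and s: "X$1$j1 * X$1$j1 = 1" "X$2$j2 * X$2$j2 = 1" "X$1$j1 * X$2$j2 * X$3$j3 = 1"
    and e: "\<And>a. klein_sign a 1 = X$1$j1 \<Longrightarrow> klein_sign a 2 = X$2$j2 \<Longrightarrow> klein_sign a 3 = X$3$j3 \<Longrightarrow> X = klein a ** P"
    for P j1 j2 j3
    using klein_sign_cases[OF s] result[OF P e] by metis
  consider "X$1$1 \<noteq> 0" "X$2$2 \<noteq> 0" | "X$1$1 \<noteq> 0" "X$2$3 \<noteq> 0" | "X$1$2 \<noteq> 0" "X$2$1 \<noteq> 0"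
    | "X$1$2 \<noteq> 0" "X$2$3 \<noteq> 0" | "X$1$3 \<noteq> 0" "X$2$1 \<noteq> 0" | "X$1$3 \<noteq> 0" "X$2$2 \<noteq> 0"
    using nz[of 1] nz[of 2] X(3)[of 1 2 1] X(3)[of 1 2 2] X(3)[of 1 2 3] by auto
  then show thesis
  proof cases
    case 1
    have z: "X$1$2 = 0" "X$1$3 = 0" "X$2$1 = 0" "X$3$1 = 0" "X$2$3 = 0" "X$3$2 = 0"
      by (rule row[OF 1(1)], simp, rule row[OF 1(1)], simp, rule col[OF 1(1)], simp, rule col[OF 1(1)], simp,
        rule row[OF 1(2)], simp, rule col[OF 1(2)], simp)
    show thesis
    proof (rule fin[of "mat 1" 1 2 3])
      show "mat 1 \<in> perm_matrices" by (simp add: perm_matrices_def)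
      show "X$1$1 * X$1$1 = 1" "X$2$2 * X$2$2 = 1" "X$1$1 * X$2$2 * X$3$3 = 1"
        using n[of 1] n[of 2] p by (simp_all add: z)
    qed (simp add: vec_eq_iff forall_3 klein_mult z perm_entries klein_def)
  next
    case 2
    have z: "X$1$3 = 0" "X$1$2 = 0" "X$2$1 = 0" "X$3$1 = 0" "X$2$2 = 0" "X$3$3 = 0"
      by (rule row[OF 2(1)], simp, rule row[OF 2(1)], simp, rule col[OF 2(1)], simp, rule col[OF 2(1)], simp,
        rule row[OF 2(2)], simp, rule col[OF 2(2)], simp)
    show thesis
    proof (rule fin[of "swap12 ** cyclic" 1 3 2])
      show "swap12 ** cyclic \<in> perm_matrices" by (simp add: perm_matrices_def)
      show "X$1$1 * X$1$1 = 1" "X$2$3 * X$2$3 = 1" "X$1$1 * X$2$3 * X$3$2 = 1"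
        using n[of 1] n[of 2] p by (simp_all add: z)
    qed (simp add: vec_eq_iff forall_3 klein_mult z perm_entries klein_def)
  next
    case 3
    have z: "X$1$1 = 0" "X$1$3 = 0" "X$2$2 = 0" "X$3$2 = 0" "X$2$3 = 0" "X$3$1 = 0"
      by (rule row[OF 3(1)], simp, rule row[OF 3(1)], simp, rule col[OF 3(1)], simp, rule col[OF 3(1)], simp,
        rule row[OF 3(2)], simp, rule col[OF 3(2)], simp)
    show thesis
    proof (rule fin[of "swap12" 2 1 3])
      show "swap12 \<in> perm_matrices" by (simp add: perm_matrices_def)
      show "X$1$2 * X$1$2 = 1" "X$2$1 * X$2$1 = 1" "X$1$2 * X$2$1 * X$3$3 = 1"
        using n[of 1] n[of 2] p by (simp_all add: z)
    qed (simp add: vec_eq_iff forall_3 klein_mult z perm_entries klein_def)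
  next
    case 4
    have z: "X$1$3 = 0" "X$1$1 = 0" "X$2$2 = 0" "X$3$2 = 0" "X$2$1 = 0" "X$3$3 = 0"
      by (rule row[OF 4(1)], simp, rule row[OF 4(1)], simp, rule col[OF 4(1)], simp, rule col[OF 4(1)], simp,
        rule row[OF 4(2)], simp, rule col[OF 4(2)], simp)
    show thesis
    proof (rule fin[of "cyclic ** cyclic" 2 3 1])
      show "cyclic ** cyclic \<in> perm_matrices" by (simp add: perm_matrices_def)
      show "X$1$2 * X$1$2 = 1" "X$2$3 * X$2$3 = 1" "X$1$2 * X$2$3 * X$3$1 = 1"
        using n[of 1] n[of 2] p by (simp_all add: z)
    qed (simp add: vec_eq_iff forall_3 klein_mult z perm_entries klein_def)
  next
    case 5
    have z: "X$1$1 = 0" "X$1$2 = 0" "X$2$3 = 0" "X$3$3 = 0" "X$2$2 = 0" "X$3$1 = 0"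
      by (rule row[OF 5(1)], simp, rule row[OF 5(1)], simp, rule col[OF 5(1)], simp, rule col[OF 5(1)], simp,
        rule row[OF 5(2)], simp, rule col[OF 5(2)], simp)
    show thesis
    proof (rule fin[of "cyclic" 3 1 2])
      show "cyclic \<in> perm_matrices" by (simp add: perm_matrices_def)
      show "X$1$3 * X$1$3 = 1" "X$2$1 * X$2$1 = 1" "X$1$3 * X$2$1 * X$3$2 = 1"
        using n[of 1] n[of 2] p by (simp_all add: z)
    qed (simp add: vec_eq_iff forall_3 klein_mult z perm_entries klein_def)
  next
    case 6
    have z: "X$1$2 = 0" "X$1$1 = 0" "X$2$3 = 0" "X$3$3 = 0" "X$2$1 = 0" "X$3$2 = 0"
      by (rule row[OF 6(1)], simp, rule row[OF 6(1)], simp, rule col[OF 6(1)], simp, rule col[OF 6(1)], simp,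
        rule row[OF 6(2)], simp, rule col[OF 6(2)], simp)
    show thesis
    proof (rule fin[of "swap12 ** (cyclic ** cyclic)" 3 2 1])
      show "swap12 ** (cyclic ** cyclic) \<in> perm_matrices" by (simp add: perm_matrices_def)
      show "X$1$3 * X$1$3 = 1" "X$2$2 * X$2$2 = 1" "X$1$3 * X$2$2 * X$3$1 = 1"
        using n[of 1] n[of 2] p by (simp_all add: z)
    qed (simp add: vec_eq_iff forall_3 klein_mult z perm_entries klein_def)
  qed
qed

lemma klein_sign_props: "klein_sign a i * klein_sign a i = 1" "klein_sign a 1 * klein_sign a 2 * klein_sign a 3 = 1"
  using exhaust_4[of a] by (auto simp: klein_sign_def)

lemma tetrahedral_gens: "klein a \<in> tetrahedral" "cyclic \<in> tetrahedral" "swap12 \<in> tetrahedral"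
proof -
  show "klein a \<in> tetrahedral"
    using klein_sign_props(1)[of a] klein_sign_props(2)[of a]
    by (simp add: tetrahedral_def sum_permutations_matrix vec_eq_iff forall_3 matrix_matrix_mult_def transpose_def
        mat_def sum_3) (simp add: klein_def)
  show "cyclic \<in> tetrahedral" "swap12 \<in> tetrahedral"
    by (simp_all add: tetrahedral_def sum_permutations_matrix vec_eq_iff forall_3 matrix_matrix_mult_def transpose_def
        mat_def sum_3 cyclic_def swap12_def)
qed

section \<open>The representation \<open>\<rho>\<close>\<close>

lemma sum_1_4: "(\<Sum>k=1..4. f k) = f 1 + f 2 + f 3 + f 4" for f :: "nat \<Rightarrow> real"
  by (simp add: numeral_eq_Suc)

lemma rho_basis_values:
  "rho_basis 1 1 = 1/2" "rho_basis 1 2 = 1/2" "rho_basis 1 3 = -1/2" "rho_basis 1 4 = -1/2"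
  "rho_basis 2 1 = 1/2" "rho_basis 2 2 = -1/2" "rho_basis 2 3 = 1/2" "rho_basis 2 4 = -1/2"
  "rho_basis 3 1 = 1/2" "rho_basis 3 2 = -1/2" "rho_basis 3 3 = -1/2" "rho_basis 3 4 = 1/2"
  "rho_basis i (Suc 0) = 1/2"
  using exhaust_3[of i] by (auto simp: rho_basis_def)

lemma in_1_4: "k \<in> {1..4} \<longleftrightarrow> k = 1 \<or> k = 2 \<or> k = 3 \<or> k = (4::nat)"
  by auto

text \<open>These are the entries of the orthogonal projection onto the complement of (1, 1, 1, 1),
  the identity minus 1/4 everywhere.\<close>

lemma rho_basis_complete:
  assumes "k \<in> {1..4}" "l \<in> {1..4}"
  shows "(\<Sum>i\<in>UNIV. rho_basis i k * rho_basis i l) = (if k = l then 3/4 else -1/4)"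
  using assms unfolding in_1_4 by (elim disjE) (simp_all add: sum_3 rho_basis_values)

lemma rho_basis_orthonormal: "(\<Sum>k=1..4. rho_basis i k * rho_basis j k) = (if i = j then 1 else 0)"
  using exhaust_3[of i] exhaust_3[of j]
  unfolding sum_1_4 by (elim disjE) (simp_all add: rho_basis_values)

lemma rho_basis_sum: "(\<Sum>k=1..4. rho_basis i k) = 0"
  using exhaust_3[of i] unfolding sum_1_4 by (elim disjE) (simp_all add: rho_basis_values)

lemma rho_alt:
  assumes "x permutes {1..4}"
  shows "rho x$i$j = (\<Sum>l=1..4. rho_basis i (x l) * rho_basis j l)"
proof -
  have "(\<Sum>k=1..4. rho_basis i k * rho_basis j (Hilbert_Choice.inv x k)) =
      (\<Sum>l\<in>x ` {1..4}. rho_basis i l * rho_basis j (Hilbert_Choice.inv x l))"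
    using permutes_image[OF assms] by simp
  also have "\<dots> = (\<Sum>l=1..4. rho_basis i (x l) * rho_basis j (Hilbert_Choice.inv x (x l)))"
    using permutes_inj_on[OF assms] by (subst sum.reindex) auto
  finally show ?thesis by (simp add: rho_def permutes_inverses[OF assms])
qed

text \<open>For fixed \<open>l\<close> the numbers \<open>rho_basis i l\<close> are the coordinates
  of a vertex of a regular tetrahedron, the projection of the \<open>l\<close>-th unit vector;
  \<open>rho x\<close> permutes the four vertices by \<open>x\<close>.\<close>

lemma rho_action:
  assumes x: "x permutes {1..4}" and l: "l \<in> {1..4}"
  shows "(\<Sum>j\<in>UNIV. rho x$i$j * rho_basis j l) = rho_basis i (x l)"
proof -
  have d: "(\<Sum>m=1..4. rho_basis i (x m) * (if m = l then 1 else 0)) = rho_basis i (x l)"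
    using l unfolding in_1_4 sum_1_4 by (elim disjE) simp_all
  have "(\<Sum>j\<in>UNIV. rho x$i$j * rho_basis j l) =
      (\<Sum>m=1..4. rho_basis i (x m) * (\<Sum>j\<in>UNIV. rho_basis j m * rho_basis j l))"
    unfolding rho_alt[OF x] sum_distrib_right sum_distrib_left
    by (subst sum.swap) (simp add: mult.assoc)
  also have "\<dots> = (\<Sum>m=1..4. rho_basis i (x m) * (if m = l then 1 else 0) - rho_basis i (x m) / 4)"
    using l by (intro sum.cong refl) (simp add: rho_basis_complete)
  also have "\<dots> = rho_basis i (x l) - (\<Sum>m=1..4. rho_basis i (x m)) / 4"
    unfolding sum_subtractf sum_divide_distrib d ..
  also have "(\<Sum>m=1..4. rho_basis i (x m)) = (\<Sum>m\<in>x ` {1..4}. rho_basis i m)"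
    using permutes_inj_on[OF x] by (subst sum.reindex) auto
  also have "\<dots> = 0" using permutes_image[OF x] rho_basis_sum[of i] by simp
  finally show ?thesis by simp
qed

lemma rho_mult:
  assumes x: "x permutes {1..4}" and y: "y permutes {1..4}"
  shows "rho (x \<circ> y) = rho x ** rho y"
proof -
  have "rho (x \<circ> y)$i$j = (rho x ** rho y)$i$j" for i j
  proof -
    have "rho (x \<circ> y)$i$j = (\<Sum>l=1..4. (\<Sum>k\<in>UNIV. rho x$i$k * rho_basis k (y l)) * rho_basis j l)"
      unfolding rho_alt[OF permutes_compose[OF y x]]
      using permutes_in_image[OF y] by (intro sum.cong refl) (simp add: rho_action[OF x])
    also have "\<dots> = (rho x ** rho y)$i$j"
      unfolding matrix_matrix_mult_def
      by (simp add: rho_alt[OF y] sum_distrib_left sum_distrib_right mult.assoc)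
        (rule sum.swap)
    finally show ?thesis .
  qed
  then show ?thesis by (simp add: vec_eq_iff)
qed

lemma rho_id: "rho id = mat 1"
  using rho_basis_orthonormal by (simp add: rho_def vec_eq_iff mat_def)

lemma rho_transpose:
  assumes "x permutes {1..4}"
  shows "transpose (rho x) = rho (Hilbert_Choice.inv x)"
  using permutes_inv[OF assms] permutes_inv_inv[OF assms]
  by (simp add: vec_eq_iff transpose_def rho_alt[OF assms]) (simp add: rho_def mult.commute)

text \<open>All coordinates of all four vertices are 1/2 or -1/2, and \<open>rho x\<close> permutes
  the vertices. So a row \<open>(p, q, r)\<close> gives the same square on each vertex, and linear
  combinations of the four expansions isolate the cross terms.\<close>

lemma rho_rows:
  assumes x: "x permutes {1..4}" and "j \<noteq> k"
  shows "rho x$i$j * rho x$i$k = 0"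
proof -
  have sq: "(rho_basis i m)\<^sup>2 = 1/4" if "m \<in> {1..4}" for m
    using that exhaust_3[of i] unfolding in_1_4 by (elim disjE) (simp_all add: rho_basis_values power2_eq_square)
  have e: "(\<Sum>j\<in>UNIV. rho x$i$j * rho_basis j l)\<^sup>2 = 1/4" if "l \<in> {1..4}" for l
    unfolding rho_action[OF x that] using sq permutes_in_image[OF x] that by blast
  define p where "p = rho x$i$1"
  define q where "q = rho x$i$2"
  define r where "r = rho x$i$3"
  have "p * p + q * q + r * r + 2 * (p * q) + 2 * (p * r) + 2 * (q * r) = 1"
    "p * p + q * q + r * r - 2 * (p * q) - 2 * (p * r) + 2 * (q * r) = 1"
    "p * p + q * q + r * r - 2 * (p * q) + 2 * (p * r) - 2 * (q * r) = 1"
    "p * p + q * q + r * r + 2 * (p * q) - 2 * (p * r) - 2 * (q * r) = 1"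
    using e[of 1] e[of 2] e[of 3] e[of 4]
    by (simp_all add: p_def q_def r_def sum_3 rho_basis_values power2_eq_square algebra_simps)
  then have "p * q = 0" "p * r = 0" "q * r = 0" by linarith+
  then show ?thesis using exhaust_3[of j] exhaust_3[of k] \<open>j \<noteq> k\<close>
    unfolding p_def q_def r_def by (elim disjE) auto
qed

lemma rho_tetrahedral:
  assumes x: "x permutes {1..4}"
  shows "rho x \<in> tetrahedral"
proof -
  note x' = permutes_inv[OF x]
  have i: "x \<circ> Hilbert_Choice.inv x = id" "Hilbert_Choice.inv x \<circ> x = id"
    using permutes_inv_o[OF x] by simp_all
  have o: "rho x ** transpose (rho x) = mat 1" "transpose (rho x) ** rho x = mat 1"
    unfolding rho_transpose[OF x] by (simp_all add: i rho_id flip: rho_mult[OF x x'] rho_mult[OF x' x])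
  have row: "rho x$i$j * rho x$i$k = 0" if "j \<noteq> k" for i j k by (rule rho_rows[OF x that])
  have col: "rho x$i$j * rho x$k$j = 0" if "i \<noteq> k" for i j k
    using rho_rows[OF x' that, of j] unfolding rho_transpose[OF x, symmetric] by (simp add: transpose_def)
  \<comment> \<open>The product of the three coordinates is the same for all vertices. Compared at
    vertex 1 and its image, it gives the permanent, since the terms with a repeated column
    vanish.\<close>
  have prod: "rho_basis 1 m * rho_basis 2 m * rho_basis 3 m = 1/8" if "m \<in> {1..4}" for m
    using that unfolding in_1_4 by (elim disjE) (simp_all add: rho_basis_values)
  have "x 1 \<in> {1..4}" using permutes_in_image[OF x] by simp
  from prod[OF this] have "(\<Sum>j\<in>UNIV. rho x$1$j * rho_basis j 1) * (\<Sum>j\<in>UNIV. rho x$2$j * rho_basis j 1) *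
      (\<Sum>j\<in>UNIV. rho x$3$j * rho_basis j 1) = 1/8"
    by (simp add: rho_action[OF x])
  then have "(rho x$1$1 + rho x$1$2 + rho x$1$3) * (rho x$2$1 + rho x$2$2 + rho x$2$3) *
      (rho x$3$1 + rho x$3$2 + rho x$3$3) = 1"
    by (simp add: sum_3 rho_basis_values field_simps)
  moreover have "rho x$1$j * rho x$2$j = 0" "rho x$1$j * rho x$3$j = 0" "rho x$2$j * rho x$3$j = 0"
    "rho x$1$j * (rho x$2$j * z) = 0" "rho x$1$j * (rho x$3$j * z) = 0" "rho x$2$j * (rho x$3$j * z) = 0"
    "rho x$1$j * (z * rho x$3$j) = 0" for j z
    using col[of 1 2 j] col[of 1 3 j] col[of 2 3 j] by auto
  ultimately have "permanent (rho x) = 1"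
    unfolding sum_permutations_matrix by (simp add: distrib_left distrib_right add_ac mult.assoc)
  then show ?thesis using o row col unfolding tetrahedral_def by blast
qed

lemma rho_inj:
  assumes x: "x permutes {1..4}" and y: "y permutes {1..4}" and eq: "rho x = rho y"
  shows "x = y"
proof -
  have "x l = y l" if l: "l \<in> {1..4}" for l
  proof -
    have "rho_basis i (x l) = rho_basis i (y l)" for i
      using rho_action[OF x l, of i] rho_action[OF y l, of i] by (simp add: eq)
    then have "(\<Sum>i\<in>UNIV. rho_basis i (x l) * rho_basis i (y l)) = (\<Sum>i\<in>UNIV. rho_basis i (y l) * rho_basis i (y l))"
      by simp
    moreover have "x l \<in> {1..4}" "y l \<in> {1..4}" using permutes_in_image[OF x] permutes_in_image[OF y] l by blast+
    ultimately show ?thesis by (simp add: rho_basis_complete split: if_splits)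
  qed
  then show ?thesis using x y by (metis ext permutes_not_in)
qed

text \<open>By counting: the 24 distinct matrices \<open>rho x\<close> lie in the set of products of
  a \<open>klein\<close> and a permutation matrix, which has at most 4 times 6 elements and contains
  all tetrahedral matrices.\<close>

lemma rho_surj:
  assumes "X \<in> tetrahedral"
  obtains x where "x permutes {1..4}" "rho x = X"
proof -
  let ?S = "{x :: nat \<Rightarrow> nat. x permutes {1..4}}"
  let ?Q = "(\<lambda>(a, P). klein a ** P) ` ((UNIV :: 4 set) \<times> perm_matrices)"
  have sub: "tetrahedral \<subseteq> ?Q" by (force elim: tetrahedral_decomposition)
  have finP: "finite perm_matrices" by (simp add: perm_matrices_def)
  have "card perm_matrices \<le> 6" unfolding perm_matrices_def
    by (intro card_insert_le_m1) simp_all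
  then have "card ((UNIV :: 4 set) \<times> perm_matrices) \<le> 24" by (simp add: card_cartesian_product)
  moreover have "card ?Q \<le> card ((UNIV :: 4 set) \<times> perm_matrices)"
    by (rule card_image_le) (simp add: finP)
  ultimately have Q: "card ?Q \<le> 24" "finite ?Q" using finP by auto
  have "inj_on rho ?S" by (rule inj_onI) (use rho_inj in blast)
  then have "card (rho ` ?S) = card ?S" by (rule card_image)
  also have "card ?S = fact 4" by (rule card_permutations) simp_all
  finally have S: "card (rho ` ?S) = 24" by (simp add: fact_numeral)
  have "rho ` ?S \<subseteq> ?Q" using sub rho_tetrahedral by blast
  then have eq: "rho ` ?S = ?Q" using S Q by (intro card_seteq) auto
  have "X \<in> rho ` ?S" unfolding eq by (rule subsetD[OF sub assms])
  then show thesis using that by blast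
qed

section \<open>Characters\<close>

text \<open>The automorphism of the quaternions that sends \<open>i\<close> to \<open>j\<close>,
  \<open>j\<close> to \<open>k\<close> and \<open>k\<close> to \<open>i\<close>. It matches
  \<open>j + 1\<close> on the numeral type \<open>3\<close>, where \<open>3 + 1 = 1\<close>.\<close>

definition quat_cycle :: "4 \<Rightarrow> 4" where
  "quat_cycle a = (if a = 4 then 4 else if a = 3 then 1 else a + 1)"

lemma quat_cycle:
  "quat_unit (j + 1) = quat_cycle (quat_unit j)"
  "quat_sign (quat_cycle a) (quat_cycle b) = quat_sign a b"
  "quat_index (quat_cycle a) (quat_cycle b) = quat_cycle (quat_index a b)"
proof -
  show "quat_unit (j + 1) = quat_cycle (quat_unit j)"
    using exhaust_3[of j] by (elim disjE) (simp_all add: quat_unit_def quat_cycle_def)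
  show "quat_sign (quat_cycle a) (quat_cycle b) = quat_sign a b"
    "quat_index (quat_cycle a) (quat_cycle b) = quat_cycle (quat_index a b)"
    using exhaust_4[of a] exhaust_4[of b]
    by (elim disjE; simp add: quat_table quat_cycle_def; simp add: quat_conj_sign_def)+
qed

lemma quat_word_cycle:
  "quat_word (map (\<lambda>j. j + 1) J) = (fst (quat_word J), quat_cycle (snd (quat_word J)))"
proof (induction J)
  case Nil
  then show ?case by (simp add: quat_cycle_def)
next
  case (Cons j J)
  then show ?case by (simp add: quat_cycle)
qed

lemma gen_word_klein: "gen_word (klein a) w \<noteq> 0 \<Longrightarrow> map fst w = map snd w"
  by (induction w) (auto simp: gen_word_def klein_def split: if_splits)

lemma gen_word_cyclic: "gen_word cyclic w \<noteq> 0 \<Longrightarrow> map fst w = map (\<lambda>j. j + 1) (map snd w)"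
proof (induction w)
  case (Cons p w)
  obtain i j where p: "p = (i, j)" by (cases p)
  have "cyclic$i$j \<noteq> 0" using Cons.prems by (auto simp: p gen_word_def)
  then have "i = j + 1" using exhaust_3[of i] exhaust_3[of j] by (elim disjE) (simp_all add: perm_entries)
  moreover have "gen_word cyclic w \<noteq> 0" using Cons.prems by (auto simp: p gen_word_def)
  ultimately show ?case using Cons.IH by (simp add: p)
qed simp

lemma gen_word_complex_matrix: "gen_word (complex_matrix X) w = complex_of_real (gen_word X w)"
  by (induction w) (auto simp: gen_word_def complex_matrix_def)

lemma bounded_linear_twisted_eval:
  assumes "is_C_SO A" "g \<in> rotations"
  shows "bounded_linear (twisted_eval A g)"
  using clinear_twisted_eval[OF assms] norm_twisted_eval_le[OF assms] unfolding clinear_map_def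
  by (intro bounded_linear_intro[where K = 4])
    (simp_all add: scaleR_scaleC scaleC_complex_def mult.commute scaleR_conv_of_real)

text \<open>If the row and the column word carry the same sign whenever the monomial is nonzero, the
  twist cancels and the functional agrees on words with the character supplied by the universal
  property. For half-turns the two words coincide; for \<open>cyclic\<close> they differ by a
  quaternion automorphism.\<close>

lemma star_hom_twisted_eval:
  assumes A: "is_C_SO A" and X: "X \<in> rotations" "X \<in> tetrahedral"
    and w: "\<And>w. gen_word X w \<noteq> 0 \<Longrightarrow> fst (quat_word (map fst w)) = fst (quat_word (map snd w))"
  shows "star_hom (twisted_eval A X)"
proof -
  obtain f where f: "star_hom f" "\<And>i j. f (A$i$j) = complex_matrix X$i$j"
    using universal_star_hom[OF A tetrahedral_relators[OF X(2)]] by blast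
  have c: "(\<chi> i j. f (A$i$j)) = complex_matrix X" by (simp add: vec_eq_iff f(2))
  note l = clinear_twisted_eval[OF A X(1)]
  have wd: "twisted_eval A X (gen_word A w) = f (gen_word A w)" for w
  proof -
    have "f (gen_word A w) = complex_of_real (gen_word X w)"
      by (simp add: gen_word_star_hom[OF f(1)] c gen_word_complex_matrix)
    moreover have "twisted_eval A X (gen_word A w) = complex_of_real (gen_word X w)"
      unfolding twisted_eval_gen_word[OF A X(1)]
      using w[of w] quat_word_sign_square[of "map snd w"] by (cases "gen_word X w = 0") simp_all
    ultimately show ?thesis by simp
  qed
  have ev: "twisted_eval A X (eval_free A p) = f (eval_free A p)" for p
  proof (induction p rule: single_sum_induct)
    case (1 w c)
    then show ?case using l by (simp add: eval_free_gen_word wd clinear_map_def star_homD[OF f(1)])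
  qed (use l in \<open>simp add: eval_free_add clinear_map_def star_homD[OF f(1)]\<close>)
  have "continuous_on UNIV (twisted_eval A X)" "continuous_on UNIV f"
    using bounded_linear_twisted_eval[OF A X(1)] star_hom_bounded_linear[OF f(1)]
    by (auto intro: linear_continuous_on)
  then have "closed {x. twisted_eval A X x = f x}" by (intro closed_Collect_eq)
  then have "closure (range (eval_free A)) \<subseteq> {x. twisted_eval A X x = f x}"
    by (rule closure_minimal[rotated]) (auto simp: ev)
  then have "twisted_eval A X = f" using A by (auto simp: is_C_SO_def)
  then show ?thesis using f(1) by simp
qed

lemma cyclic_rotations: "cyclic \<in> rotations"
  by (rule rot_rotations)

lemma star_hom_twisted_eval_klein: "is_C_SO A \<Longrightarrow> star_hom (twisted_eval A (klein a))"
  by (rule star_hom_twisted_eval[OF _ klein_rotations tetrahedral_gens(1)]) (assumption, drule gen_word_klein, simp only:)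

lemma star_hom_twisted_eval_cyclic: "is_C_SO A \<Longrightarrow> star_hom (twisted_eval A cyclic)"
  by (rule star_hom_twisted_eval[OF _ cyclic_rotations tetrahedral_gens(2)])
    (assumption, drule gen_word_cyclic, simp add: quat_word_cycle del: map_map)

text \<open>Inherited from S_4 through \<open>rho\<close>, which spares expanding the permanent of a
  product.\<close>

lemma tetrahedral_mult:
  assumes "X \<in> tetrahedral" "Y \<in> tetrahedral"
  shows "X ** Y \<in> tetrahedral"
proof -
  obtain x y where "x permutes {1..4}" "rho x = X" "y permutes {1..4}" "rho y = Y"
    using rho_surj[OF assms(1)] rho_surj[OF assms(2)] by metis
  then show ?thesis using rho_tetrahedral[OF permutes_compose, of y x] rho_mult[of x y] by auto
qed

lemma tetrahedral_one: "mat 1 \<in> tetrahedral"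
  using rho_tetrahedral[OF permutes_id] by (simp add: rho_id)

lemma tetrahedral_products:
  "klein a \<in> tetrahedral" "klein a ** mat 1 \<in> tetrahedral" "klein a ** cyclic \<in> tetrahedral"
  "klein a ** (cyclic ** cyclic) \<in> tetrahedral" "klein a ** swap12 \<in> tetrahedral"
  "klein a ** (swap12 ** cyclic) \<in> tetrahedral" "klein a ** (swap12 ** (cyclic ** cyclic)) \<in> tetrahedral"
  by (intro tetrahedral_mult tetrahedral_gens tetrahedral_one)+

text \<open>There are 3 times 8 pairs of a half-turn and an element of order 3, as many as elements
  of S_4, and conjugation acts simply transitively on them. In each witness the permutation part
  takes axis 1 to axis \<open>a\<close> and \<open>cyclic\<close> to \<open>P\<close>; the factor
  \<open>klein c\<close> is the one whose product with its image under conjugation by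
  \<open>P\<close> is \<open>klein b\<close>.\<close>

lemma tetrahedral_conjugate_generators:
  assumes "a \<noteq> 4" "P = cyclic \<or> P = cyclic ** cyclic"
  shows "\<exists>x\<in>tetrahedral. x ** klein 1 = klein a ** x \<and> x ** cyclic = (klein b ** P) ** x"
proof -
  let ?G = "\<lambda>Y Z. \<exists>x\<in>tetrahedral. x ** klein 1 = Y ** x \<and> x ** cyclic = Z ** x"
  have g1_1_1: "?G (klein 1) (klein 1 ** cyclic)"
    by (rule bexI[of _ "klein 2 ** mat 1"])
      (simp add: tetrahedral_simps, rule tetrahedral_products)
  have g1_1_2: "?G (klein 1) (klein 1 ** (cyclic ** cyclic))"
    by (rule bexI[of _ "klein 3 ** (swap12 ** cyclic)"])
      (simp add: tetrahedral_simps, rule tetrahedral_products)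
  have g1_2_1: "?G (klein 1) (klein 2 ** cyclic)"
    by (rule bexI[of _ "klein 3 ** mat 1"])
      (simp add: tetrahedral_simps, rule tetrahedral_products)
  have g1_2_2: "?G (klein 1) (klein 2 ** (cyclic ** cyclic))"
    by (rule bexI[of _ "klein 1 ** (swap12 ** cyclic)"])
      (simp add: tetrahedral_simps, rule tetrahedral_products)
  have g1_3_1: "?G (klein 1) (klein 3 ** cyclic)"
    by (rule bexI[of _ "klein 1 ** mat 1"])
      (simp add: tetrahedral_simps, rule tetrahedral_products)
  have g1_3_2: "?G (klein 1) (klein 3 ** (cyclic ** cyclic))"
    by (rule bexI[of _ "klein 2 ** (swap12 ** cyclic)"])
      (simp add: tetrahedral_simps, rule tetrahedral_products)
  have g1_4_1: "?G (klein 1) (klein 4 ** cyclic)"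
    by (rule bexI[of _ "klein 4 ** mat 1"])
      (simp add: tetrahedral_simps, rule tetrahedral_products)
  have g1_4_2: "?G (klein 1) (klein 4 ** (cyclic ** cyclic))"
    by (rule bexI[of _ "klein 4 ** (swap12 ** cyclic)"])
      (simp add: tetrahedral_simps, rule tetrahedral_products)
  have g2_1_1: "?G (klein 2) (klein 1 ** cyclic)"
    by (rule bexI[of _ "klein 2 ** cyclic"])
      (simp add: tetrahedral_simps, rule tetrahedral_products)
  have g2_1_2: "?G (klein 2) (klein 1 ** (cyclic ** cyclic))"
    by (rule bexI[of _ "klein 3 ** swap12"])
      (simp add: tetrahedral_simps, rule tetrahedral_products)
  have g2_2_1: "?G (klein 2) (klein 2 ** cyclic)"
    by (rule bexI[of _ "klein 3 ** cyclic"])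
      (simp add: tetrahedral_simps, rule tetrahedral_products)
  have g2_2_2: "?G (klein 2) (klein 2 ** (cyclic ** cyclic))"
    by (rule bexI[of _ "klein 1 ** swap12"])
      (simp add: tetrahedral_simps, rule tetrahedral_products)
  have g2_3_1: "?G (klein 2) (klein 3 ** cyclic)"
    by (rule bexI[of _ "klein 1 ** cyclic"])
      (simp add: tetrahedral_simps, rule tetrahedral_products)
  have g2_3_2: "?G (klein 2) (klein 3 ** (cyclic ** cyclic))"
    by (rule bexI[of _ "klein 2 ** swap12"])
      (simp add: tetrahedral_simps, rule tetrahedral_products)
  have g2_4_1: "?G (klein 2) (klein 4 ** cyclic)"
    by (rule bexI[of _ "klein 4 ** cyclic"])
      (simp add: tetrahedral_simps, rule tetrahedral_products)
  have g2_4_2: "?G (klein 2) (klein 4 ** (cyclic ** cyclic))"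
    by (rule bexI[of _ "klein 4 ** swap12"])
      (simp add: tetrahedral_simps, rule tetrahedral_products)
  have g3_1_1: "?G (klein 3) (klein 1 ** cyclic)"
    by (rule bexI[of _ "klein 2 ** (cyclic ** cyclic)"])
      (simp add: tetrahedral_simps, rule tetrahedral_products)
  have g3_1_2: "?G (klein 3) (klein 1 ** (cyclic ** cyclic))"
    by (rule bexI[of _ "klein 3 ** (swap12 ** (cyclic ** cyclic))"])
      (simp add: tetrahedral_simps, rule tetrahedral_products)
  have g3_2_1: "?G (klein 3) (klein 2 ** cyclic)"
    by (rule bexI[of _ "klein 3 ** (cyclic ** cyclic)"])
      (simp add: tetrahedral_simps, rule tetrahedral_products)
  have g3_2_2: "?G (klein 3) (klein 2 ** (cyclic ** cyclic))"
    by (rule bexI[of _ "klein 1 ** (swap12 ** (cyclic ** cyclic))"])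
      (simp add: tetrahedral_simps, rule tetrahedral_products)
  have g3_3_1: "?G (klein 3) (klein 3 ** cyclic)"
    by (rule bexI[of _ "klein 1 ** (cyclic ** cyclic)"])
      (simp add: tetrahedral_simps, rule tetrahedral_products)
  have g3_3_2: "?G (klein 3) (klein 3 ** (cyclic ** cyclic))"
    by (rule bexI[of _ "klein 2 ** (swap12 ** (cyclic ** cyclic))"])
      (simp add: tetrahedral_simps, rule tetrahedral_products)
  have g3_4_1: "?G (klein 3) (klein 4 ** cyclic)"
    by (rule bexI[of _ "klein 4 ** (cyclic ** cyclic)"])
      (simp add: tetrahedral_simps, rule tetrahedral_products)
  have g3_4_2: "?G (klein 3) (klein 4 ** (cyclic ** cyclic))"
    by (rule bexI[of _ "klein 4 ** (swap12 ** (cyclic ** cyclic))"])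
      (simp add: tetrahedral_simps, rule tetrahedral_products)
  show ?thesis
    using assms exhaust_4[of a] exhaust_4[of b]
    by (elim disjE) (simp_all only: simp_thms g1_1_1 g1_1_2 g1_2_1 g1_2_2 g1_3_1 g1_3_2 g1_4_1 g1_4_2
      g2_1_1 g2_1_2 g2_2_1 g2_2_2 g2_3_1 g2_3_2 g2_4_1 g2_4_2
      g3_1_1 g3_1_2 g3_2_1 g3_2_2 g3_3_1 g3_3_2 g3_4_1 g3_4_2)
qed

lemma det_perm_matrices:
  "det (klein a) = 1" "det cyclic = 1" "det swap12 = -1"
  using klein_sign_props(2)[of a] by (simp_all add: det_3 klein_def perm_entries)

text \<open>An involution of determinant 1 must be a half-turn, as the odd permutation parts have
  determinant -1 and the 3-cycles do not square to 1. A nontrivial element of order 3 has a 3-cycle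
  as its permutation part.\<close>

lemma tetrahedral_conjugate_images:
  assumes Y: "Y \<in> tetrahedral" "Y ** Y = mat 1" "Y \<noteq> mat 1" "det Y = 1"
    and Z: "Z \<in> tetrahedral" "Z ** (Z ** Z) = mat 1" "Z \<noteq> mat 1"
  obtains x where "x \<in> tetrahedral" "x ** klein 1 = Y ** x" "x ** cyclic = Z ** x"
proof -
  have k4: "klein 4 = mat 1" by (simp add: vec_eq_iff klein_def klein_sign_def mat_def)
  obtain a P where P: "P \<in> perm_matrices" "Y = klein a ** P" using tetrahedral_decomposition[OF Y(1)] .
  have "P = mat 1"
  proof -
    have "det P = 1" using Y(4) by (simp add: P det_mul det_perm_matrices)
    then have "P = mat 1 \<or> P = cyclic \<or> P = cyclic ** cyclic"
      using P(1) by (auto simp: perm_matrices_def det_mul det_perm_matrices)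
    moreover have "(Y ** Y)$1$1 = 1" using Y(2) by (simp add: mat_def)
    ultimately show ?thesis by (auto simp: P perm_entries klein_def)
  qed
  then have Ya: "Y = klein a" by (simp add: P)
  then have "a \<noteq> 4" using Y(3) k4 by auto
  obtain b Q where Q: "Q \<in> perm_matrices" "Z = klein b ** Q" using tetrahedral_decomposition[OF Z(1)] .
  have "Q = cyclic \<or> Q = cyclic ** cyclic"
  proof -
    have "det Z * (det Z * det Z) = 1" using arg_cong[OF Z(2), of det] by (simp add: det_mul)
    then have "det Q * (det Q * det Q) = 1" by (simp add: Q det_mul det_perm_matrices)
    then have "Q = mat 1 \<or> Q = cyclic \<or> Q = cyclic ** cyclic"
      using Q(1) by (auto simp: perm_matrices_def det_mul det_perm_matrices)
    moreover have "Q \<noteq> mat 1"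
    proof
      assume "Q = mat 1"
      then have "Z = klein b" by (simp add: Q)
      moreover have "klein b ** (klein b ** klein b) = klein b"
        using klein_sign_props(1)[of b] by (simp add: vec_eq_iff klein_mult) (simp add: klein_def)
      ultimately show False using Z by simp
    qed
    ultimately show ?thesis by blast
  qed
  then show thesis
    using tetrahedral_conjugate_generators[OF \<open>a \<noteq> 4\<close>, of Q b] that by (auto simp: Ya Q)
qed

section \<open>Classification of the automorphisms\<close>

abbreviation (input) scalar_conjugate :: "real^3^3 \<Rightarrow> 'a::cstar_algebra^3^3 \<Rightarrow> 'a^3^3" where
  "scalar_conjugate x A \<equiv> transpose (scalar_matrix x) ** A ** scalar_matrix x"

lemma scalar_conjugate_entry:
  fixes M :: "'a::cstar_algebra^3^3"
  shows "scalar_conjugate x M$i$j =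
    (\<Sum>l\<in>UNIV. \<Sum>k\<in>UNIV. complex_of_real (x$k$i * x$l$j) *\<^sub>C M$k$l)"
proof -
  have "of_real r = complex_of_real r *\<^sub>C (1 :: 'a)" for r
    by (simp only: of_real_def[where 'a = 'a] scaleR_scaleC)
  then show ?thesis
    unfolding matrix_matrix_mult_def transpose_def scalar_matrix_def vec_lambda_beta sum_distrib_right
    by (intro sum.cong refl) (simp add: mult_scaleC_left mult_scaleC_right scaleC_scaleC mult.commute)
qed

lemma clinear_scalar_conjugate:
  fixes M :: "'a::cstar_algebra^3^3" and f :: "'a \<Rightarrow> complex"
  assumes "clinear_map f"
  shows "f (scalar_conjugate x M$i$j) =
    (complex_matrix (transpose x) ** (\<chi> i j. f (M$i$j)) ** complex_matrix x)$i$j"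
proof -
  have sc: "f (c *\<^sub>C y) = c * f y" for c y using assms by (simp add: clinear_map_def scaleC_complex_def)
  show ?thesis
    unfolding scalar_conjugate_entry clinear_map_sum[OF assms] sc
    by (simp add: matrix_matrix_mult_def complex_matrix_def transpose_def sum_distrib_left sum_distrib_right mult_ac)
qed

lemma star_hom_scalar_conjugate:
  fixes M :: "'a::cstar_algebra^3^3" and f :: "'a \<Rightarrow> 'c::cstar_algebra"
  assumes "star_hom f"
  shows "f (scalar_conjugate x M$i$j) =
    (transpose (scalar_matrix x) ** (\<chi> i j. f (M$i$j)) ** scalar_matrix x)$i$j"
  unfolding scalar_conjugate_entry clinear_map_sum[OF star_hom_clinear[OF assms]]
  by (simp add: star_homD[OF assms])

lemma scalar_matrix_mult: "scalar_matrix (x ** y) = (scalar_matrix x ** scalar_matrix y :: 'a::cstar_algebra^3^3)"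
  by (simp add: scalar_matrix_def matrix_matrix_mult_def vec_eq_iff)

lemma scalar_matrix_one: "scalar_matrix (mat 1) = (mat 1 :: 'a::cstar_algebra^3^3)"
  by (simp add: scalar_matrix_def vec_eq_iff mat_def)

lemma scalar_matrix_transpose: "transpose (scalar_matrix x) = (scalar_matrix (transpose x) :: 'a::cstar_algebra^3^3)"
  by (simp add: scalar_matrix_def vec_eq_iff transpose_def)

lemma complex_matrix_inject: "complex_matrix x = complex_matrix y \<longleftrightarrow> x = y"
  by (simp add: complex_matrix_def vec_eq_iff)

lemma tsum_three: "tsum tens (map (\<lambda>k. (f k, g k)) [1, 2, 3]) = (\<Sum>k\<in>(UNIV :: 3 set). tens (f k) (g k))"
  by (simp add: sum_3 add.assoc)

lemma tfun_three: "tfun \<phi> \<psi> (map (\<lambda>k. (f k, g k)) [1, 2, 3]) = (\<Sum>k\<in>(UNIV :: 3 set). \<phi> (f k) * \<psi> (g k))"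
  by (simp add: sum_3 add.assoc)

lemma automorphism_classification:
  fixes A :: "'a::cstar_algebra^3^3" and tens :: "'a \<Rightarrow> 'a \<Rightarrow> 'b::cstar_algebra"
  assumes A: "is_C_SO A" and tens: "is_min_tensor tens" and D: "is_coproduct tens A \<Delta>"
    and \<theta>: "qg_automorphism tens \<Delta> \<theta>"
  obtains x where "x \<in> tetrahedral"
    "(\<chi> i j. \<theta> (A$i$j)) = scalar_conjugate x A"
proof -
  obtain T where th: "star_hom \<theta>" "bij \<theta>" and T: "star_hom T" "\<And>x y. T (tens x y) = tens (\<theta> x) (\<theta> y)" "T \<circ> \<Delta> = \<Delta> \<circ> \<theta>"
    using \<theta> unfolding qg_automorphism_def by blast
  define B where "B = (\<chi> i j. \<theta> (A$i$j))"
  have \<Delta>B: "\<Delta> (B$i$j) = tsum tens (map (\<lambda>k. (B$i$k, B$k$j)) [1, 2, 3])" for i j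
  proof -
    have "\<Delta> (\<theta> (A$i$j)) = T (\<Delta> (A$i$j))" using T(3) by (metis comp_apply)
    also have "\<dots> = (\<Sum>k\<in>UNIV. tens (B$i$k) (B$k$j))"
      using D by (simp add: is_coproduct_def clinear_map_sum[OF star_hom_clinear[OF T(1)]] T(2) B_def)
    finally show ?thesis unfolding tsum_three by (simp add: B_def)
  qed
  define R where "R = (\<lambda>g. \<chi> i j. twisted_eval A g (B$i$j))"
  have hom: "R (g ** h) = R g ** R h" if "g \<in> rotations" "h \<in> rotations" for g h
  proof -
    have "R (g ** h)$i$j = (R g ** R h)$i$j" for i j
    proof -
      have "(R g ** R h)$i$j = tfun (twisted_eval A g) (twisted_eval A h) (map (\<lambda>k. (B$i$k, B$k$j)) [1, 2, 3])"
        unfolding tfun_three by (simp add: R_def matrix_matrix_mult_def)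
      also have "\<dots> = twisted_eval A (g ** h) (B$i$j)"
        by (rule twisted_eval_coproduct[OF tens A D that \<Delta>B])
      finally show ?thesis by (simp add: R_def)
    qed
    then show ?thesis by (simp add: vec_eq_iff)
  qed
  define m where "m = 4 * (\<Sum>i\<in>UNIV. \<Sum>j\<in>UNIV. norm (B$i$j))"
  have bound: "cmod (R g$i$j) \<le> m" if "g \<in> rotations" for g i j
  proof -
    have "norm (B$i$j) \<le> (\<Sum>j\<in>UNIV. norm (B$i$j))" by (rule member_le_sum) auto
    also have "\<dots> \<le> (\<Sum>i\<in>UNIV. \<Sum>j\<in>UNIV. norm (B$i$j))"
      by (rule member_le_sum[of i UNIV "\<lambda>i. \<Sum>j\<in>UNIV. norm (B$i$j)"]) (auto simp: sum_nonneg)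
    finally show ?thesis using norm_twisted_eval_le[OF A that, of "B$i$j"] by (simp add: R_def m_def)
  qed
  have rel: "so_relators A \<subseteq> {0}" using A by (simp add: is_C_SO_def)
  \<comment> \<open>A character composed with the automorphism is again a character, so its matrix
    is tetrahedral.\<close>
  have char: "\<exists>Y\<in>tetrahedral. R X = complex_matrix Y" if "star_hom (twisted_eval A X)" for X
  proof -
    have "so_relators (\<chi> i j. (twisted_eval A X \<circ> \<theta>) (A$i$j)) \<subseteq> {0}"
      by (rule star_hom_so_relators_zero[OF star_hom_comp[OF that th(1)] rel])
    then obtain Y where "Y \<in> tetrahedral" "(\<chi> i j. (twisted_eval A X \<circ> \<theta>) (A$i$j)) = complex_matrix Y"
      by (rule complex_matrix_relators)
    then show ?thesis by (auto simp: R_def B_def)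
  qed
  obtain Y where Y: "\<And>a. Y a \<in> tetrahedral" "\<And>a. R (klein a) = complex_matrix (Y a)"
    using char[OF star_hom_twisted_eval_klein[OF A]] by metis
  obtain Z where Z: "Z \<in> tetrahedral" "R cyclic = complex_matrix Z"
    using char[OF star_hom_twisted_eval_cyclic[OF A]] by blast
  have inv: "U = mat 1" if "U \<in> tetrahedral" "U ** U = U" for U
  proof -
    have "U = U ** U ** transpose U" using that(1) by (simp add: tetrahedral_def flip: matrix_mul_assoc)
    then show ?thesis using that by (simp add: tetrahedral_def)
  qed
  have det0: "det U \<noteq> 0" if "U \<in> tetrahedral" for U
  proof -
    have "det (U ** transpose U) = 1" using that by (simp add: tetrahedral_def)
    then show ?thesis by (auto simp: det_mul)
  qed
  note kr = klein_rotations cyclic_rotations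
  have kk: "Y a ** Y b = Y c" if "klein a ** klein b = klein c" for a b c
    using arg_cong[OF that, of R] by (simp add: hom kr Y complex_matrix_inject flip: complex_matrix_mult)
  have kc: "Z ** Y a = Y b ** Z" if "cyclic ** klein a = klein b ** cyclic" for a b
    using arg_cong[OF that, of R] by (simp add: hom kr Y Z complex_matrix_inject flip: complex_matrix_mult)
  have Y4: "Y 4 = mat 1"
    by (rule inv[OF Y(1)], rule kk) (simp add: vec_eq_iff klein_mult klein_sign_def)
  have Y11: "Y 1 ** Y 1 = mat 1"
    unfolding Y4[symmetric] by (rule kk) (simp add: vec_eq_iff forall_3 klein_mult, simp add: klein_def klein_sign_def)
  \<comment> \<open>The images of the three half-turns are conjugate by \<open>Z\<close>, so they
    share one determinant \<open>d\<close>; a product of two of them is the third, whence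
    \<open>d * d = d\<close>.\<close>
  have "det (Y 1) = 1"
  proof -
    have "Z ** Y 1 = Y 2 ** Z" "Z ** Y 2 = Y 3 ** Z"
      by (rule kc, simp add: vec_eq_iff forall_3 klein_mult perm_entries klein_def klein_sign_def)+
    from arg_cong[OF this(1), of det] arg_cong[OF this(2), of det]
    have "det (Y 1) = det (Y 2)" "det (Y 2) = det (Y 3)" using det0[OF Z(1)] by (simp_all add: det_mul)
    moreover have "Y 1 ** Y 2 = Y 3"
      by (rule kk) (simp add: vec_eq_iff forall_3 klein_mult, simp add: klein_def klein_sign_def)
    from arg_cong[OF this, of det] have "det (Y 1) * det (Y 2) = det (Y 3)" by (simp add: det_mul)
    ultimately show ?thesis using det0[OF Y(1), of 1] by auto
  qed
  have ZZ: "Z ** (Z ** Z) = mat 1"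
  proof -
    have "cyclic ** (cyclic ** cyclic) = klein 4" by (simp add: tetrahedral_simps)
    from arg_cong[OF this, of R] show ?thesis
      by (simp add: hom kr rotations_mult Y Z Y4 complex_matrix_inject flip: complex_matrix_mult)
  qed
  \<comment> \<open>Surjectivity of the automorphism enters here: equal composites with it come from
    equal characters, and those differ on the generators.\<close>
  have nontrivial: "R X \<noteq> R (klein 4)" if X: "star_hom (twisted_eval A X)" "X \<in> rotations" "X \<noteq> klein 4" for X
  proof
    assume eq: "R X = R (klein 4)"
    have "twisted_eval A X \<circ> \<theta> = twisted_eval A (klein 4) \<circ> \<theta>"
    proof (rule star_hom_eq_on_generators[OF A])
      show "(twisted_eval A X \<circ> \<theta>) (A$i$j) = (twisted_eval A (klein 4) \<circ> \<theta>) (A$i$j)" for i j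
        using eq by (simp add: R_def B_def vec_eq_iff)
    qed (intro star_hom_comp th X star_hom_twisted_eval_klein A)+
    then have "twisted_eval A X y = twisted_eval A (klein 4) y" for y
      using th(2) by (metis bij_pointE comp_apply)
    from this[of "A$i$j" for i j] have "X = klein 4"
      by (simp add: twisted_eval_gen[OF A X(2)] twisted_eval_gen[OF A klein_rotations] vec_eq_iff)
    then show False using X(3) by simp
  qed
  have ne: "klein 1 \<noteq> klein 4" "cyclic \<noteq> klein 4"
    by (simp_all add: tetrahedral_simps)
  have "Y 1 \<noteq> mat 1"
    using nontrivial[OF star_hom_twisted_eval_klein[OF A] klein_rotations ne(1)] by (metis Y(2) Y4)
  moreover have "Z \<noteq> mat 1"
    using nontrivial[OF star_hom_twisted_eval_cyclic[OF A] cyclic_rotations ne(2)] by (metis Y(2) Y4 Z(2))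
  ultimately obtain x where x: "x \<in> tetrahedral" "x ** klein 1 = Y 1 ** x" "x ** cyclic = Z ** x"
    using tetrahedral_conjugate_images[OF Y(1) Y11 _ \<open>det (Y 1) = 1\<close> Z(1) ZZ] by blast
  have xx: "transpose x ** x = mat 1" "x ** transpose x = mat 1" using x(1) by (auto simp: tetrahedral_def)
  have xx': "transpose x ** (x ** M) = M" "x ** (transpose x ** M) = M" for M :: "real^3^3"
    by (simp_all add: matrix_mul_assoc xx)
  define S where "S = (\<lambda>g. complex_matrix (transpose x) ** R g ** complex_matrix x)"
  have cx: "complex_matrix x ** (complex_matrix (transpose x) ** M) = M" for M :: "complex^3^3"
  proof -
    have "complex_matrix x ** complex_matrix (transpose x) = mat 1"
      unfolding complex_matrix_mult[symmetric] xx by (simp add: complex_matrix_def vec_eq_iff mat_def)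
    then show ?thesis by (simp add: matrix_mul_assoc)
  qed
  have Shom: "S (g ** h) = S g ** S h" if "g \<in> rotations" "h \<in> rotations" for g h
    by (simp add: S_def hom that cx flip: matrix_mul_assoc)
  have S1: "S (klein 1) = complex_matrix (klein 1)" and Sc: "S cyclic = complex_matrix cyclic"
    unfolding S_def Y Z complex_matrix_mult[symmetric] matrix_mul_assoc[symmetric] x(2,3)[symmetric] by (simp_all add: xx')
  \<comment> \<open>All half-turns are words in \<open>klein 1\<close> and \<open>cyclic\<close>, so
    matching these two images suffices.\<close>
  have kleins: "klein 2 = cyclic ** (klein 1 ** (cyclic ** cyclic))" "klein 3 = klein 1 ** klein 2" "klein 4 = klein 1 ** klein 1"
    by (simp_all add: tetrahedral_simps)
  have S2: "S (klein 2) = complex_matrix (klein 2)"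
    unfolding kleins(1) by (simp add: Shom kr rotations_mult S1 Sc complex_matrix_mult)
  have S3: "S (klein 3) = complex_matrix (klein 3)" "S (klein 4) = complex_matrix (klein 4)"
    unfolding kleins(2,3) by (simp_all add: Shom kr S1 S2 complex_matrix_mult)
  have Sk: "S (klein a) = complex_matrix (klein a)" for a
    using exhaust_4[of a] S1 S2 S3 by (elim disjE) simp_all
  have Sb: "cmod (S g$i$j) \<le> (\<Sum>l\<in>UNIV. \<Sum>k\<in>UNIV. \<bar>x$k$i\<bar> * m * \<bar>x$l$j\<bar>)" if "g \<in> rotations" for g i j
  proof -
    have "S g$i$j = (\<Sum>l\<in>UNIV. \<Sum>k\<in>UNIV. complex_of_real (x$k$i) * R g$k$l * complex_of_real (x$l$j))"
      by (simp add: S_def matrix_matrix_mult_def complex_matrix_def transpose_def sum_distrib_right)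
    also have "cmod \<dots> \<le> (\<Sum>l\<in>UNIV. \<Sum>k\<in>UNIV. \<bar>x$k$i\<bar> * m * \<bar>x$l$j\<bar>)"
      using bound[OF that] by (intro sum_norm_le) (auto simp: norm_mult intro!: mult_right_mono mult_left_mono)
    finally show ?thesis .
  qed
  \<comment> \<open>Summed over all entries as well, to provide one bound independent of
    \<open>i\<close> and \<open>j\<close>.\<close>
  define b where "b = (\<Sum>i\<in>UNIV. \<Sum>j\<in>UNIV. \<Sum>l\<in>UNIV. \<Sum>k\<in>UNIV. \<bar>x$k$i\<bar> * m * \<bar>x$l$j\<bar>)"
  have m0: "0 \<le> m" by (simp add: m_def sum_nonneg)
  have Sb': "cmod (S g$i$j) \<le> b" if "g \<in> rotations" for g i j
  proof -
    let ?f = "\<lambda>i j. \<Sum>l\<in>UNIV. \<Sum>k\<in>UNIV. \<bar>x$k$i\<bar> * m * \<bar>x$l$j\<bar>"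
    have f0: "0 \<le> ?f i j" for i j using m0 by (intro sum_nonneg mult_nonneg_nonneg) auto
    have "?f i j \<le> (\<Sum>j\<in>UNIV. ?f i j)" by (rule member_le_sum) (auto simp: f0)
    also have "\<dots> \<le> (\<Sum>i\<in>UNIV. \<Sum>j\<in>UNIV. ?f i j)"
      by (rule member_le_sum[of i UNIV "\<lambda>i. \<Sum>j\<in>UNIV. ?f i j"]) (auto intro!: sum_nonneg f0)
    finally show ?thesis using Sb[OF that, of i j] by (simp add: b_def)
  qed
  have Sg: "S g = complex_matrix g" if "g \<in> rotations" for g
    by (rule rotation_representation_rigid[of S b, OF Shom Sb' Sk Sc that])
  define C where "C = scalar_conjugate x B"
  have "C$i$j = A$i$j" for i j
  proof -
    have "C$i$j - A$i$j = 0"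
    proof (rule twisted_eval_separates[OF A])
      fix g assume g: "g \<in> rotations"
      note l = clinear_twisted_eval[OF A g]
      have "twisted_eval A g (C$i$j) = S g$i$j"
        unfolding C_def clinear_scalar_conjugate[OF l] S_def R_def ..
      also have "\<dots> = twisted_eval A g (A$i$j)"
        unfolding Sg[OF g] twisted_eval_gen[OF A g] by (simp add: complex_matrix_def)
      finally show "twisted_eval A g (C$i$j - A$i$j) = 0" by (simp add: clinear_map_diff[OF l])
    qed
    then show ?thesis by simp
  qed
  then have CA: "C = A" by (simp add: vec_eq_iff)
  \<comment> \<open>So far \<open>A\<close> is expressed by the images \<open>B\<close>;
    orthogonality of \<open>x\<close> inverts this, which turns \<open>x\<close> into its
    transpose.\<close>
  have "scalar_conjugate (transpose x) A = B"
  proof -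
    have i: "scalar_matrix x ** transpose (scalar_matrix x) = (mat 1 :: 'a^3^3)"
      unfolding scalar_matrix_transpose scalar_matrix_mult[symmetric] xx scalar_matrix_one ..
    have "scalar_conjugate (transpose x) A =
        (scalar_matrix x ** transpose (scalar_matrix x)) ** B ** (scalar_matrix x ** transpose (scalar_matrix x))"
      unfolding CA[symmetric] C_def by (simp add: scalar_matrix_transpose matrix_mul_assoc)
    then show ?thesis by (simp add: i)
  qed
  then show thesis using that[OF tetrahedral_transpose[OF x(1)]] by (simp add: B_def)
qed

section \<open>The automorphisms coming from the tetrahedral group\<close>

text \<open>The conjugation multiplies the generator \<open>(i, j)\<close> by the signs of
  \<open>i\<close> and of \<open>j\<close>. In every term of the permanent the product of all three
  signs appears twice, once for rows and once for columns, and it is 1.\<close>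

lemma so_relators_conjugate_klein:
  fixes A :: "'a::cstar_algebra^3^3"
  assumes "so_relators A \<subseteq> {0}"
  shows "so_relators (scalar_conjugate (klein a) A) \<subseteq> {0}"
proof -
  note r = so_relatorsD[OF assms]
  let ?s = "\<lambda>i. complex_of_real (klein_sign a i)"
  let ?B = "\<chi> i j. (?s i * ?s j) *\<^sub>C A$i$j"
  have ss: "?s i * ?s i = 1" for i
    using klein_sign_props(1)[of a i] by (simp flip: of_real_mult)
  have s3: "?s 1 * (?s 2 * ?s 3) = 1"
    using klein_sign_props(2)[of a] by (simp add: mult.assoc flip: of_real_mult)
  have sk: "?s k * (?s k * z) = z" for k z
    using ss[of k] by (simp flip: mult.assoc)
  have eq: "scalar_conjugate (klein a) A = ?B"
  proof -
    have "(\<Sum>l\<in>UNIV. \<Sum>k\<in>UNIV. complex_of_real (klein a$k$i * klein a$l$j) *\<^sub>C A$k$l) = (?s i * ?s j) *\<^sub>C A$i$j" for i j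
    proof -
      have "(\<Sum>l\<in>UNIV. \<Sum>k\<in>UNIV. complex_of_real (klein a$k$i * klein a$l$j) *\<^sub>C A$k$l) =
          (\<Sum>l\<in>UNIV. \<Sum>k\<in>UNIV. if k = i then (if l = j then (?s i * ?s j) *\<^sub>C A$i$j else 0) else 0)"
        by (intro sum.cong refl) (auto simp: klein_def)
      then show ?thesis by simp
    qed
    then show ?thesis unfolding vec_eq_iff scalar_conjugate_entry by simp
  qed
  have p: "?B$i$j * ?B$k$l = (?s i * ?s j * (?s k * ?s l)) *\<^sub>C (A$i$j * A$k$l)" for i j k l
    by (simp add: mult_scaleC_left mult_scaleC_right scaleC_scaleC mult_ac)
  have o: "(\<Sum>k\<in>UNIV. A$i$k * A$j$k) = mat 1$i$j" "(\<Sum>k\<in>UNIV. A$k$i * A$k$j) = mat 1$i$j" for i j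
    using r(2,3) by (simp_all add: vec_eq_iff matrix_matrix_mult_def transpose_def)
  show ?thesis unfolding eq
  proof (rule so_relatorsI)
    show "adj (?B$i$j) = ?B$i$j" for i j by (simp add: adj_scaleC r)
    have "(?B ** transpose ?B)$i$j = (?s i * ?s j) *\<^sub>C (\<Sum>k\<in>UNIV. A$i$k * A$j$k)" for i j
      by (simp add: matrix_matrix_mult_def transpose_def mult_scaleC_left mult_scaleC_right scaleC_scaleC
          scaleC_sum_right mult_ac) (simp add: sk)
    then show "?B ** transpose ?B = mat 1" by (simp add: vec_eq_iff o mat_def ss scaleC_one)
    have "(transpose ?B ** ?B)$i$j = (?s i * ?s j) *\<^sub>C (\<Sum>k\<in>UNIV. A$k$i * A$k$j)" for i j
      by (simp add: matrix_matrix_mult_def transpose_def mult_scaleC_left mult_scaleC_right scaleC_scaleC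
          scaleC_sum_right mult_ac) (simp add: sk)
    then show "transpose ?B ** ?B = mat 1" by (simp add: vec_eq_iff o mat_def ss scaleC_one)
    show "?B$i$j * ?B$i$k = - (?B$i$k * ?B$i$j)" if "k \<noteq> j" for i j k
      unfolding p r(4)[OF that] by (simp add: scaleC_minus_right mult_ac)
    show "?B$i$j * ?B$k$j = - (?B$k$j * ?B$i$j)" if "k \<noteq> i" for i j k
      unfolding p r(5)[OF that] by (simp add: scaleC_minus_right mult_ac)
    show "?B$i$j * ?B$k$l = ?B$k$l * ?B$i$j" if "i \<noteq> k" "j \<noteq> l" for i j k l
      unfolding p r(6)[OF that] by (simp add: mult_ac)
    have t: "?B$1$i * ?B$2$j * ?B$3$k = (?s 1 * (?s 2 * ?s 3) * (?s i * (?s j * ?s k))) *\<^sub>C (A$1$i * A$2$j * A$3$k)" for i j k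
      by (simp add: mult_scaleC_left mult_scaleC_right scaleC_scaleC mult_ac)
    have s3': "?s 1 * (?s 3 * ?s 2) = 1" "?s 2 * (?s 1 * ?s 3) = 1" "?s 2 * (?s 3 * ?s 1) = 1"
      "?s 3 * (?s 1 * ?s 2) = 1" "?s 3 * (?s 2 * ?s 1) = 1"
      using s3 by (simp_all add: mult_ac)
    show "permanent ?B = 1"
    proof -
      have e: "permanent ?B =
          ?B$1$1 * ?B$2$2 * ?B$3$3 + ?B$1$1 * ?B$2$3 * ?B$3$2 + ?B$1$2 * ?B$2$1 * ?B$3$3 + ?B$1$2 * ?B$2$3 * ?B$3$1 +
          ?B$1$3 * ?B$2$1 * ?B$3$2 + ?B$1$3 * ?B$2$2 * ?B$3$1"
        by (rule sum_permutations_matrix)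
      show ?thesis
        unfolding e unfolding t s3 s3' mult_1_left scaleC_one using r(7) unfolding sum_permutations_matrix .
    qed
  qed
qed

text \<open>Permuting rows and columns simultaneously preserves all relations except possibly the
  last one, where it changes the order of the factors; that one is left as a hypothesis.\<close>

lemma so_relators_permute:
  fixes A :: "'a::cstar_algebra^3^3"
  assumes A: "so_relators A \<subseteq> {0}" and \<pi>: "bij \<pi>"
    and d: "(\<Sum>\<sigma> | \<sigma> permutes (UNIV :: 3 set). A$(\<pi> 1)$(\<pi> (\<sigma> 1)) * A$(\<pi> 2)$(\<pi> (\<sigma> 2)) * A$(\<pi> 3)$(\<pi> (\<sigma> 3))) = 1"
  shows "so_relators (\<chi> i j. A$(\<pi> i)$(\<pi> j)) \<subseteq> {0}"
proof -
  note r = so_relatorsD[OF A]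
  have inj: "\<pi> i = \<pi> j \<longleftrightarrow> i = j" for i j using \<pi> by (simp add: bij_is_inj inj_eq)
  have o: "(\<Sum>k\<in>UNIV. A$i$k * A$j$k) = mat 1$i$j" "(\<Sum>k\<in>UNIV. A$k$i * A$k$j) = mat 1$i$j" for i j
    using r(2,3) by (simp_all add: vec_eq_iff matrix_matrix_mult_def transpose_def)
  have re: "(\<Sum>k\<in>UNIV. f (\<pi> k)) = (\<Sum>k\<in>UNIV. f k)" for f :: "3 \<Rightarrow> 'a"
    by (rule sum.reindex_bij_betw[OF \<pi>])
  let ?B = "\<chi> i j. A$(\<pi> i)$(\<pi> j)"
  show ?thesis
  proof (rule so_relatorsI)
    have "(?B ** transpose ?B)$i$j = mat 1$i$j" for i j
      using re[of "\<lambda>k. A$(\<pi> i)$k * A$(\<pi> j)$k"]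
      by (simp add: matrix_matrix_mult_def transpose_def o) (simp add: mat_def inj)
    then show "?B ** transpose ?B = mat 1" by (simp add: vec_eq_iff)
    have "(transpose ?B ** ?B)$i$j = mat 1$i$j" for i j
      using re[of "\<lambda>k. A$k$(\<pi> i) * A$k$(\<pi> j)"]
      by (simp add: matrix_matrix_mult_def transpose_def o) (simp add: mat_def inj)
    then show "transpose ?B ** ?B = mat 1" by (simp add: vec_eq_iff)
    show "?B$i$j * ?B$i$k = - (?B$i$k * ?B$i$j)" if "k \<noteq> j" for i j k
      using r(4)[of "\<pi> k" "\<pi> j" "\<pi> i"] that by (simp only: vec_lambda_beta inj not_False_eq_True)
    show "?B$i$j * ?B$k$j = - (?B$k$j * ?B$i$j)" if "k \<noteq> i" for i j k
      using r(5)[of "\<pi> k" "\<pi> i" "\<pi> j"] that by (simp only: vec_lambda_beta inj not_False_eq_True)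
    show "?B$i$j * ?B$k$l = ?B$k$l * ?B$i$j" if "i \<noteq> k" "j \<noteq> l" for i j k l
      using r(6)[of "\<pi> i" "\<pi> k" "\<pi> j" "\<pi> l"] that by (simp only: vec_lambda_beta inj not_False_eq_True)
  qed (simp_all add: r d)
qed

lemma so_relators_conjugate_cyclic:
  fixes A :: "'a::cstar_algebra^3^3"
  assumes A: "so_relators A \<subseteq> {0}"
  shows "so_relators (scalar_conjugate cyclic A) \<subseteq> {0}"
proof -
  note r = so_relatorsD[OF A]
  have four: "(4 :: 3) = 1" by simp
  have eq: "scalar_conjugate cyclic A = (\<chi> i j. A$(i + 1)$(j + 1))"
    unfolding vec_eq_iff scalar_conjugate_entry by (simp add: forall_3 sum_3 perm_entries scaleC_one four)
  have rot: "x * y * z = z * x * y" if "y * z = z * y" "x * z = z * x" for x y z :: 'a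
    using that by (metis mult.assoc)
  \<comment> \<open>The factors in a term of the permanent lie in different rows and columns, so
    they commute and the original order can be restored.\<close>
  have t: "A$2$i * A$3$j * A$1$k = A$1$k * A$2$i * A$3$j" if "i \<noteq> k" "j \<noteq> k" for i j k
    by (rule rot; rule r(6)) (use that in simp_all)
  have "(\<Sum>\<sigma> | \<sigma> permutes (UNIV :: 3 set). A$(1 + 1)$(\<sigma> 1 + 1) * A$(2 + 1)$(\<sigma> 2 + 1) * A$(3 + 1)$(\<sigma> 3 + 1)) =
      permanent A"
    unfolding sum_permutations_3[of "\<lambda>a b c. A$(1 + 1)$(a + 1) * A$(2 + 1)$(b + 1) * A$(3 + 1)$(c + 1)"]
      sum_permutations_matrix
    by (simp add: t four add_ac)
  moreover have "bij (\<lambda>i :: 3. i + 1)" by (rule bij_plus_right)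
  ultimately show ?thesis unfolding eq by (intro so_relators_permute[OF A]) (simp_all only: r(7))
qed

lemma so_relators_conjugate_swap12:
  fixes A :: "'a::cstar_algebra^3^3"
  assumes A: "so_relators A \<subseteq> {0}"
  shows "so_relators (scalar_conjugate swap12 A) \<subseteq> {0}"
proof -
  note r = so_relatorsD[OF A]
  define s :: "3 \<Rightarrow> 3" where "s = (\<lambda>i. if i = 1 then 2 else if i = 2 then 1 else i)"
  have s: "s 1 = 2" "s 2 = 1" "s 3 = 3" by (simp_all add: s_def)
  have eq: "scalar_conjugate swap12 A = (\<chi> i j. A$(s i)$(s j))"
    unfolding vec_eq_iff scalar_conjugate_entry by (simp add: forall_3 sum_3 perm_entries scaleC_one s)
  have t: "A$2$i * A$1$j = A$1$j * A$2$i" if "i \<noteq> j" for i j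
    by (rule r(6)) (use that in simp_all)
  have "(\<Sum>\<sigma> | \<sigma> permutes (UNIV :: 3 set). A$(s 1)$(s (\<sigma> 1)) * A$(s 2)$(s (\<sigma> 2)) * A$(s 3)$(s (\<sigma> 3))) =
      permanent A"
    unfolding sum_permutations_3[of "\<lambda>a b c. A$(s 1)$(s a) * A$(s 2)$(s b) * A$(s 3)$(s c)"]
      sum_permutations_matrix
    by (simp add: t s add_ac)
  moreover have "s \<circ> s = id" by (auto simp: s_def fun_eq_iff)
  then have "bij s" using o_bij by blast
  ultimately show ?thesis unfolding eq by (intro so_relators_permute[OF A]) (simp_all only: r(7))
qed

lemma scalar_conjugate_mult:
  fixes A :: "'a::cstar_algebra^3^3"
  shows "scalar_conjugate (x ** y) A =
    scalar_conjugate y (scalar_conjugate x A)"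
proof -
  have "transpose (scalar_matrix (x ** y)) = transpose (scalar_matrix y) ** (transpose (scalar_matrix x) :: 'a^3^3)"
    by (simp only: scalar_matrix_transpose matrix_transpose_mul) (simp only: scalar_matrix_mult)
  then show ?thesis by (simp only: scalar_matrix_mult matrix_mul_assoc)
qed

lemma so_relators_conjugate:
  fixes A :: "'a::cstar_algebra^3^3"
  assumes A: "so_relators A \<subseteq> {0}" and x: "x \<in> tetrahedral"
  shows "so_relators (scalar_conjugate x A) \<subseteq> {0}"
proof -
  obtain a P where P: "P \<in> perm_matrices" "x = klein a ** P" using tetrahedral_decomposition[OF x] .
  note k = so_relators_conjugate_klein[OF A, of a]
  note c = so_relators_conjugate_cyclic and s = so_relators_conjugate_swap12
  have one: "scalar_conjugate (mat 1) M = M" for M :: "'a^3^3"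
    by (simp add: scalar_matrix_one transpose_mat)
  show ?thesis
    using P(1) unfolding perm_matrices_def P(2) scalar_conjugate_mult[of "klein a" P]
    by (elim insertE emptyE; simp only: one scalar_conjugate_mult; intro c s k)
qed

definition conjugation :: "'a::cstar_algebra^3^3 \<Rightarrow> real^3^3 \<Rightarrow> 'a \<Rightarrow> 'a" where
  "conjugation A x = (SOME f. star_hom f \<and>
     (\<forall>i j. f (A$i$j) = scalar_conjugate x A$i$j))"

lemma conjugation:
  assumes "is_C_SO A" "x \<in> tetrahedral"
  shows "star_hom (conjugation A x)"
    "conjugation A x (A$i$j) = scalar_conjugate x A$i$j"
proof -
  have rel: "so_relators A \<subseteq> {0}" using assms(1) by (simp add: is_C_SO_def)
  obtain f where "star_hom f" "\<And>i j. f (A$i$j) = scalar_conjugate x A$i$j"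
    using universal_star_hom[OF assms(1) so_relators_conjugate[OF rel assms(2)]] by blast
  then have "\<exists>f. star_hom f \<and> (\<forall>i j. f (A$i$j) = scalar_conjugate x A$i$j)" by blast
  from someI_ex[OF this]
  show "star_hom (conjugation A x)"
    "conjugation A x (A$i$j) = scalar_conjugate x A$i$j"
    unfolding conjugation_def by auto
qed

text \<open>Scalar matrices pass through the homomorphism for \<open>x\<close>, so the conjugation
  by \<open>y\<close> ends up outside the one by \<open>x\<close>. This is the order in
  \<open>x ** y\<close>, hence a homomorphism and not an antihomomorphism.\<close>

lemma conjugation_mult:
  assumes A: "is_C_SO A" and x: "x \<in> tetrahedral" and y: "y \<in> tetrahedral"
  shows "conjugation A (x ** y) = conjugation A x \<circ> conjugation A y"
proof (rule star_hom_eq_on_generators[OF A])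
  note cx = conjugation[OF A x] and cy = conjugation[OF A y] and cxy = conjugation[OF A tetrahedral_mult[OF x y]]
  show "star_hom (conjugation A (x ** y))" by (rule cxy)
  show "star_hom (conjugation A x \<circ> conjugation A y)" by (intro star_hom_comp cx cy)
  fix i j
  have "(\<chi> i j. conjugation A x (A$i$j)) = scalar_conjugate x A"
    by (simp add: vec_eq_iff cx(2))
  then show "conjugation A (x ** y) (A$i$j) = (conjugation A x \<circ> conjugation A y) (A$i$j)"
    by (simp add: cxy(2) cy(2) star_hom_scalar_conjugate[OF cx(1)] scalar_conjugate_mult)
qed

lemma conjugation_one:
  assumes "is_C_SO A"
  shows "conjugation A (mat 1) = id"
  by (rule star_hom_eq_on_generators[OF assms conjugation(1)[OF assms tetrahedral_one] star_hom_id])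
    (simp add: conjugation(2)[OF assms tetrahedral_one] scalar_matrix_one transpose_mat)

lemma bij_conjugation:
  assumes A: "is_C_SO A" and x: "x \<in> tetrahedral"
  shows "bij (conjugation A x)"
proof (rule o_bij)
  have xx: "x ** transpose x = mat 1" "transpose x ** x = mat 1" using x by (auto simp: tetrahedral_def)
  note x' = tetrahedral_transpose[OF x]
  show "conjugation A (transpose x) \<circ> conjugation A x = id" "conjugation A x \<circ> conjugation A (transpose x) = id"
    by (simp_all add: xx conjugation_one[OF A] flip: conjugation_mult[OF A x' x] conjugation_mult[OF A x x'])
qed

section \<open>The tensor square of an automorphism, and compatibility with the coproduct\<close>

lemma tsum_tprod:
  assumes tens: "is_min_tensor tens"
  shows "tsum tens (tprod ts us) = tsum tens ts * tsum tens us"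
proof (induction ts)
  case (Cons p ts)
  obtain x y where p: "p = (x, y)" by (cases p)
  have "tsum tens (map (\<lambda>(u, v). (x * u, y * v)) us) = tens x y * tsum tens us"
    by (induction us) (auto simp: distrib_left is_min_tensorD(6)[OF tens])
  then show ?case using Cons by (simp add: p tprod_Cons distrib_right)
qed simp

lemma tsum_tadj:
  assumes "is_min_tensor tens"
  shows "tsum tens (tadj ts) = adj (tsum tens ts)"
proof (induction ts)
  case (Cons p ts)
  then show ?case by (cases p) (simp add: adj_add is_min_tensorD(7)[OF assms])
qed simp

text \<open>States pull back to states along the automorphism, so a spatial bound for a tensor is
  also one for its image. The map on algebraic tensors is therefore contractive and extends to the
  completion.\<close>

lemma tensor_map_exists:
  fixes tens :: "'a::cstar_algebra \<Rightarrow> 'a \<Rightarrow> 'b::cstar_algebra"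
  assumes tens: "is_min_tensor tens" and \<theta>: "star_hom \<theta>" "bij \<theta>"
  obtains T where "star_hom T" "\<And>x y. T (tens x y) = tens (\<theta> x) (\<theta> y)"
proof -
  let ?m = "map (\<lambda>(x, y). (\<theta> x, \<theta> y))"
  have tp: "?m (tprod ts us) = tprod (?m ts) (?m us)" for ts us
  proof (induction ts)
    case (Cons p ts)
    obtain x y where p: "p = (x, y)" by (cases p)
    have "?m (map (\<lambda>(u, v). (x * u, y * v)) us) = map (\<lambda>(u, v). (\<theta> x * u, \<theta> y * v)) (?m us)"
      by (induction us) (auto simp: star_homD[OF \<theta>(1)])
    then show ?case using Cons by (simp add: p tprod_Cons del: map_map)
  qed simp
  have ta: "?m (tadj ts) = tadj (?m ts)" for ts
    by (induction ts) (auto simp: star_homD[OF \<theta>(1)])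
  have tf: "tfun \<phi> \<psi> (?m ts) = tfun (\<phi> \<circ> \<theta>) (\<psi> \<circ> \<theta>) ts" for \<phi> \<psi> ts
    by (induction ts) auto
  have st: "state (\<phi> \<circ> \<theta>)" if "state \<phi>" for \<phi>
    using that \<theta>(1) unfolding state_def clinear_map_def star_hom_def by (metis comp_apply)
  have norm: "norm (tsum tens (?m ts)) \<le> norm (tsum tens ts)" for ts
  proof (rule is_min_tensorD(10)[OF tens])
    let ?C = "norm (tsum tens ts)"
    have sb: "spatial_bound ts ?C" by (rule is_min_tensorD(9)[OF tens])
    show "spatial_bound (?m ts) ?C"
      unfolding spatial_bound_def
    proof (intro conjI allI impI)
      fix \<phi> \<psi> :: "'a \<Rightarrow> complex" and zs :: "('a \<times> 'a) list" assume s: "state \<phi> \<and> state \<psi>"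
      \<comment> \<open>The test vector \<open>zs\<close> is arbitrary in the target, and
        surjectivity writes it as an image so that the bound for \<open>ts\<close> applies.\<close>
      define ys where "ys = map (\<lambda>(x, y). (Hilbert_Choice.inv \<theta> x, Hilbert_Choice.inv \<theta> y)) zs"
      have zs: "zs = ?m ys"
        unfolding ys_def using \<theta>(2) by (induction zs) (auto simp: bij_is_surj surj_f_inv_f)
      have "Re (tfun (\<phi> \<circ> \<theta>) (\<psi> \<circ> \<theta>) (tprod (tadj (tprod ts ys)) (tprod ts ys)))
          \<le> ?C\<^sup>2 * Re (tfun (\<phi> \<circ> \<theta>) (\<psi> \<circ> \<theta>) (tprod (tadj ys) ys))"
        using sb st s unfolding spatial_bound_def by blast
      then show "Re (tfun \<phi> \<psi> (tprod (tadj (tprod (?m ts) zs)) (tprod (?m ts) zs)))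
          \<le> ?C\<^sup>2 * Re (tfun \<phi> \<psi> (tprod (tadj zs) zs))"
        unfolding zs tf[symmetric] tp ta .
    qed simp
  qed
  define R where "R = range (\<lambda>ts. (tsum tens ts, tsum tens (?m ts)))"
  have Rt: "(tsum tens ts, tsum tens (?m ts)) \<in> R" for ts unfolding R_def by blast
  obtain T where T: "star_hom T" "\<And>x y. (x, y) \<in> R \<Longrightarrow> T x = y"
  proof (rule dense_star_hom_extension[of R])
    fix x y x' y' assume "(x, y) \<in> R" "(x', y') \<in> R"
    then obtain ts us where e: "x = tsum tens ts" "y = tsum tens (?m ts)" "x' = tsum tens us" "y' = tsum tens (?m us)"
      by (auto simp: R_def)
    show "(x + x', y + y') \<in> R" using Rt[of "ts @ us"] by (simp add: e)
    show "(x * x', y * y') \<in> R" using Rt[of "tprod ts us"] unfolding tp tsum_tprod[OF tens] e .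
  next
    fix c x y assume "(x, y) \<in> R"
    then obtain ts where e: "x = tsum tens ts" "y = tsum tens (?m ts)" by (auto simp: R_def)
    have "?m (map (\<lambda>(x, y). (c *\<^sub>C x, y)) ts) = map (\<lambda>(x, y). (c *\<^sub>C x, y)) (?m ts)"
      by (induction ts) (auto simp: star_homD[OF \<theta>(1)])
    then show "(c *\<^sub>C x, c *\<^sub>C y) \<in> R"
      using Rt[of "map (\<lambda>(x, y). (c *\<^sub>C x, y)) ts"] unfolding e by (simp only: tsum_map_scaleC[OF tens])
    show "(adj x, adj y) \<in> R" using Rt[of "tadj ts"] unfolding e ta tsum_tadj[OF tens] .
    show "norm y \<le> norm x" unfolding e by (rule norm)
  next
    show "(1, 1) \<in> R"
      using Rt[of "[(1, 1)]"] by (simp add: is_min_tensorD(5)[OF tens] star_homD[OF \<theta>(1)])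
    show "closure (fst ` R) = UNIV" using is_min_tensorD(8)[OF tens] by (simp add: R_def image_image)
  qed blast
  have "T (tens x y) = tens (\<theta> x) (\<theta> y)" for x y
    using T(2)[OF Rt[of "[(x, y)]"]] by simp
  then show thesis using that T(1) by blast
qed

lemma conjugation_automorphism:
  fixes A :: "'a::cstar_algebra^3^3" and tens :: "'a \<Rightarrow> 'a \<Rightarrow> 'b::cstar_algebra"
  assumes A: "is_C_SO A" and tens: "is_min_tensor tens" and D: "is_coproduct tens A \<Delta>" and x: "x \<in> tetrahedral"
  shows "qg_automorphism tens \<Delta> (conjugation A x)"
proof -
  let ?\<theta> = "conjugation A x"
  note \<theta> = conjugation[OF A x]
  obtain T where T: "star_hom T" "\<And>x y. T (tens x y) = tens (?\<theta> x) (?\<theta> y)"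
    using tensor_map_exists[OF tens \<theta>(1) bij_conjugation[OF A x]] by blast
  have Dh: "star_hom \<Delta>" and DA: "\<Delta> (A$i$j) = (\<Sum>k\<in>UNIV. tens (A$i$k) (A$k$j))" for i j
    using D by (auto simp: is_coproduct_def)
  note ten = is_min_tensorD[OF tens] is_min_tensor_sum[OF tens]
  have xx: "(\<Sum>m\<in>UNIV. x$l$m * x$k$m) = (if l = k then 1 else 0)" for k l
  proof -
    have "(x ** transpose x)$l$k = mat 1$l$k" using x by (simp add: tetrahedral_def)
    then show ?thesis by (simp add: matrix_matrix_mult_def transpose_def mat_def)
  qed
  have "T \<circ> \<Delta> = \<Delta> \<circ> ?\<theta>"
  proof (rule star_hom_eq_on_generators[OF A star_hom_comp[OF T(1) Dh] star_hom_comp[OF Dh \<theta>(1)]])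
    fix i j
    let ?c = "\<lambda>k q. complex_of_real (x$k$i * x$q$j)"
    have "T (\<Delta> (A$i$j)) = (\<Sum>m\<in>UNIV. \<Sum>q\<in>UNIV. \<Sum>p\<in>UNIV. \<Sum>l\<in>UNIV. \<Sum>k\<in>UNIV.
        complex_of_real (x$k$i * x$q$j * (x$l$m * x$p$m)) *\<^sub>C tens (A$k$l) (A$p$q))"
      by (simp add: DA clinear_map_sum[OF star_hom_clinear[OF T(1)]] T(2) \<theta>(2) scalar_conjugate_entry ten
          scaleC_scaleC mult_ac scaleC_sum_right)
    \<comment> \<open>The sum over the middle index of the coproduct is moved innermost, where
      \<open>x ** transpose x = mat 1\<close> collapses it to \<open>l = p\<close>.\<close>
    also have "\<dots> = (\<Sum>q\<in>UNIV. \<Sum>p\<in>UNIV. \<Sum>l\<in>UNIV. \<Sum>k\<in>UNIV. \<Sum>m\<in>UNIV.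
        complex_of_real (x$k$i * x$q$j * (x$l$m * x$p$m)) *\<^sub>C tens (A$k$l) (A$p$q))"
      by (rule trans[OF sum.swap], rule sum.cong[OF refl], rule trans[OF sum.swap], rule sum.cong[OF refl],
          rule trans[OF sum.swap], rule sum.cong[OF refl], rule sum.swap)
    also have "\<dots> = (\<Sum>q\<in>UNIV. \<Sum>p\<in>UNIV. \<Sum>l\<in>UNIV. \<Sum>k\<in>UNIV.
        complex_of_real (x$k$i * x$q$j * (\<Sum>m\<in>UNIV. x$l$m * x$p$m)) *\<^sub>C tens (A$k$l) (A$p$q))"
      by (simp only: sum_distrib_left of_real_sum scaleC_sum_left)
    also have "\<dots> = (\<Sum>q\<in>UNIV. \<Sum>p\<in>UNIV. \<Sum>l\<in>UNIV.
        if l = p then (\<Sum>k\<in>UNIV. ?c k q *\<^sub>C tens (A$k$p) (A$p$q)) else 0)"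
      unfolding xx by (intro sum.cong refl) auto
    also have "\<dots> = (\<Sum>q\<in>UNIV. \<Sum>p\<in>UNIV. \<Sum>k\<in>UNIV. ?c k q *\<^sub>C tens (A$k$p) (A$p$q))"
      by simp
    also have "\<dots> = (\<Sum>q\<in>UNIV. \<Sum>k\<in>UNIV. \<Sum>p\<in>UNIV. ?c k q *\<^sub>C tens (A$k$p) (A$p$q))"
      by (intro sum.cong[OF refl] sum.swap)
    also have "\<dots> = \<Delta> (?\<theta> (A$i$j))"
      by (simp add: \<theta>(2) scalar_conjugate_entry clinear_map_sum[OF star_hom_clinear[OF Dh]] star_homD[OF Dh] DA
          scaleC_sum_right)
    finally show "(T \<circ> \<Delta>) (A$i$j) = (\<Delta> \<circ> ?\<theta>) (A$i$j)" by simp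
  qed
  then show ?thesis
    unfolding qg_automorphism_def using \<theta>(1) bij_conjugation[OF A x] T by blast
qed

text \<open>If conjugation by \<open>z\<close> is trivial, evaluation shows that \<open>z\<close>
  commutes with all rotations. The half-turns make \<open>z\<close> diagonal and
  \<open>cyclic\<close> makes its diagonal constant; orthogonality leaves only 1 and -1, and the
  permanent excludes -1.\<close>

lemma conjugation_inj:
  assumes A: "is_C_SO A" and x: "x \<in> tetrahedral" and y: "y \<in> tetrahedral"
    and eq: "conjugation A x = conjugation A y"
  shows "x = y"
proof -
  define z where "z = x ** transpose y"
  have z: "z \<in> tetrahedral" unfolding z_def by (intro tetrahedral_mult tetrahedral_transpose x y)
  have xx: "x ** transpose x = mat 1" "y ** transpose y = mat 1" "transpose y ** y = mat 1"
    using x y by (auto simp: tetrahedral_def)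
  have zz: "z ** transpose z = mat 1" using z by (simp add: tetrahedral_def)
  have "conjugation A z = conjugation A y \<circ> conjugation A (transpose y)"
    unfolding z_def conjugation_mult[OF A x tetrahedral_transpose[OF y]] eq ..
  also have "\<dots> = conjugation A (y ** transpose y)"
    by (rule conjugation_mult[OF A y tetrahedral_transpose[OF y], symmetric])
  finally have id: "conjugation A z = id" by (simp add: xx conjugation_one[OF A])
  have comm: "g ** z = z ** g" if g: "g \<in> rotations" for g
  proof -
    note l = clinear_twisted_eval[OF A g]
    have gA: "(\<chi> i j. twisted_eval A g (A$i$j)) = complex_matrix g"
      by (simp add: vec_eq_iff twisted_eval_gen[OF A g] complex_matrix_def)
    have "(complex_matrix (transpose z) ** complex_matrix g ** complex_matrix z)$i$j = complex_matrix g$i$j" for i j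
      unfolding gA[symmetric] clinear_scalar_conjugate[OF l, symmetric] conjugation(2)[OF A z, symmetric] id
      by simp
    then have "complex_matrix (transpose z ** g ** z) = complex_matrix g"
      by (simp add: vec_eq_iff complex_matrix_mult)
    then have "transpose z ** g ** z = g" by (simp add: complex_matrix_inject)
    then have "z ** (transpose z ** g ** z) = z ** g" by simp
    then show ?thesis by (simp add: matrix_mul_assoc zz)
  qed
  have k: "klein_sign a i * z$i$j = z$i$j * klein_sign a j" for a i j
    using comm[OF klein_rotations, of a] by (simp add: vec_eq_iff klein_mult)
  have zd: "z$1$2 = 0" "z$1$3 = 0" "z$2$1 = 0" "z$2$3 = 0" "z$3$1 = 0" "z$3$2 = 0"
    using k[of 1 1 2] k[of 1 1 3] k[of 1 2 1] k[of 2 2 3] k[of 1 3 1] k[of 2 3 2]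
    by (simp_all add: klein_sign_def)
  have "z$1$1 = z$2$2" "z$2$2 = z$3$3"
    using arg_cong[OF comm[OF cyclic_rotations], of "\<lambda>M. M$2$1"]
      arg_cong[OF comm[OF cyclic_rotations], of "\<lambda>M. M$3$2"] by (simp_all add: perm_entries)
  then have ze: "z$2$2 = z$1$1" "z$3$3 = z$1$1" by (simp_all only:)
  have "z$1$1 * z$1$1 = 1"
    using arg_cong[OF zz, of "\<lambda>M. M$1$1"] by (simp add: matrix_matrix_mult_def transpose_def sum_3 zd mat_def)
  moreover have "z$1$1 * z$1$1 * z$1$1 = 1"
    using z by (simp add: tetrahedral_def sum_permutations_matrix zd ze)
  ultimately have "z$1$1 = 1" by simp
  then have "z = mat 1" by (simp add: vec_eq_iff forall_3 zd ze mat_def)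
  then have "x ** (transpose y ** y) = y" unfolding z_def by (simp add: matrix_mul_assoc)
  then show ?thesis by (simp add: xx)
qed

theorem theorem2p11:
  fixes A :: "'a::cstar_algebra^3^3"
    and tens :: "'a \<Rightarrow> 'a \<Rightarrow> 'b::cstar_algebra"
    and \<Delta> :: "'a \<Rightarrow> 'b"
  assumes "is_C_SO A"
    and "is_min_tensor tens"
    and "is_coproduct tens A \<Delta>"
  shows "(\<forall>\<theta>. qg_automorphism tens \<Delta> \<theta> \<longrightarrow>
            (\<exists>x\<in>carrier (sym_group 4).
               (\<chi> i j. \<theta> (A$i$j)) =
                 transpose (scalar_matrix (rho x)) ** A ** scalar_matrix (rho x))) \<and>
         qg_Aut tens \<Delta> \<cong> sym_group 4"
proof -
  note A = assms(1)
  have classification: "\<exists>x\<in>carrier (sym_group 4).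
      (\<chi> i j. \<theta> (A$i$j)) = transpose (scalar_matrix (rho x)) ** A ** scalar_matrix (rho x)"
    if \<theta>: "qg_automorphism tens \<Delta> \<theta>" for \<theta>
  proof -
    obtain X where X: "X \<in> tetrahedral"
      "(\<chi> i j. \<theta> (A$i$j)) = transpose (scalar_matrix X) ** A ** scalar_matrix X"
      using automorphism_classification[OF assms \<theta>] .
    obtain x where "x permutes {1..4}" "rho x = X" using rho_surj[OF X(1)] .
    then show ?thesis using X(2) by (auto simp: sym_group_carrier)
  qed
  let ?h = "\<lambda>x. conjugation A (rho x)"
  have tet: "rho x \<in> tetrahedral" if "x \<in> carrier (sym_group 4)" for x
    using that rho_tetrahedral by (simp add: sym_group_carrier)
  have "?h \<in> iso (sym_group 4) (qg_Aut tens \<Delta>)"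
    unfolding iso_iff
  proof (intro conjI)
    show "?h \<in> hom (sym_group 4) (qg_Aut tens \<Delta>)"
    proof (rule homI)
      fix x y assume xy: "x \<in> carrier (sym_group 4)" "y \<in> carrier (sym_group 4)"
      show "?h x \<in> carrier (qg_Aut tens \<Delta>)"
        using conjugation_automorphism[OF assms tet[OF xy(1)]] by (simp add: qg_Aut_def)
      show "?h (x \<otimes>\<^bsub>sym_group 4\<^esub> y) = ?h x \<otimes>\<^bsub>qg_Aut tens \<Delta>\<^esub> ?h y"
        using xy conjugation_mult[OF A tet[OF xy(1)] tet[OF xy(2)]]
        by (simp add: sym_group_mult qg_Aut_def rho_mult sym_group_carrier)
    qed
    show "inj_on ?h (carrier (sym_group 4))"
    proof (rule inj_onI)
      fix x y assume xy: "x \<in> carrier (sym_group 4)" "y \<in> carrier (sym_group 4)" "?h x = ?h y"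
      then have "rho x = rho y" using conjugation_inj[OF A tet[OF xy(1)] tet[OF xy(2)]] by blast
      then show "x = y" using xy rho_inj by (simp add: sym_group_carrier)
    qed
    show "?h ` carrier (sym_group 4) = carrier (qg_Aut tens \<Delta>)"
    proof (intro subset_antisym subsetI)
      fix \<theta> assume "\<theta> \<in> ?h ` carrier (sym_group 4)"
      then show "\<theta> \<in> carrier (qg_Aut tens \<Delta>)"
        using conjugation_automorphism[OF assms tet] by (auto simp: qg_Aut_def)
    next
      fix \<theta> assume "\<theta> \<in> carrier (qg_Aut tens \<Delta>)"
      then have \<theta>: "qg_automorphism tens \<Delta> \<theta>" by (simp add: qg_Aut_def)
      then obtain x where x: "x \<in> carrier (sym_group 4)"
        "(\<chi> i j. \<theta> (A$i$j)) = transpose (scalar_matrix (rho x)) ** A ** scalar_matrix (rho x)"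
        using classification by blast
      have "\<theta> = ?h x"
      proof (rule star_hom_eq_on_generators[OF A _ conjugation(1)[OF A tet[OF x(1)]]])
        show "star_hom \<theta>" using \<theta> by (simp add: qg_automorphism_def)
        show "\<theta> (A$i$j) = ?h x (A$i$j)" for i j
          unfolding conjugation(2)[OF A tet[OF x(1)]] x(2)[symmetric] by simp
      qed
      then show "\<theta> \<in> ?h ` carrier (sym_group 4)" using x(1) by blast
    qed
  qed
  then have "sym_group 4 \<cong> qg_Aut tens \<Delta>" unfolding is_iso_def by blast
  then have "qg_Aut tens \<Delta> \<cong> sym_group 4" by (rule group.iso_sym[OF sym_group_is_group])
  then show ?thesis using classification by blast
qed

end
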